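(* Let $n\in\mathbb{N}$, $s\in(0,1)$, $\Lambda\ge1$, $p\in(1,n/s]$, and let $\Omega\subset\mathbb{R}^n$ be open. If $u\in V^{s,p}(\Omega|\mathbb{R}^n)$ is a weak subsolution of $\mathcal{L}u=0$ in $\Omega$, then for any $x_0\in\mathbb{R}^n$, $R>0$, and $\delta\in(0,1)$, $$\mathop{\mathrm{w\text{-}sup}}_{B_{R/2}(x_0)} u_M^+ \le \delta\,\mathrm{Tail}(u_M^+;x_0,R/2)+C\delta^{-\frac{(p-1)n}{sp^2}}\left(\frac{1}{|B_R(x_0)|}\int_{B_R(x_0)}u_M^+(x)^p\,\mathrm{d}x\right)^{1/p},$$ where $M=\mathop{\mathrm{w\text{-}sup}}_{B_R(x_0)\setminus\Omega}u_+$, $u_M^+(x)=\max\{u(x),M\}$, and $C=C(n,s,p,\Lambda)>0$.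
   Context: $k:\mathbb{R}^n\times\mathbb{R}^n\to[0,\infty]$ is measurable with $k(x,y)=k(y,x)$ and $\Lambda^{-1}|x-y|^{-n-sp}\le k(x,y)\le\Lambda|x-y|^{-n-sp}$; $\mathcal{L}u(x)=2\,\mathrm{p.v.}\int_{\mathbb{R}^n}|u(x)-u(y)|^{p-2}(u(x)-u(y))k(x,y)\,\mathrm{d}y$ and $\mathcal{E}^k(u,v)=\int_{\mathbb{R}^n}\int_{\mathbb{R}^n}|u(x)-u(y)|^{p-2}(u(x)-u(y))(v(x)-v(y))k(x,y)\,\mathrm{d}y\,\mathrm{d}x$. $W^{s,p}_{\mathrm{loc}}(\Omega)$ is the local fractional Sobolev space; $L^{p-1}_{sp}(\mathbb{R}^n)=\{u\in L^{p-1}_{\mathrm{loc}}(\mathbb{R}^n):\int_{\mathbb{R}^n}|u(y)|^{p-1}(1+|y|)^{-n-sp}\,\mathrm{d}y<+\infty\}$. $V^{s,p}(\Omega|\mathbb{R}^n)=\{u:\mathbb{R}^n\to\mathbb{R}: u|_\Omega\in L^p(\Omega),\ \frac{|u(x)-u(y)|}{|x-y|^{n/p+s}}\in L^p(\Omega\times\mathbb{R}^n)\}$ with norm $\left(\int_\Omega|u|^p\,\mathrm{d}x+\int_\Omega\int_{\mathbb{R}^n}\frac{|u(x)-u(y)|^p}{|x-y|^{n+sp}}\,\mathrm{d}y\,\mathrm{d}x\right)^{1/p}$; it is contained in $W^{s,p}_{\mathrm{loc}}(\Omega)\cap L^{p-1}_{sp}(\mathbb{R}^n)$. $u\in W^{s,p}_{\mathrm{loc}}(\Omega)$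 with $u_-\in L^{p-1}_{sp}(\mathbb{R}^n)$ is a weak supersolution of $\mathcal{L}u=0$ in $\Omega$ if $\mathcal{E}^k(u,\varphi)\ge0$ for all nonnegative $\varphi\in C_c^\infty(\Omega)$; $u$ is a weak subsolution if $-u$ is a weak supersolution. For a set $T\subset\mathbb{R}^n$ and $u\in V^{s,p}(\Omega|\mathbb{R}^n)$, "$u\le0$ on $T$ in the sense of $V^{s,p}(\Omega|\mathbb{R}^n)$" means that $u_+=\max\{u,0\}$ is the limit in $V^{s,p}(\Omega|\mathbb{R}^n)$ of a sequence of $C^{0,1}(\mathbb{R}^n)$-functions with compact support in $\mathbb{R}^n\setminus T$; $u\le v$ on $T$ in this sense means $u-v\le0$. $\mathop{\mathrm{w\text{-}sup}}_T u=\inf\{\kappa\in\mathbb{R}: u\le\kappa\text{ on }T\text{ in the sense of }V^{s,p}(\Omega|\mathbb{R}^n)\}$. $\mathrm{Tail}(u;x_0,r)=\left(r^{sp}\int_{\mathbb{R}^n\setminus B_r(x_0)}\frac{|u(y)|^{p-1}}{|y-x_0|^{n+sp}}\,\mathrm{d}y\right)^{1/(p-1)}$. *)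

theory Defs
  imports "HOL-Analysis.Analysis"
begin

text \<open>
  The space \<open>\<real>\<^sup>n\<close> is a type \<open>'a::euclidean_space\<close> with \<open>n = DIM('a)\<close>; the parameters \<open>s\<close>, \<open>p\<close>
  are passed explicitly.  Measurable means Lebesgue measurable.  Double integrals are written as
  integrals over the product space (Tonelli/Fubini).
\<close>

subsection \<open>Function spaces\<close>

text \<open>On the diagonal the quotient is \<open>0 / 0 = 0\<close>; the diagonal is a null set.\<close>

definition gagliardo :: "real \<Rightarrow> real \<Rightarrow> ('a::euclidean_space \<times> 'a) set \<Rightarrow> ('a \<Rightarrow> real) \<Rightarrow> ennreal" where
  "gagliardo s p A u =
     (\<integral>\<^sup>+ z\<in>A. ennreal (\<bar>u (fst z) - u (snd z)\<bar> powr p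
                / norm (fst z - snd z) powr (real DIM('a) + s * p)) \<partial>lebesgue)"

definition Lp_energy :: "real \<Rightarrow> 'a::euclidean_space set \<Rightarrow> ('a \<Rightarrow> real) \<Rightarrow> ennreal" where
  "Lp_energy p A u = (\<integral>\<^sup>+ x\<in>A. ennreal (\<bar>u x\<bar> powr p) \<partial>lebesgue)"

definition W_loc :: "real \<Rightarrow> real \<Rightarrow> 'a::euclidean_space set \<Rightarrow> ('a \<Rightarrow> real) set" where
  "W_loc s p \<Omega> = {u. u \<in> borel_measurable lebesgue \<and>
     (\<forall>G. open G \<and> compact (closure G) \<and> closure G \<subseteq> \<Omega> \<longrightarrow>
        Lp_energy p G u < \<infinity> \<and> gagliardo s p (G \<times> G) u < \<infinity>)}"

definition L_tail :: "real \<Rightarrow> real \<Rightarrow> ('a::euclidean_space \<Rightarrow> real) set" where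
  "L_tail s p = {u. u \<in> borel_measurable lebesgue \<and>
     (\<forall>K. compact K \<longrightarrow> Lp_energy (p - 1) K u < \<infinity>) \<and>
     (\<integral>\<^sup>+ y. ennreal (\<bar>u y\<bar> powr (p - 1) * (1 + norm y) powr (- real DIM('a) - s * p)) \<partial>lebesgue) < \<infinity>}"

definition V_space :: "real \<Rightarrow> real \<Rightarrow> 'a::euclidean_space set \<Rightarrow> ('a \<Rightarrow> real) set" where
  "V_space s p \<Omega> = {u. u \<in> borel_measurable lebesgue \<and>
     Lp_energy p \<Omega> u < \<infinity> \<and> gagliardo s p (\<Omega> \<times> UNIV) u < \<infinity>}"

text \<open>Meaningful for members of \<open>V_space\<close> only, since \<open>enn2real \<infinity> = 0\<close>.\<close>

definition V_norm :: "real \<Rightarrow> real \<Rightarrow> 'a::euclidean_space set \<Rightarrow> ('a \<Rightarrow> real) \<Rightarrow> real" where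
  "V_norm s p \<Omega> u = enn2real (Lp_energy p \<Omega> u + gagliardo s p (\<Omega> \<times> UNIV) u) powr (1 / p)"

subsection \<open>Kernels and weak solutions\<close>

text \<open>The two-sided bound is imposed off the diagonal, where \<open>|x - y|\<close> to a negative power is finite
  (HOL's \<open>0 powr a\<close> is \<open>0\<close>, not \<open>\<infinity>\<close>); no condition is imposed on the null set \<open>x = y\<close>.\<close>

definition admissible_kernel ::
    "real \<Rightarrow> real \<Rightarrow> real \<Rightarrow> ('a::euclidean_space \<Rightarrow> 'a \<Rightarrow> ennreal) \<Rightarrow> bool" where
  "admissible_kernel s p \<Lambda> k \<longleftrightarrow>
     (\<lambda>z. k (fst z) (snd z)) \<in> borel_measurable lebesgue \<and>
     (\<forall>x y. k x y = k y x) \<and>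
     (\<forall>x y. x \<noteq> y \<longrightarrow>
        ennreal (inverse \<Lambda> * norm (x - y) powr (- real DIM('a) - s * p)) \<le> k x y \<and>
        k x y \<le> ennreal (\<Lambda> * norm (x - y) powr (- real DIM('a) - s * p)))"

text \<open>\<open>energy p k u v\<close> is the integral of \<open>F k\<close> with \<open>F = energy_diff p u v\<close>, as positive part minus
  negative part (\<open>ennreal\<close> maps negative numbers to \<open>0\<close>).  It is extended-real-valued because,
  for \<open>u\<close> merely locally Sobolev with \<open>u\<^sub>- \<in> L_tail\<close> and a nonnegative test function \<open>v\<close>, only the
  positive part is known to be finite: the value may be \<open>-\<infinity>\<close>.\<close>

definition energy_diff :: "real \<Rightarrow> ('a \<Rightarrow> real) \<Rightarrow> ('a \<Rightarrow> real) \<Rightarrow> 'a \<Rightarrow> 'a \<Rightarrow> real" where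
  "energy_diff p u v x y = \<bar>u x - u y\<bar> powr (p - 2) * (u x - u y) * (v x - v y)"

definition energy ::
    "real \<Rightarrow> ('a::euclidean_space \<Rightarrow> 'a \<Rightarrow> ennreal) \<Rightarrow> ('a \<Rightarrow> real) \<Rightarrow> ('a \<Rightarrow> real) \<Rightarrow> ereal" where
  "energy p k u v =
     enn2ereal (\<integral>\<^sup>+ z. ennreal (energy_diff p u v (fst z) (snd z)) * k (fst z) (snd z) \<partial>lebesgue)
   - enn2ereal (\<integral>\<^sup>+ z. ennreal (- energy_diff p u v (fst z) (snd z)) * k (fst z) (snd z) \<partial>lebesgue)"

primrec Ck :: "nat \<Rightarrow> ('a::euclidean_space \<Rightarrow> real) \<Rightarrow> bool" where
  "Ck 0 f \<longleftrightarrow> continuous_on UNIV f"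
| "Ck (Suc m) f \<longleftrightarrow> (\<forall>x. f differentiable (at x)) \<and>
     (\<forall>i\<in>Basis. Ck m (\<lambda>x. frechet_derivative f (at x) i))"

definition supp :: "('a::euclidean_space \<Rightarrow> real) \<Rightarrow> 'a set" where
  "supp f = closure {x. f x \<noteq> 0}"

definition test_functions :: "'a::euclidean_space set \<Rightarrow> ('a \<Rightarrow> real) set" where
  "test_functions \<Omega> = {\<phi>. (\<forall>m. Ck m \<phi>) \<and> compact (supp \<phi>) \<and> supp \<phi> \<subseteq> \<Omega>}"

definition weak_supersolution ::
    "real \<Rightarrow> real \<Rightarrow> ('a::euclidean_space \<Rightarrow> 'a \<Rightarrow> ennreal) \<Rightarrow> 'a set \<Rightarrow> ('a \<Rightarrow> real) \<Rightarrow> bool" where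
  "weak_supersolution s p k \<Omega> u \<longleftrightarrow>
     u \<in> W_loc s p \<Omega> \<and> (\<lambda>x. max (- u x) 0) \<in> L_tail s p \<and>
     (\<forall>\<phi>\<in>test_functions \<Omega>. (\<forall>x. 0 \<le> \<phi> x) \<longrightarrow> 0 \<le> energy p k u \<phi>)"

definition weak_subsolution ::
    "real \<Rightarrow> real \<Rightarrow> ('a::euclidean_space \<Rightarrow> 'a \<Rightarrow> ennreal) \<Rightarrow> 'a set \<Rightarrow> ('a \<Rightarrow> real) \<Rightarrow> bool" where
  "weak_subsolution s p k \<Omega> u \<longleftrightarrow> weak_supersolution s p k \<Omega> (\<lambda>x. - u x)"

subsection \<open>Inequalities and suprema in the sense of \<open>V\<close>\<close>

text \<open>The function \<open>f\<close> is extended-real-valued because it is applied to truncations \<open>max {u, M}\<close> in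
  which \<open>M\<close> may be \<open>\<infinity>\<close>.  Only the positive part of \<open>f\<close> is required to lie in \<open>V\<close>: the notion is
  applied to \<open>f - \<kappa>\<close>, which is not in \<open>V\<close> if \<open>\<Omega>\<close> has infinite measure and \<open>\<kappa> \<noteq> 0\<close>.\<close>

definition V_le0_on :: "real \<Rightarrow> real \<Rightarrow> 'a::euclidean_space set \<Rightarrow> 'a set \<Rightarrow> ('a \<Rightarrow> ereal) \<Rightarrow> bool" where
  "V_le0_on s p \<Omega> T f \<longleftrightarrow>
     (\<exists>g\<in>V_space s p \<Omega>. (\<forall>x. ereal (g x) = max (f x) 0) \<and>
        (\<exists>\<phi> :: nat \<Rightarrow> 'a \<Rightarrow> real.
           (\<forall>j. \<phi> j \<in> V_space s p \<Omega> \<and> (\<exists>L. L-lipschitz_on UNIV (\<phi> j)) \<and>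
                compact (supp (\<phi> j)) \<and> supp (\<phi> j) \<subseteq> - T) \<and>
           (\<lambda>j. V_norm s p \<Omega> (\<lambda>x. g x - \<phi> j x)) \<longlonglongrightarrow> 0))"

definition wsup :: "real \<Rightarrow> real \<Rightarrow> 'a::euclidean_space set \<Rightarrow> 'a set \<Rightarrow> ('a \<Rightarrow> ereal) \<Rightarrow> ereal" where
  "wsup s p \<Omega> T f = Inf {ereal \<kappa> |\<kappa>. V_le0_on s p \<Omega> T (\<lambda>x. f x - ereal \<kappa>)}"

text \<open>The number \<open>M\<close>.  The supremum of the nonnegative function \<open>u\<^sub>+\<close> is taken in \<open>[0, \<infinity>]\<close>, so that
  \<open>M = 0\<close> when \<open>B\<^sub>R(x\<^sub>0) - \<Omega>\<close> is empty or negligible; there the infimum over all real levels can be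
  \<open>-\<infinity>\<close>.  Hence \<open>max {u, M}\<close> is nonnegative and its real powers make sense.\<close>

definition exterior_sup :: "real \<Rightarrow> real \<Rightarrow> 'a::euclidean_space set \<Rightarrow> 'a \<Rightarrow> real \<Rightarrow> ('a \<Rightarrow> real) \<Rightarrow> ereal" where
  "exterior_sup s p \<Omega> x0 R u = max 0 (wsup s p \<Omega> (ball x0 R - \<Omega>) (\<lambda>x. ereal (max (u x) 0)))"

definition upper_trunc :: "('a \<Rightarrow> real) \<Rightarrow> ereal \<Rightarrow> 'a \<Rightarrow> ereal" where
  "upper_trunc u M x = max (ereal (u x)) M"

subsection \<open>Tail\<close>

text \<open>Real powers on \<open>[0, \<infinity>]\<close>, used for positive exponents only.\<close>

definition epowr :: "ennreal \<Rightarrow> real \<Rightarrow> ennreal" where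
  "epowr t a = (if t = \<infinity> then \<infinity> else ennreal (enn2real t powr a))"

definition Tail :: "real \<Rightarrow> real \<Rightarrow> ('a::euclidean_space \<Rightarrow> ereal) \<Rightarrow> 'a \<Rightarrow> real \<Rightarrow> ennreal" where
  "Tail s p f x0 r =
     epowr (ennreal (r powr (s * p)) *
            (\<integral>\<^sup>+ y\<in>- ball x0 r. epowr (e2ennreal \<bar>f y\<bar>) (p - 1)
               * ennreal (norm (y - x0) powr (- real DIM('a) - s * p)) \<partial>lebesgue))
           (1 / (p - 1))"

definition ball_mean :: "real \<Rightarrow> ('a::euclidean_space \<Rightarrow> ereal) \<Rightarrow> 'a \<Rightarrow> real \<Rightarrow> ennreal" where
  "ball_mean p f x0 r =
     epowr ((\<integral>\<^sup>+ x\<in>ball x0 r. epowr (e2ennreal (f x)) p \<partial>lebesgue) / emeasure lebesgue (ball x0 r))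
           (1 / p)"

end

theory Submission
  imports Defs
begin

text \<open>
  The proof is De Giorgi's level set method.  Let \<open>l > M\<close>.  By the definition of \<open>M\<close>, the truncation
  \<open>(u\<^sub>+ - \<kappa>)\<^sub>+\<close> for some \<open>\<kappa> < l\<close> is a limit in \<open>V\<close> of Lipschitz functions vanishing near
  \<open>B\<^sub>R - \<Omega>\<close>.  Multiplied by a cutoff with support in \<open>B\<^sub>R\<close> these become test functions after
  mollification, so \<open>\<eta>\<^sup>p (u - l)\<^sub>+\<close> may be inserted into the equation although \<open>B\<^sub>R\<close> may leave \<open>\<Omega>\<close>.
  This gives a Caccioppoli inequality with a tail term.  In place of the Sobolev inequality we use the
  elementary bound \<open>\<integral>|f|\<^sup>p \<le> C |{f \<noteq> 0}|\<^bsup>sp/n\<^esup> [f]\<^sup>p\<close> (compare \<open>f(x)\<close> with the zeros of \<open>f\<close> in a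
  ball about \<open>x\<close> of volume \<open>2 |{f \<noteq> 0}|\<close>); it is enough for the iteration over levels and radii, and it
  also covers \<open>sp = n\<close>.  The resulting almost everywhere bound on \<open>B\<^bsub>3R/4\<^esub>\<close> is a bound in the sense of \<open>V\<close>
  on \<open>B\<^bsub>R/2\<^esub>\<close>, because the same Lipschitz functions, truncated and cut off inside \<open>B\<^bsub>3R/4\<^esub>\<close>,
  approximate \<open>(u - l)\<^sub>+\<close>.
\<close>


subsection \<open>Elementary inequalities\<close>

text \<open>The norm of \<open>V_space\<close> sees values only in \<Omega> and differences only for
  pairs with a point in \<Omega>, whereas test functions and tails live on all of R^n. Convergence
  outside \<Omega> is therefore recovered from differences with one fixed point of \<Omega>, and
  majorants are arranged so that absolute values enter only at the point in \<Omega>. The weak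
  inequality compares two integrals in [0, \<infinity>] and can be rearranged only if one of them is
  finite; hence finiteness is carried along in \<open>tested\<close>. The infimum behind M need not
  be attained, so all levels stay above M by some \<epsilon> > 0, and the result follows for every
  level strictly above the right-hand side. Origin of the power of \<delta>: the increment h of the
  levels is at least \<delta> times the tail, so the tail term costs a factor \<delta>^(1-p) in each
  step. The gain exponent of the iteration is sp/n, so the initial L^p energy must be small like
  \<delta>^((p-1)n/(sp)) h^p; solving for h takes a p-th root and gives the exponent
  -(p-1)n/(sp^2).\<close>

lemma powr_tangent:
  fixes p s t :: real
  assumes "1 \<le> p" "0 \<le> t" "t \<le> s"
  shows "s powr p - t powr p \<le> p * s powr (p - 1) * (s - t)"
proof (cases "t = 0 \<or> t = s")
  case True
  then show ?thesis
  proof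
    assume t: "t = 0"
    show ?thesis
    proof (cases "s = 0")
      case False
      then have "s powr p = s powr (p - 1) * s"
        using assms powr_mult_base[of s "p - 1"] by (simp add: mult.commute)
      then show ?thesis using assms t mult_right_mono[of 1 p "s powr p"] by (simp add: mult.assoc)
    qed (use t in auto)
  qed auto
next
  case False
  with assms have ts: "0 < t" "t < s" by auto
  have "\<exists>z. t < z \<and> z < s \<and> s powr p - t powr p = (s - t) * (p * z powr (p - 1))"
    using ts by (intro MVT2) (auto intro!: derivative_eq_intros)
  then obtain z where z: "t < z" "z < s" "s powr p - t powr p = (s - t) * (p * z powr (p - 1))"
    by auto
  have "z powr (p - 1) \<le> s powr (p - 1)" using z ts assms by (intro powr_mono2) auto
  then have "(s - t) * (p * z powr (p - 1)) \<le> (s - t) * (p * s powr (p - 1))"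
    using ts assms by (intro mult_left_mono) auto
  then show ?thesis using z(3) by (simp add: mult_ac)
qed

text \<open>Compare X with 2pY. If X is larger, then pY is at most X/2 and the product is absorbed;
  otherwise X is replaced by 2pY, which produces the constant p(2p)^(p-1).\<close>

lemma powr_Young:
  fixes p X Y :: real
  assumes "1 < p" "0 \<le> X" "0 \<le> Y"
  shows "p * X powr (p - 1) * Y \<le> X powr p / 2 + p * (2 * p) powr (p - 1) * Y powr p"
proof -
  have split: "t powr p = t powr (p - 1) * t" if "0 \<le> t" for t :: real
    using that assms powr_mult_base[of t "p - 1"] by (cases "t = 0") (auto simp: mult.commute)
  have nonneg: "0 \<le> p * (2 * p) powr (p - 1) * Y powr p" using assms by auto
  show ?thesis
  proof (cases "2 * p * Y \<le> X")
    case True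
    then have "X powr (p - 1) * (2 * p * Y) \<le> X powr (p - 1) * X" by (intro mult_left_mono) auto
    then have "p * X powr (p - 1) * Y \<le> X powr p / 2" using split[of X] assms by (simp add: mult_ac)
    then show ?thesis using nonneg by linarith
  next
    case False
    then have "X powr (p - 1) \<le> (2 * p * Y) powr (p - 1)" using assms by (intro powr_mono2) auto
    also have "\<dots> = (2 * p) powr (p - 1) * Y powr (p - 1)" using assms by (simp add: powr_mult)
    finally have "p * Y * X powr (p - 1) \<le> p * Y * ((2 * p) powr (p - 1) * Y powr (p - 1))"
      using assms by (intro mult_left_mono) auto
    then have "p * X powr (p - 1) * Y \<le> p * (2 * p) powr (p - 1) * Y powr p"
      using split[of Y] assms by (simp add: mult_ac)
    moreover have "0 \<le> X powr p / 2" by simp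
    ultimately show ?thesis by linarith
  qed
qed

lemma powr_add_le:
  fixes p a b :: real
  assumes "0 \<le> p" "0 \<le> a" "0 \<le> b"
  shows "(a + b) powr p \<le> 2 powr p * (a powr p + b powr p)"
proof -
  have "(a + b) powr p \<le> (2 * max a b) powr p" using assms by (intro powr_mono2) auto
  also have "\<dots> = 2 powr p * max a b powr p" using assms by (simp add: powr_mult)
  also have "\<dots> \<le> 2 powr p * (a powr p + b powr p)" by (intro mult_left_mono) (auto simp: max_def)
  finally show ?thesis .
qed

lemma powr_minus_one_mult_le:
  fixes p a b :: real
  assumes "1 < p" "0 \<le> a" "0 \<le> b"
  shows "a powr (p - 1) * b \<le> a powr p + b powr p"
proof -
  have split: "t powr p = t powr (p - 1) * t" if "0 \<le> t" for t :: real
    using that assms powr_mult_base[of t "p - 1"] by (cases "t = 0") (auto simp: mult.commute)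
  have "a powr (p - 1) * b \<le> max a b powr (p - 1) * max a b"
    using assms by (intro mult_mono powr_mono2) auto
  also have "\<dots> = max a b powr p" using split[of "max a b"] assms by simp
  also have "\<dots> \<le> a powr p + b powr p" by (auto simp: max_def)
  finally show ?thesis .
qed

section \<open>Pointwise inequalities behind the Caccioppoli estimate\<close>

definition Caccioppoli_const :: "real \<Rightarrow> real" where
  "Caccioppoli_const p = 2 powr p * (2 * (p * (2 * p) powr (p - 1)) + 1)"

lemma Caccioppoli_const_pos: "1 < p \<Longrightarrow> 0 < Caccioppoli_const p"
  unfolding Caccioppoli_const_def by (intro mult_pos_pos add_nonneg_pos) auto

text \<open>If the cutoff is not smaller at the larger value A, the energy integrand has the right
  sign and dominates (\<tau>(A - B))^p. Otherwise the p-th power on the cutoff pays off: the error p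
  \<sigma>^(p-1) (\<sigma> - \<tau>) A carries exactly the power \<sigma>^(p-1) that
  \<open>powr_Young\<close> needs to hide it in ((A - B)\<sigma>)^p.\<close>

lemma Caccioppoli_ordered:
  fixes p A B \<tau> \<sigma> :: real
  assumes "1 < p" "0 \<le> B" "B \<le> A" "0 \<le> \<tau>" "0 \<le> \<sigma>"
  shows "\<bar>\<tau> * A - \<sigma> * B\<bar> powr p
    \<le> 2 powr (p + 1) * ((A - B) powr (p - 1) * (\<tau> powr p * A - \<sigma> powr p * B))
      + Caccioppoli_const p * (A powr p * \<bar>\<tau> - \<sigma>\<bar> powr p)"
proof -
  define D where "D = (A - B) powr (p - 1) * (\<tau> powr p * A - \<sigma> powr p * B)"
  define Z where "Z = A powr p * \<bar>\<tau> - \<sigma>\<bar> powr p"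
  define c where "c = p * (2 * p) powr (p - 1)"
  have c: "0 \<le> c" using assms by (simp add: c_def)
  have Z: "0 \<le> Z" by (simp add: Z_def)
  have split: "t powr p = t powr (p - 1) * t" if "0 \<le> t" for t :: real
    using that assms powr_mult_base[of t "p - 1"] by (cases "t = 0") (auto simp: mult.commute)
  have two: "2 powr (p + 1) = 2 * 2 powr p" by (simp add: powr_add)
  have Cc: "Caccioppoli_const p = 2 powr p * (2 * c + 1)" by (simp add: Caccioppoli_const_def c_def)
  show ?thesis
  proof (cases "\<sigma> \<le> \<tau>")
    case True
    have "\<sigma> powr p * B \<le> \<tau> powr p * B" using True assms by (intro mult_right_mono powr_mono2) auto
    then have "(A - B) powr (p - 1) * (\<tau> powr p * (A - B)) \<le> D"
      unfolding D_def by (intro mult_left_mono) (auto simp: algebra_simps)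
    moreover have "(\<tau> * (A - B)) powr p = (A - B) powr (p - 1) * (\<tau> powr p * (A - B))"
      using split[of "A - B"] assms by (simp add: powr_mult)
    ultimately have D1: "(\<tau> * (A - B)) powr p \<le> D" by simp
    have D0: "0 \<le> D" using D1 powr_ge_zero[of "\<tau> * (A - B)" p] by linarith
    have "\<bar>\<tau> * A - \<sigma> * B\<bar> = \<tau> * (A - B) + B * (\<tau> - \<sigma>)"
      using True assms mult_mono[of \<sigma> \<tau> B A] by (simp add: algebra_simps)
    also have "\<dots> powr p \<le> 2 powr p * ((\<tau> * (A - B)) powr p + (B * (\<tau> - \<sigma>)) powr p)"
      using assms True by (intro powr_add_le) auto
    also have "(B * (\<tau> - \<sigma>)) powr p \<le> Z"
      unfolding Z_def using assms True by (auto simp: powr_mult intro!: mult_mono powr_mono2)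
    also have "(\<tau> * (A - B)) powr p \<le> D" by (rule D1)
    finally have "\<bar>\<tau> * A - \<sigma> * B\<bar> powr p \<le> 2 powr p * (D + Z)" by simp
    also have "\<dots> \<le> 2 powr p * (2 * D + (2 * c + 1) * Z)"
      using D0 Z c by (intro mult_left_mono) (auto simp: algebra_simps)
    also have "\<dots> = 2 powr (p + 1) * D + Caccioppoli_const p * Z" unfolding two Cc by (simp add: algebra_simps)
    finally show ?thesis by (simp add: D_def Z_def)
  next
    case False
    let ?S = "(A - B) * \<sigma>" and ?W = "(\<sigma> - \<tau>) * A"
    have "\<sigma> powr p - \<tau> powr p \<le> p * \<sigma> powr (p - 1) * (\<sigma> - \<tau>)"
      using False assms by (intro powr_tangent) auto
    then have "(A - B) powr (p - 1) * ((\<sigma> powr p - \<tau> powr p) * A)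
        \<le> (A - B) powr (p - 1) * ((p * \<sigma> powr (p - 1) * (\<sigma> - \<tau>)) * A)"
      using assms by (intro mult_left_mono mult_right_mono) auto
    also have "\<dots> = p * ?S powr (p - 1) * ?W" using assms by (simp add: powr_mult mult_ac)
    also have "\<dots> \<le> ?S powr p / 2 + c * ?W powr p"
      unfolding c_def using assms False by (intro powr_Young) auto
    also have "?W powr p = Z" unfolding Z_def using assms False by (simp add: powr_mult mult.commute)
    finally have Y: "(A - B) powr (p - 1) * ((\<sigma> powr p - \<tau> powr p) * A) \<le> ?S powr p / 2 + c * Z" .
    have "D = ?S powr p - (A - B) powr (p - 1) * ((\<sigma> powr p - \<tau> powr p) * A)"
    proof -
      have "?S powr p = (A - B) powr (p - 1) * (A - B) * \<sigma> powr p"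
        using split[of "A - B"] assms by (simp add: powr_mult)
      then show ?thesis unfolding D_def by (simp add: algebra_simps)
    qed
    with Y have D1: "?S powr p \<le> 2 * D + 2 * c * Z" by simp
    have "\<tau> * A - \<sigma> * B = ?S - ?W" by (simp add: algebra_simps)
    moreover have "0 \<le> ?S" "0 \<le> ?W" using assms False by auto
    ultimately have "\<bar>\<tau> * A - \<sigma> * B\<bar> \<le> ?S + ?W" by linarith
    then have "\<bar>\<tau> * A - \<sigma> * B\<bar> powr p \<le> (?S + ?W) powr p" using assms by (intro powr_mono2) auto
    also have "\<dots> \<le> 2 powr p * (?S powr p + ?W powr p)"
      using assms False by (intro powr_add_le) auto
    also have "\<dots> \<le> 2 powr p * (2 * D + 2 * c * Z + Z)"
      using D1 \<open>?W powr p = Z\<close> by (intro mult_left_mono) auto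
    also have "\<dots> = 2 powr (p + 1) * D + Caccioppoli_const p * Z" unfolding two Cc by (simp add: algebra_simps)
    finally show ?thesis by (simp add: D_def Z_def)
  qed
qed

text \<open>Truncation changes the difference only if b <= k. Then B = 0, the last factor is
  nonnegative, and A <= a - b, so truncating can only lower the product.\<close>

lemma powr_diff_ge_truncated:
  fixes p a b k \<tau> \<sigma> :: real
  assumes "1 < p" "b \<le> a" "0 \<le> \<tau>"
  defines "A \<equiv> max (a - k) 0" and "B \<equiv> max (b - k) 0"
  shows "(A - B) powr (p - 1) * (\<tau> powr p * A - \<sigma> powr p * B)
    \<le> \<bar>a - b\<bar> powr (p - 2) * (a - b) * (\<tau> powr p * A - \<sigma> powr p * B)"
proof -
  have X: "\<bar>a - b\<bar> powr (p - 2) * (a - b) = (a - b) powr (p - 1)"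
    using assms powr_mult_base[of "a - b" "p - 2"] by (cases "a = b") (auto simp: mult.commute)
  show ?thesis
  proof (cases "k < b")
    case True
    then have "A - B = a - b" using assms by (auto simp: A_def B_def)
    then show ?thesis using X by simp
  next
    case False
    then have B: "B = 0" by (simp add: B_def)
    show ?thesis
    proof (cases "k < a")
      case True
      then have "A powr (p - 1) \<le> (a - b) powr (p - 1)"
        using False assms by (intro powr_mono2) (auto simp: A_def)
      then show ?thesis using X B assms by (auto simp: A_def intro!: mult_right_mono)
    qed (use B in \<open>auto simp: A_def\<close>)
  qed
qed

lemma Caccioppoli_pointwise:
  fixes p a b k \<tau> \<sigma> :: real
  assumes "1 < p" "0 \<le> \<tau>" "0 \<le> \<sigma>"
  defines "A \<equiv> max (a - k) 0" and "B \<equiv> max (b - k) 0"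
  shows "\<bar>\<tau> * A - \<sigma> * B\<bar> powr p
    \<le> 2 powr (p + 1) * (\<bar>a - b\<bar> powr (p - 2) * (a - b) * (\<tau> powr p * A - \<sigma> powr p * B))
      + Caccioppoli_const p * ((A powr p + B powr p) * \<bar>\<tau> - \<sigma>\<bar> powr p)"
proof -
  have *: "\<bar>\<tau> * A - \<sigma> * B\<bar> powr p
    \<le> 2 powr (p + 1) * (\<bar>a - b\<bar> powr (p - 2) * (a - b) * (\<tau> powr p * A - \<sigma> powr p * B))
      + Caccioppoli_const p * ((A powr p + B powr p) * \<bar>\<tau> - \<sigma>\<bar> powr p)"
    if "b \<le> a" "0 \<le> \<tau>" "0 \<le> \<sigma>" "A = max (a - k) 0" "B = max (b - k) 0" for a b \<tau> \<sigma> A B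
  proof -
    have "\<bar>\<tau> * A - \<sigma> * B\<bar> powr p
      \<le> 2 powr (p + 1) * ((A - B) powr (p - 1) * (\<tau> powr p * A - \<sigma> powr p * B))
        + Caccioppoli_const p * (A powr p * \<bar>\<tau> - \<sigma>\<bar> powr p)"
      using that assms(1) by (intro Caccioppoli_ordered) auto
    also have "\<dots> \<le> 2 powr (p + 1) * (\<bar>a - b\<bar> powr (p - 2) * (a - b) * (\<tau> powr p * A - \<sigma> powr p * B))
      + Caccioppoli_const p * ((A powr p + B powr p) * \<bar>\<tau> - \<sigma>\<bar> powr p)"
    proof (rule add_mono)
      show "2 powr (p + 1) * ((A - B) powr (p - 1) * (\<tau> powr p * A - \<sigma> powr p * B))
        \<le> 2 powr (p + 1) * (\<bar>a - b\<bar> powr (p - 2) * (a - b) * (\<tau> powr p * A - \<sigma> powr p * B))"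
        unfolding that(4,5) by (intro mult_left_mono powr_diff_ge_truncated that assms) auto
      show "Caccioppoli_const p * (A powr p * \<bar>\<tau> - \<sigma>\<bar> powr p) \<le> Caccioppoli_const p * ((A powr p + B powr p) * \<bar>\<tau> - \<sigma>\<bar> powr p)"
        using Caccioppoli_const_pos[OF assms(1)] by (intro mult_left_mono mult_right_mono) auto
    qed
    finally show ?thesis .
  qed
  show ?thesis
  proof (cases "b \<le> a")
    case True
    then show ?thesis using *[of b a \<tau> \<sigma> A B] assms by simp
  next
    case False
    then have "\<bar>\<sigma> * B - \<tau> * A\<bar> powr p
    \<le> 2 powr (p + 1) * (\<bar>b - a\<bar> powr (p - 2) * (b - a) * (\<sigma> powr p * B - \<tau> powr p * A))
      + Caccioppoli_const p * ((B powr p + A powr p) * \<bar>\<sigma> - \<tau>\<bar> powr p)"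
      using *[of a b \<sigma> \<tau> B A] assms by simp
    moreover have "(b - a) * (\<sigma> powr p * B - \<tau> powr p * A) = (a - b) * (\<tau> powr p * A - \<sigma> powr p * B)"
      by (simp add: algebra_simps)
    ultimately show ?thesis
      by (simp only: abs_minus_commute[of b a] abs_minus_commute[of \<sigma> \<tau>] mult.assoc
          abs_minus_commute[of "\<sigma> * B"] add.commute[of "B powr p"])
  qed
qed

text \<open>For pairs with the second point outside the support of the cutoff. The integrand is
  negative only for k < a < b, and there b - a <= b - k, so the loss is a tail term of the
  truncation at the second point.\<close>

lemma Caccioppoli_pointwise_exterior:
  fixes p a b k t :: real
  assumes "1 < p" "0 \<le> t"
  defines "A \<equiv> max (a - k) 0" and "B \<equiv> max (b - k) 0"
  shows "- (\<bar>a - b\<bar> powr (p - 2) * (a - b) * (t * A)) \<le> B powr (p - 1) * (t * A)"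
proof (cases "k < a \<and> a < b")
  case True
  have "\<bar>a - b\<bar> powr (p - 2) * (a - b) = - ((b - a) powr (p - 1))"
    using True powr_mult_base[of "b - a" "p - 2"] by (auto simp: algebra_simps)
  moreover have "(b - a) powr (p - 1) \<le> B powr (p - 1)"
    using True assms by (intro powr_mono2) (auto simp: B_def)
  ultimately show ?thesis using assms by (auto simp: A_def intro!: mult_right_mono)
next
  case False
  then have "0 \<le> \<bar>a - b\<bar> powr (p - 2) * (a - b) * (t * A)"
    using assms by (cases "k < a") (auto simp: A_def)
  moreover have "0 \<le> B powr (p - 1) * (t * A)" using assms by (auto simp: A_def)
  ultimately show ?thesis by linarith
qed

subsection \<open>Kernel integrals and the Faber-Krahn inequality\<close>

lemma ex_dyadic_scale:
  fixes t :: real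
  assumes "1 \<le> t"
  shows "\<exists>i::nat. 2 ^ i \<le> t \<and> t < 2 ^ Suc i"
proof -
  obtain N where N: "t < 2 ^ N" using real_arch_pow[of 2 t] by auto
  define k where "k = (LEAST k. t < 2 ^ k)"
  have k: "t < 2 ^ k" unfolding k_def using N by (rule LeastI)
  then have "k \<noteq> 0" using assms by (intro notI) auto
  then obtain i where i: "k = Suc i" by (cases k) auto
  have "\<not> t < 2 ^ i" using i not_less_Least[of i "\<lambda>k. t < 2 ^ k"] by (simp add: k_def)
  then have "2 ^ i \<le> t" "t < 2 ^ Suc i" using i k by auto
  then show ?thesis by blast
qed

lemma ennreal_le_suminf: "f i \<le> (\<Sum>i. f i :: ennreal)"
  using sum_le_suminf[of f "{i}"] by simp

text \<open>Dyadic annuli about x. On the far ones the minimum is 1 and the masses decay like 2^(-sp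
  i); on the near ones the p-th power of |x - y| beats the singularity and the masses decay like
  2^(-(p - sp) i). The conditions s > 0 and s < 1 are the convergence of the two geometric
  series.\<close>

lemma kernel_integral:
  fixes s p :: real
  assumes "0 < s" "s < 1" "1 < p"
  shows "\<exists>C>0. \<forall>d>0. \<forall>x::'a::euclidean_space.
    (\<integral>\<^sup>+y. ennreal (min 1 (norm (x - y) / d) powr p * norm (x - y) powr (- real DIM('a) - s * p)) \<partial>lborel)
    \<le> ennreal (C * d powr (- (s * p)))"
proof -
  define n where "n = DIM('a)"
  define q where "q = real n + s * p"
  define \<omega> where "\<omega> = unit_ball_vol (real n)"
  define a where "a = (2::real) powr (- (s * p))"
  define b where "b = (2::real) powr (- (p - s * p))"
  have \<omega>: "0 < \<omega>" by (simp add: \<omega>_def)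
  have sp: "0 < s * p" "s * p < p" using assms by auto
  have q: "0 < q" using sp by (simp add: q_def n_def add_pos_pos)
  have ab: "0 < a" "a < 1" "0 < b" "b < 1"
    using sp by (auto simp: a_def b_def powr_less_one)
  define C where "C = \<omega> * (2 ^ n * (1 / (1 - a)) + 2 powr q * (1 / (1 - b)))"
  have C: "0 < C" unfolding C_def using ab \<omega> by (intro mult_pos_pos add_pos_pos) auto
  have pw: "((2::real) ^ i) powr r = (2 powr r) ^ i" for i r
    by (induction i) (auto simp: powr_mult)
  have mcb: "(\<lambda>y. ennreal c * indicator (cball x r) y) \<in> borel_measurable borel" for c r and x :: 'a
    by (intro borel_measurable_times_ennreal borel_measurable_indicator) auto
  have vol: "(\<integral>\<^sup>+y. ennreal c * indicator (cball x r) y \<partial>lborel) = ennreal (c * (\<omega> * r ^ n))"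
    if "0 \<le> c" "0 \<le> r" for c r and x :: 'a
    using that \<omega> emeasure_cball[of r x]
    by (simp add: nn_integral_cmult_indicator \<omega>_def n_def flip: ennreal_mult)
  show ?thesis
  proof (intro exI[of _ C] conjI allI impI C)
    fix d :: real and x :: 'a
    assume d: "0 < d"
    \<comment> \<open>With t = |x - y|/d, \<open>e1 i\<close> bounds the integrand for 2^i <= t <
      2^(i+1) and \<open>e2 i\<close> for 2^(-(i+1)) < t <= 2^(-i). In \<open>g\<close> the annuli
      are enlarged to the full balls, which costs only a constant.\<close>
    define e1 where "e1 i = (2 ^ i * d) powr (- q)" for i :: nat
    define e2 where "e2 i = (1 / 2 ^ i) powr p * (1 / 2 ^ Suc i * d) powr (- q)" for i :: nat
    define g where "g i y = ennreal (e1 i) * indicator (cball x (2 ^ Suc i * d)) y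
        + ennreal (e2 i) * indicator (cball x (1 / 2 ^ i * d)) y" for i :: nat and y :: 'a
    have [measurable]: "g i \<in> borel_measurable lborel" for i
      unfolding g_def by (intro borel_measurable_add borel_measurable_times_ennreal borel_measurable_indicator) auto
    have le: "ennreal (min 1 (norm (x - y) / d) powr p * norm (x - y) powr (- real DIM('a) - s * p)) \<le> (\<Sum>i. g i y)"
      for y
    proof (cases "x = y")
      case False
      define t where "t = norm (x - y) / d"
      have t: "0 < t" "norm (x - y) = t * d" using False d by (auto simp: t_def)
      have qq: "- real DIM('a) - s * p = - q" by (simp add: q_def n_def)
      have "\<exists>i. ennreal (min 1 t powr p * (t * d) powr (- q)) \<le> g i y"
      proof (cases "1 \<le> t")
        case True
        then obtain i :: nat where i: "2 ^ i \<le> t" "t < 2 ^ Suc i" using ex_dyadic_scale by blast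
        have "(t * d) powr (- q) \<le> e1 i" unfolding e1_def using i d q
          by (intro powr_mono2') auto
        moreover have "y \<in> cball x (2 ^ Suc i * d)" using i t d by (simp add: dist_norm)
        ultimately have "ennreal (min 1 t powr p * (t * d) powr (- q)) \<le> g i y"
          using True by (auto simp: g_def intro!: add_increasing2 ennreal_leI)
        then show ?thesis ..
      next
        case False
        then have "1 \<le> 1 / t" using t by simp
        then obtain i :: nat where i: "2 ^ i \<le> 1 / t" "1 / t < 2 ^ Suc i" using ex_dyadic_scale by blast
        have i': "t \<le> 1 / 2 ^ i" "1 / 2 ^ Suc i < t" using i t by (auto simp: field_simps)
        have "t powr p \<le> (1 / 2 ^ i) powr p" using i' assms t by (intro powr_mono2) auto
        moreover have "(t * d) powr (- q) \<le> (1 / 2 ^ Suc i * d) powr (- q)"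
        proof (rule powr_mono2')
          show "1 / 2 ^ Suc i * d \<le> t * d"
            by (rule mult_right_mono[OF less_imp_le[OF i'(2)] less_imp_le[OF d]])
        qed (use q d in auto)
        ultimately have "t powr p * (t * d) powr (- q) \<le> e2 i"
          unfolding e2_def by (rule mult_mono) auto
        moreover have "y \<in> cball x (1 / 2 ^ i * d)"
          unfolding mem_cball dist_norm t(2) by (rule mult_right_mono[OF i'(1) less_imp_le[OF d]])
        moreover have "min 1 t = t" using False by (intro min_absorb2) simp
        ultimately have "ennreal (min 1 t powr p * (t * d) powr (- q)) \<le> ennreal (e2 i) * indicator (cball x (1 / 2 ^ i * d)) y"
          by (simp only: indicator_simps(1) mult_1_right ennreal_leI)
        also have "\<dots> \<le> g i y" unfolding g_def by (rule add_increasing) simp_all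
        finally have "ennreal (min 1 t powr p * (t * d) powr (- q)) \<le> g i y" .
        then show ?thesis ..
      qed
      then obtain i where "ennreal (min 1 t powr p * (t * d) powr (- q)) \<le> g i y" ..
      from order_trans[OF this ennreal_le_suminf[of "\<lambda>i. g i y"]]
      show ?thesis unfolding qq t_def[symmetric] unfolding t(2) .
    qed auto
    have sc: "(r * d) powr (- q) * (\<omega> * (r' * d) ^ n) = \<omega> * d powr (- (s * p)) * (r powr (- q) * r' ^ n)"
      if "0 < r" "0 < r'" for r r'
    proof -
      have "d powr (- q) * d ^ n = d powr (- (s * p))"
        using d by (simp add: q_def powr_diff powr_realpow powr_add powr_minus field_simps)
      then show ?thesis using that d by (simp add: powr_mult power_mult_distrib mult_ac)
    qed
    have I1: "e1 i * (\<omega> * (2 ^ Suc i * d) ^ n) = \<omega> * d powr (- (s * p)) * (2 ^ n * a ^ i)" for i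
    proof -
      have "(2 ^ i) powr (- q) * (2 ^ Suc i) ^ n = (2::real) ^ n * a ^ i"
      proof -
        have "((2::real) ^ i) powr (- q) * (2 ^ i) powr (real n) = (2 ^ i) powr (- (s * p))"
          by (simp add: q_def flip: powr_add)
        moreover have "((2::real) ^ Suc i) ^ n = 2 ^ n * (2 ^ i) powr (real n)"
          by (simp add: powr_realpow power_mult_distrib)
        ultimately show ?thesis by (simp add: a_def pw mult_ac)
      qed
      then show ?thesis unfolding e1_def by (subst sc) auto
    qed
    have I2: "e2 i * (\<omega> * (1 / 2 ^ i * d) ^ n) = \<omega> * d powr (- (s * p)) * (2 powr q * b ^ i)" for i
    proof -
      have "(1 / 2 ^ i) powr p * ((1 / 2 ^ Suc i) powr (- q) * (1 / 2 ^ i) ^ n) = 2 powr q * b ^ i"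
      proof -
        have "(1 / 2 ^ i) powr p * ((1 / 2 ^ i) powr (- q) * (1 / 2 ^ i :: real) powr (real n))
            = (1 / 2 ^ i) powr (p - s * p)"
          by (simp add: q_def flip: powr_add)
        moreover have "(1 / 2 ^ i :: real) powr (p - s * p) = b ^ i"
          unfolding b_def powr_minus_divide by (simp only: powr_divide power_one_over pw powr_one_eq_one)
        moreover have "(1 / 2 ^ Suc i :: real) powr (- q) = 2 powr q * (1 / 2 ^ i) powr (- q)"
          by (simp add: powr_divide powr_minus_divide powr_mult)
        ultimately show ?thesis by (simp add: powr_realpow mult_ac)
      qed
      then show ?thesis unfolding e2_def mult.assoc by (subst sc) (auto simp: mult_ac)
    qed
    have ig: "(\<integral>\<^sup>+y. g i y \<partial>lborel)
        = ennreal (\<omega> * d powr (- (s * p)) * (2 ^ n * a ^ i + 2 powr q * b ^ i))" for i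
    proof -
      have "(\<integral>\<^sup>+y. g i y \<partial>lborel) = ennreal (e1 i * (\<omega> * (2 ^ Suc i * d) ^ n))
          + ennreal (e2 i * (\<omega> * (1 / 2 ^ i * d) ^ n))"
      proof -
        have "0 \<le> e1 i" "0 \<le> e2 i" by (simp_all add: e1_def e2_def)
        then show ?thesis unfolding g_def using d
          by (subst nn_integral_add) (simp_all add: vol mcb del: power_Suc)
      qed
      also have "\<dots> = ennreal (\<omega> * d powr (- (s * p)) * (2 ^ n * a ^ i + 2 powr q * b ^ i))"
        unfolding I1 I2 using \<omega> ab by (simp add: distrib_left flip: ennreal_plus)
      finally show ?thesis .
    qed
    have "(\<integral>\<^sup>+y. ennreal (min 1 (norm (x - y) / d) powr p * norm (x - y) powr (- real DIM('a) - s * p)) \<partial>lborel)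
        \<le> (\<integral>\<^sup>+y. (\<Sum>i. g i y) \<partial>lborel)"
      by (intro nn_integral_mono le)
    also have "\<dots> = (\<Sum>i. ennreal (\<omega> * d powr (- (s * p)) * (2 ^ n * a ^ i + 2 powr q * b ^ i)))"
      by (subst nn_integral_suminf) (auto simp: ig)
    also have "\<dots> = ennreal (C * d powr (- (s * p)))"
    proof (rule suminf_ennreal_eq)
      have "(\<lambda>i. \<omega> * d powr (- (s * p)) * (2 ^ n * a ^ i + 2 powr q * b ^ i)) sums
          (\<omega> * d powr (- (s * p)) * (2 ^ n * (1 / (1 - a)) + 2 powr q * (1 / (1 - b))))"
        using ab by (intro sums_mult sums_add geometric_sums) auto
      then show "(\<lambda>i. \<omega> * d powr (- (s * p)) * (2 ^ n * a ^ i + 2 powr q * b ^ i)) sums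
          (C * d powr (- (s * p)))" by (simp add: C_def mult_ac)
    qed (use \<omega> ab in auto)
    finally show "(\<integral>\<^sup>+y. ennreal (min 1 (norm (x - y) / d) powr p * norm (x - y) powr (- real DIM('a) - s * p)) \<partial>lborel)
        \<le> ennreal (C * d powr (- (s * p)))" .
  qed
qed

lemma Faber_Krahn:
  fixes s p :: real
  assumes "0 < s" "1 < p"
  shows "\<exists>C>0. \<forall>(f :: 'a::euclidean_space \<Rightarrow> real) m.
    f \<in> borel_measurable borel \<longrightarrow> 0 \<le> m \<longrightarrow> emeasure lborel {x. f x \<noteq> 0} \<le> ennreal m \<longrightarrow>
    (\<integral>\<^sup>+x. ennreal (\<bar>f x\<bar> powr p) \<partial>lborel) \<le> ennreal (C * m powr (s * p / DIM('a))) *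
      (\<integral>\<^sup>+x. \<integral>\<^sup>+y. ennreal (\<bar>f x - f y\<bar> powr p * norm (x - y) powr (- real DIM('a) - s * p)) \<partial>lborel \<partial>lborel)"
proof -
  define n where "n = DIM('a)"
  define q where "q = real n + s * p"
  define \<omega> where "\<omega> = unit_ball_vol (real n)"
  have n: "0 < real n" by (simp add: n_def)
  have \<omega>: "0 < \<omega>" by (simp add: \<omega>_def)
  have sp: "0 < s * p" using assms by auto
  have q: "0 < q" using sp by (simp add: q_def n_def add_pos_pos)
  define C where "C = (2 / \<omega>) powr (q / n)"
  have C: "0 < C" using \<omega> by (simp add: C_def)
  show ?thesis
  proof (intro exI[of _ C] conjI allI impI C)
    fix f :: "'a \<Rightarrow> real" and m :: real
    assume [measurable]: "f \<in> borel_measurable borel" and m0: "0 \<le> m"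
      and m: "emeasure lborel {x. f x \<noteq> 0} \<le> ennreal m"
    define A where "A = {x. f x \<noteq> 0}"
    have [measurable]: "A \<in> sets borel" unfolding A_def by measurable
    let ?G = "\<integral>\<^sup>+x. \<integral>\<^sup>+y. ennreal (\<bar>f x - f y\<bar> powr p * norm (x - y) powr (- real DIM('a) - s * p)) \<partial>lborel \<partial>lborel"
    show "(\<integral>\<^sup>+x. ennreal (\<bar>f x\<bar> powr p) \<partial>lborel) \<le> ennreal (C * m powr (s * p / DIM('a))) * ?G"
    proof (cases "m = 0")
      case True
      then have "emeasure lborel A = 0" using m by (simp add: A_def)
      then have "AE x in lborel. x \<notin> A"
        by (intro AE_not_in) auto
      then have "AE x in lborel. ennreal (\<bar>f x\<bar> powr p) = 0" by eventually_elim (simp add: A_def)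
      then have "(\<integral>\<^sup>+x. ennreal (\<bar>f x\<bar> powr p) \<partial>lborel) = 0"
        by (subst nn_integral_0_iff_AE) auto
      then show ?thesis by simp
    next
      case False
      with m0 have m0: "0 < m" by simp
      \<comment> \<open>Balls of this radius have volume 2m, so at least volume m of each consists
        of zeros of f. For m = 0 the radius would be 0, hence the separate case.\<close>
      define r where "r = (2 * m / \<omega>) powr (1 / n)"
      have r: "0 < r" using m0 \<omega> by (simp add: r_def)
      have rn: "\<omega> * r ^ n = 2 * m"
      proof -
        have "r ^ n = r powr (real n)" using r by (simp add: powr_realpow)
        also have "\<dots> = 2 * m / \<omega>" using n m0 \<omega> by (simp add: r_def powr_powr)
        finally show ?thesis using \<omega> by simp
      qed
      \<comment> \<open>Volume of the zeros times the smallest value of the kernel on the ball.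
        Since r^q is a multiple of m^(q/n) and q/n = 1 + sp/n, its inverse is the claimed factor C
        m^(sp/n).\<close>
      define c where "c = m * r powr (- q)"
      have c: "0 < c" using m0 r by (simp add: c_def)
      have inner: "ennreal c * ennreal (\<bar>f x\<bar> powr p)
        \<le> (\<integral>\<^sup>+y. ennreal (\<bar>f x - f y\<bar> powr p * norm (x - y) powr (- real DIM('a) - s * p)) \<partial>lborel)" for x
      proof (cases "f x = 0")
        case False
        have "ennreal (2 * m) = emeasure lborel (ball x r)"
          using emeasure_ball[of r x] r rn by (simp add: \<omega>_def n_def)
        also have "\<dots> \<le> emeasure lborel ((ball x r - A) \<union> A)" by (intro emeasure_mono) auto
        also have "\<dots> \<le> emeasure lborel (ball x r - A) + emeasure lborel A"
          by (intro emeasure_subadditive) auto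
        also have "\<dots> \<le> emeasure lborel (ball x r - A) + ennreal m"
          using m by (intro add_left_mono) (simp add: A_def)
        finally have "ennreal m + ennreal m \<le> emeasure lborel (ball x r - A) + ennreal m"
          using m0 by (simp flip: ennreal_plus)
        then have vol: "ennreal m \<le> emeasure lborel (ball x r - A)"
          by (subst (asm) ennreal_add_left_cancel_le[of "ennreal m", simplified add.commute]) auto
        have "ennreal c * ennreal (\<bar>f x\<bar> powr p) = ennreal (\<bar>f x\<bar> powr p * r powr (- q)) * ennreal m"
          using m0 by (simp add: c_def mult_ac flip: ennreal_mult)
        also have "\<dots> \<le> ennreal (\<bar>f x\<bar> powr p * r powr (- q)) * emeasure lborel (ball x r - A)"
          using vol by (intro mult_left_mono) auto
        also have "\<dots> = (\<integral>\<^sup>+y. ennreal (\<bar>f x\<bar> powr p * r powr (- q)) * indicator (ball x r - A) y \<partial>lborel)"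
          by (subst nn_integral_cmult_indicator) auto
        also have "\<dots> \<le> (\<integral>\<^sup>+y. ennreal (\<bar>f x - f y\<bar> powr p * norm (x - y) powr (- real DIM('a) - s * p)) \<partial>lborel)"
        proof (intro nn_integral_mono)
          fix y
          show "ennreal (\<bar>f x\<bar> powr p * r powr (- q)) * indicator (ball x r - A) y
            \<le> ennreal (\<bar>f x - f y\<bar> powr p * norm (x - y) powr (- real DIM('a) - s * p))"
          proof (cases "y \<in> ball x r - A")
            case True
            then have y: "f y = 0" "norm (x - y) < r" "x \<noteq> y" using False
              by (auto simp: A_def dist_norm)
            have "- real DIM('a) - s * p = - q" by (simp add: q_def n_def)
            moreover have "r powr (- q) \<le> norm (x - y) powr (- q)"
              using y r q by (intro powr_mono2') auto
            ultimately show ?thesis using True y by (auto intro!: ennreal_leI mult_left_mono)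
          qed auto
        qed
        finally show ?thesis .
      qed auto
      have "ennreal c * (\<integral>\<^sup>+x. ennreal (\<bar>f x\<bar> powr p) \<partial>lborel) \<le> ?G"
        by (subst nn_integral_cmult[symmetric]) (auto intro!: nn_integral_mono inner)
      then have "ennreal (1 / c) * (ennreal c * (\<integral>\<^sup>+x. ennreal (\<bar>f x\<bar> powr p) \<partial>lborel)) \<le> ennreal (1 / c) * ?G"
        by (rule mult_left_mono) simp
      moreover have "ennreal (1 / c) * ennreal c = 1" using c by (simp flip: ennreal_mult)
      moreover have "1 / c = C * m powr (s * p / DIM('a))"
      proof -
        have "r powr q = (2 * m / \<omega>) powr (q / n)" by (simp add: r_def powr_powr)
        also have "\<dots> = C * m powr (q / n)" using m0 \<omega> by (simp add: C_def powr_mult powr_divide)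
        also have "q / n = 1 + s * p / n" using n by (simp add: q_def field_simps)
        finally have "r powr q = C * (m * m powr (s * p / n))" using m0 by (simp add: powr_add)
        moreover have "1 / c = r powr q / m" by (simp add: c_def powr_minus_divide)
        ultimately show ?thesis using m0 by (simp add: n_def)
      qed
      ultimately show ?thesis by (simp flip: mult.assoc)
    qed
  qed
qed

subsection \<open>Mollification\<close>

lemma Ck_SucI:
  fixes f :: "'a::euclidean_space \<Rightarrow> real"
  assumes "\<And>x. (f has_derivative f' x) (at x)" "\<And>i. i \<in> Basis \<Longrightarrow> Ck m (\<lambda>x. f' x i)"
  shows "Ck (Suc m) f"
proof -
  have "frechet_derivative f (at x) = f' x" for x using frechet_derivative_at[OF assms(1)[of x]] by simp
  then show ?thesis using assms by (auto simp: differentiable_def)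
qed

lemma Ck_SucD:
  fixes f :: "'a::euclidean_space \<Rightarrow> real"
  assumes "Ck (Suc m) f"
  shows "(f has_derivative frechet_derivative f (at x)) (at x)"
  using assms frechet_derivative_works by auto

lemma Ck_continuous: "Ck m f \<Longrightarrow> continuous_on UNIV f"
proof (cases m)
  case (Suc k)
  assume "Ck m f"
  then have "\<forall>x. f differentiable (at x)" using Suc by simp
  then show "continuous_on UNIV f"
    using differentiable_imp_continuous_within continuous_at_imp_continuous_on by blast
qed simp

lemma Ck_antimono: "Ck (Suc m) f \<Longrightarrow> Ck m f"
proof (induction m arbitrary: f)
  case 0
  then show ?case using Ck_continuous[of "Suc 0" f] by simp
next
  case (Suc m)
  from Suc.prems have "\<forall>x. f differentiable (at x)" "\<forall>i\<in>Basis. Ck (Suc m) (\<lambda>x. frechet_derivative f (at x) i)"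
    using Ck.simps(2)[of "Suc m" f] by blast+
  then show ?case using Suc.IH by auto
qed

lemma Ck_const: "Ck m (\<lambda>x. c)"
proof (induction m arbitrary: c)
  case (Suc m)
  show ?case by (rule Ck_SucI[where f' = "\<lambda>_ _. 0"]) (auto simp: Suc)
qed simp

lemma Ck_add: "Ck m f \<Longrightarrow> Ck m g \<Longrightarrow> Ck m (\<lambda>x. f x + g x)"
proof (induction m arbitrary: f g)
  case 0
  then show ?case by (auto intro: continuous_intros)
next
  case (Suc m)
  show ?case
  proof (rule Ck_SucI)
    show "((\<lambda>x. f x + g x) has_derivative (\<lambda>h. frechet_derivative f (at x) h + frechet_derivative g (at x) h)) (at x)" for x
      by (intro has_derivative_add Ck_SucD[OF Suc.prems(1)] Ck_SucD[OF Suc.prems(2)])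
    show "Ck m (\<lambda>x. frechet_derivative f (at x) i + frechet_derivative g (at x) i)" if "i \<in> Basis" for i
      using Suc.prems that by (intro Suc.IH) auto
  qed
qed

lemma Ck_mult: "Ck m f \<Longrightarrow> Ck m g \<Longrightarrow> Ck m (\<lambda>x. f x * g x)"
proof (induction m arbitrary: f g)
  case 0
  then show ?case by (auto intro: continuous_intros)
next
  case (Suc m)
  show ?case
  proof (rule Ck_SucI)
    show "((\<lambda>x. f x * g x) has_derivative (\<lambda>h. f x * frechet_derivative g (at x) h + frechet_derivative f (at x) h * g x)) (at x)" for x
      by (intro has_derivative_mult Ck_SucD[OF Suc.prems(1)] Ck_SucD[OF Suc.prems(2)])
    show "Ck m (\<lambda>x. f x * frechet_derivative g (at x) i + frechet_derivative f (at x) i * g x)" if "i \<in> Basis" for i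
      using Suc.prems that Ck_antimono[OF Suc.prems(1)] Ck_antimono[OF Suc.prems(2)]
      by (intro Ck_add Suc.IH) auto
  qed
qed

lemma Ck_inner: "Ck m (\<lambda>x. x \<bullet> i)"
proof (cases m)
  case (Suc k)
  show ?thesis unfolding Suc
    by (rule Ck_SucI[where f' = "\<lambda>_ h. h \<bullet> i"])
      (auto intro!: Ck_const bounded_linear_imp_has_derivative bounded_linear_inner_left)
qed (auto intro: continuous_intros)

text \<open>The functions \<open>t\<^sup>-\<^sup>k exp (-1/t)\<close>, extended by zero, are closed under differentiation up to
  linear combinations.\<close>

definition flat :: "nat \<Rightarrow> real \<Rightarrow> real" where
  "flat k t = (if 0 < t then (1 / t) ^ k * exp (- (1 / t)) else 0)"

lemma flat_nonneg: "0 \<le> flat k t" by (simp add: flat_def)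

lemma flat_right_limit: "(flat k \<longlongrightarrow> 0) (at 0)"
proof -
  have "((\<lambda>x. x ^ k / exp x) \<longlongrightarrow> (0::real)) at_top" by (rule tendsto_power_div_exp_0)
  then have "((\<lambda>t. (inverse t) ^ k / exp (inverse t)) \<longlongrightarrow> (0::real)) (at_right 0)"
    by (rule filterlim_compose[OF _ filterlim_inverse_at_top_right])
  moreover have "eventually (\<lambda>t. (inverse t) ^ k / exp (inverse t) = flat k t) (at_right (0::real))"
    by (rule eventually_at_right_less[THEN eventually_mono]) (simp add: flat_def exp_minus inverse_eq_divide)
  ultimately have "(flat k \<longlongrightarrow> 0) (at_right 0)" by (rule Lim_transform_eventually)
  moreover have "eventually (\<lambda>t. 0 = flat k t) (at_left (0::real))"
    unfolding eventually_at_filter by (rule always_eventually) (simp add: flat_def)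
  then have "(flat k \<longlongrightarrow> 0) (at_left 0)" by (rule Lim_transform_eventually[OF tendsto_const])
  ultimately show ?thesis by (simp add: filterlim_at_split)
qed

lemma flat_has_derivative:
  "(flat k has_real_derivative (- real k * flat (Suc k) t + flat (Suc (Suc k)) t)) (at t)"
proof -
  consider "t < 0" | "t = 0" | "0 < t" by linarith
  then show ?thesis
  proof cases
    case 1
    have "((\<lambda>_. 0) has_real_derivative 0) (at t)" by simp
    then have "(flat k has_real_derivative 0) (at t)"
      by (rule DERIV_cong_ev[THEN iffD1, rotated -1])
        (use 1 in \<open>auto simp: flat_def eventually_nhds intro!: exI[of _ "{..<0}"]\<close>)
    then show ?thesis using 1 by (simp add: flat_def)
  next
    case 2
    \<comment> \<open>The difference quotient of \<open>flat k\<close> at 0 is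
      \<open>flat (Suc k)\<close> itself, including negative h, where both vanish.\<close>
    have "((\<lambda>h. (flat k (0 + h) - flat k 0) / h) \<longlongrightarrow> 0) (at 0)"
    proof (rule Lim_transform_eventually[OF flat_right_limit[of "Suc k"]])
      show "eventually (\<lambda>h. flat (Suc k) h = (flat k (0 + h) - flat k 0) / h) (at 0)"
        unfolding eventually_at_filter by (rule always_eventually) (simp add: flat_def)
    qed
    then show ?thesis using 2 by (simp add: flat_def DERIV_def)
  next
    case 3
    have "((\<lambda>t. (1 / t) ^ k * exp (- (1 / t))) has_real_derivative
        (- real k * flat (Suc k) t + flat (Suc (Suc k)) t)) (at t)"
    proof -
      have d1: "((\<lambda>t. 1 / t) has_real_derivative - ((1 / t)\<^sup>2)) (at t)"
        using 3 by (auto intro!: derivative_eq_intros simp: power2_eq_square)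
      have "((\<lambda>t. exp (- (1 / t))) has_real_derivative exp (- (1 / t)) * (1 / t)\<^sup>2) (at t)"
        using DERIV_chain2[OF DERIV_exp DERIV_minus[OF d1]] by simp
      from DERIV_mult[OF DERIV_power[OF d1, of k] this]
      have "((\<lambda>t. (1 / t) ^ k * exp (- (1 / t))) has_real_derivative
        (real k * (- ((1 / t)\<^sup>2) * (1 / t) ^ (k - Suc 0))) * exp (- (1 / t))
         + exp (- (1 / t)) * (1 / t)\<^sup>2 * (1 / t) ^ k) (at t)" by simp
      moreover have "real k * (- ((1 / t)\<^sup>2) * (1 / t) ^ (k - Suc 0)) = - real k * (1 / t) ^ Suc k"
      proof -
        have "real k * (- (u\<^sup>2) * u ^ (k - Suc 0)) = - real k * u ^ Suc k" for u :: real
          by (cases k) (simp_all add: power2_eq_square algebra_simps)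
        then show ?thesis .
      qed
      moreover have "exp (- (1 / t)) * (1 / t)\<^sup>2 * (1 / t) ^ k = (1 / t) ^ Suc (Suc k) * exp (- (1 / t))"
        by (simp add: power2_eq_square)
      ultimately show ?thesis using 3 by (simp only: flat_def if_True mult.assoc)
    qed
    then show ?thesis
      by (rule DERIV_cong_ev[THEN iffD1, rotated -1])
        (use 3 in \<open>auto simp: flat_def eventually_nhds intro!: exI[of _ "{0<..}"]\<close>)
  qed
qed

text \<open>With k = 0 and c = r^2 this is the bump function of the ball of radius r. The induction
  needs all k at once, because the derivatives are combinations of functions of the same family with
  larger k, times coordinates.\<close>

lemma Ck_flat_ball: "Ck m (\<lambda>x::'a::euclidean_space. flat k (c - x \<bullet> x))"
proof (induction m arbitrary: k)
  case 0
  have "continuous_on UNIV (flat k)"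
    using flat_has_derivative DERIV_isCont by (intro continuous_at_imp_continuous_on) blast
  then show ?case
    by (auto intro!: continuous_intros continuous_on_compose2[where g = "flat k" and t = UNIV])
next
  case (Suc m)
  let ?D = "\<lambda>t. - real k * flat (Suc k) t + flat (Suc (Suc k)) t"
  show ?case
  proof (rule Ck_SucI[where f' = "\<lambda>x h. ?D (c - x \<bullet> x) * (- 2 * (x \<bullet> h))"])
    fix x :: 'a
    have "((\<lambda>x. c - x \<bullet> x) has_derivative (\<lambda>h. - 2 * (x \<bullet> h))) (at x)"
      by (auto intro!: derivative_eq_intros simp: inner_commute)
    from has_derivative_compose[OF this, of "flat k" "(*) (?D (c - x \<bullet> x))"]
    show "((\<lambda>x. flat k (c - x \<bullet> x)) has_derivative (\<lambda>h. ?D (c - x \<bullet> x) * (- 2 * (x \<bullet> h)))) (at x)"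
      using flat_has_derivative[of k "c - x \<bullet> x"] by (simp add: has_field_derivative_def)
  next
    fix i :: 'a assume "i \<in> Basis"
    show "Ck m (\<lambda>x. ?D (c - x \<bullet> x) * (- 2 * (x \<bullet> i)))"
      by (intro Ck_mult Ck_add Ck_const Suc Ck_inner)
  qed
qed

text \<open>All derivatives fall on \<psi>, so continuity of F suffices; the induction is over
  \<psi> because its partial derivatives take its place. The compact box makes the Leibniz rule for
  parameter integrals applicable.\<close>

lemma Ck_convolution:
  fixes \<psi> F :: "'a::euclidean_space \<Rightarrow> real"
  assumes F: "continuous_on UNIV F" and \<psi>: "\<And>m. Ck m \<psi>"
  shows "Ck m (\<lambda>x. integral (cbox a b) (\<lambda>z. \<psi> (x - z) * F z))"
  using \<psi>
proof (induction m arbitrary: \<psi>)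
  have F': "continuous_on A (\<lambda>p. F (snd p))" for A :: "('a \<times> 'a) set"
    by (rule continuous_on_compose2[OF F]) (auto intro: continuous_intros)
  have shift: "continuous_on A (\<lambda>p. g (fst p - snd p))"
    if "continuous_on UNIV g" for A and g :: "'a \<Rightarrow> real"
    by (rule continuous_on_compose2[OF that])
      (auto intro!: continuous_on_diff continuous_on_fst continuous_on_snd continuous_on_id)
  {
    case 0
    have "continuous_on (UNIV \<times> cbox a b) (\<lambda>(x, z). \<psi> (x - z) * F z)"
      unfolding case_prod_unfold by (intro continuous_intros F' shift Ck_continuous[OF 0])
    then show ?case using integral_continuous_on_param[of UNIV a b "\<lambda>x z. \<psi> (x - z) * F z"] by simp
  next
    case (Suc m)
    let ?d = "\<lambda>x. frechet_derivative \<psi> (at x)"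
    have d: "(\<psi> has_derivative ?d x) (at x)" for x using Ck_SucD[OF Suc.prems] .
    have bl: "bounded_linear (?d x)" for x using d has_derivative_bounded_linear by blast
    \<comment> \<open>The Leibniz rule wants the derivative as a continuous family of bounded linear
      maps; its continuity is checked on basis vectors only.\<close>
    define G where "G x z = F z *\<^sub>R Blinfun (?d (x - z))" for x z
    have G: "blinfun_apply (G x z) h = F z * ?d (x - z) h" for x z h
      by (simp add: G_def blinfun.scaleR_left bounded_linear_Blinfun_apply[OF bl])
    have contD: "continuous_on UNIV (\<lambda>x. ?d x i)" if "i \<in> Basis" for i
    proof -
      have "Ck 0 (\<lambda>x. ?d x i)" using Suc.prems[of "Suc 0"] that by simp
      then show ?thesis by simp
    qed
    have contG: "continuous_on (UNIV \<times> cbox a b) (\<lambda>(x, z). G x z)"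
    proof (rule continuous_on_blinfun_componentwise)
      fix i :: 'a assume "i \<in> Basis"
      then show "continuous_on (UNIV \<times> cbox a b) (\<lambda>p. blinfun_apply (case p of (x, z) \<Rightarrow> G x z) i)"
        unfolding case_prod_unfold G by (intro continuous_intros F' shift contD)
    qed
    have int: "(\<lambda>z. \<psi> (x - z) * F z) integrable_on cbox a b" for x
    proof (rule integrable_continuous)
      have "continuous_on (cbox a b) (\<lambda>z. \<psi> (x - z))"
        by (rule continuous_on_compose2[OF Ck_continuous[OF Suc.prems]]) (auto intro: continuous_intros)
      then show "continuous_on (cbox a b) (\<lambda>z. \<psi> (x - z) * F z)"
        using F continuous_on_subset by (intro continuous_intros) auto
    qed
    have intG: "G x integrable_on cbox a b" for x
    proof (rule integrable_continuous)
      have "continuous_on (cbox a b) (\<lambda>z. case_prod G (x, z))"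
        by (rule continuous_on_compose2[OF contG]) (auto intro: continuous_on_Pair)
      then show "continuous_on (cbox a b) (G x)" by simp
    qed
    show ?case
    proof (rule Ck_SucI[where f' = "\<lambda>x h. integral (cbox a b) (\<lambda>z. ?d (x - z) h * F z)"])
      fix x
      have "((\<lambda>x. integral (cbox a b) (\<lambda>z. \<psi> (x - z) * F z)) has_derivative
          blinfun_apply (integral (cbox a b) (G x))) (at x within UNIV)"
      proof (rule leibniz_rule[OF _ int contG])
        fix x z
        have "((\<lambda>x. \<psi> (x - z)) has_derivative ?d (x - z)) (at x)"
        proof -
          have "((\<lambda>x. x - z) has_derivative (\<lambda>h. h)) (at x)"
            by (auto intro!: derivative_eq_intros)
          from has_derivative_compose[OF this d] show ?thesis .
        qed
        from has_derivative_mult_left[OF this, of "F z"]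
        show "((\<lambda>x. \<psi> (x - z) * F z) has_derivative blinfun_apply (G x z)) (at x within UNIV)"
          by (rule has_derivative_eq_rhs) (auto simp: G mult.commute)
      qed auto
      moreover have "blinfun_apply (integral (cbox a b) (G x)) h = integral (cbox a b) (\<lambda>z. ?d (x - z) h * F z)" for h
        using blinfun_apply_integral[OF intG, of x h] by (simp add: G mult.commute)
      ultimately show "((\<lambda>x. integral (cbox a b) (\<lambda>z. \<psi> (x - z) * F z)) has_derivative
          (\<lambda>h. integral (cbox a b) (\<lambda>z. ?d (x - z) h * F z))) (at x)"
        by (simp add: has_derivative_eq_rhs fun_eq_iff)
    next
      fix i :: 'a assume i: "i \<in> Basis"
      have "Ck k (\<lambda>x. ?d x i)" for k using Suc.prems[of "Suc k"] i by simp
      then show "Ck m (\<lambda>x. integral (cbox a b) (\<lambda>z. ?d (x - z) i * F z))" by (rule Suc.IH)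
    qed
  }
qed

section \<open>Mollification of Lipschitz functions\<close>

lemma lborel_integral_reflect:
  fixes f :: "'a::euclidean_space \<Rightarrow> real"
  assumes [measurable]: "f \<in> borel_measurable borel"
  shows "(\<integral>z. f (x - z) \<partial>lborel) = (\<integral>z. f z \<partial>lborel)"
proof -
  have "(lborel :: 'a measure) = distr lborel borel (\<lambda>z. x + (-1) *\<^sub>R z)"
    using lborel_affine[of "-1" x] by (simp add: density_1)
  then have "(\<integral>z. f z \<partial>lborel) = (\<integral>z. f z \<partial>distr lborel borel (\<lambda>z. x + (-1) *\<^sub>R z))" by simp
  also have "\<dots> = (\<integral>z. f (x - z) \<partial>lborel)" by (subst integral_distr) auto
  finally show ?thesis by simp
qed

text \<open>Averaging over a ball of radius r keeps bounds and the Lipschitz constant, moves values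
  by at most L r and enlarges the support by at most r. These facts are read off the form of the
  average in which F is shifted; smoothness comes from the reflected form, in which the bump is
  shifted.\<close>

lemma mollification:
  fixes F :: "'a::euclidean_space \<Rightarrow> real"
  assumes "L-lipschitz_on UNIV F" "compact (supp F)" "\<And>x. 0 \<le> F x" "\<And>x. F x \<le> N" "0 < r"
  shows "\<exists>\<phi>. (\<forall>m. Ck m \<phi>) \<and> (\<forall>x. 0 \<le> \<phi> x \<and> \<phi> x \<le> N \<and> \<bar>\<phi> x - F x\<bar> \<le> L * r)
    \<and> L-lipschitz_on UNIV \<phi> \<and> (\<forall>x. \<phi> x \<noteq> 0 \<longrightarrow> (\<exists>z. F z \<noteq> 0 \<and> dist x z \<le> r))"
proof -
  define \<psi> where "\<psi> x = flat 0 (r\<^sup>2 - x \<bullet> x)" for x :: 'a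
  have Ck: "Ck m \<psi>" for m unfolding \<psi>_def by (rule Ck_flat_ball)
  have cont: "continuous_on UNIV \<psi>" using Ck_continuous[OF Ck] .
  have nn: "0 \<le> \<psi> x" for x by (simp add: \<psi>_def flat_nonneg)
  have pos: "\<psi> x \<noteq> 0 \<longleftrightarrow> norm x < r" for x
  proof -
    have "\<psi> x \<noteq> 0 \<longleftrightarrow> (norm x)\<^sup>2 < r\<^sup>2" by (simp add: \<psi>_def flat_def power2_norm_eq_inner)
    then show ?thesis using \<open>0 < r\<close> power_strict_mono[of "norm x" r 2] power2_less_imp_less[of "norm x" r] by auto
  qed
  have F: "continuous_on UNIV F" using lipschitz_on_continuous_on[OF assms(1)] .
  have [measurable]: "\<psi> \<in> borel_measurable borel" "F \<in> borel_measurable borel"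
    using cont F by (auto intro: borel_measurable_continuous_onI)
  obtain a b where ab: "supp F \<subseteq> cbox a b"
    using compact_imp_bounded[OF assms(2)] bounded_subset_cbox_symmetric by metis
  have F0: "F z = 0" if "z \<notin> cbox a b" for z
  proof (rule ccontr)
    assume z: "F z \<noteq> 0"
    have "z \<in> supp F" unfolding supp_def by (rule subsetD[OF closure_subset]) (simp add: z)
    then show False using ab that by blast
  qed
  have int_cont: "integrable lborel (\<lambda>z. indicator (cball x R) z *\<^sub>R g z)"
    if "continuous_on UNIV g" for x :: 'a and R and g :: "'a \<Rightarrow> real"
    using that by (intro borel_integrable_compact) (auto intro: continuous_on_subset)
  have int: "integrable lborel (\<lambda>z. \<psi> z * g z)" if "continuous_on UNIV g" for g
  proof -
    have "integrable lborel (\<lambda>z. indicator (cball 0 r) z *\<^sub>R (\<psi> z * g z))"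
      using that cont by (intro int_cont continuous_intros)
    moreover have "(\<lambda>z. indicator (cball 0 r) z *\<^sub>R (\<psi> z * g z)) = (\<lambda>z. \<psi> z * g z)"
    proof
      show "indicator (cball 0 r) z *\<^sub>R (\<psi> z * g z) = \<psi> z * g z" for z
        using pos[of z] by (cases "\<psi> z = 0") auto
    qed
    ultimately show ?thesis by (simp only:)
  qed
  define I where "I = (\<integral>z. \<psi> z \<partial>lborel)"
  have I: "0 < I"
  proof -
    have "integrable lborel \<psi>" using int[of "\<lambda>_. 1"] by simp
    moreover have "\<not> (AE z in lborel. \<psi> z = 0)"
    proof
      assume "AE z in lborel. \<psi> z = 0"
      then have "AE z in lborel. z \<notin> ball (0::'a) r" by eventually_elim (use pos in auto)
      then have "emeasure lborel (ball (0::'a) r) = 0" by (subst (asm) AE_iff_measurable) auto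
      then show False using emeasure_ball[of r "0::'a"] \<open>0 < r\<close> unit_ball_vol_pos[of "real DIM('a)"]
        by (simp add: mult_le_0_iff not_le)
    qed
    ultimately have "I \<noteq> 0" unfolding I_def using integral_nonneg_eq_0_iff_AE[of lborel \<psi>] nn by auto
    moreover have "0 \<le> I" unfolding I_def using nn by (intro Bochner_Integration.integral_nonneg) auto
    ultimately show ?thesis by simp
  qed
  define \<phi> where "\<phi> x = (\<integral>z. \<psi> z * F (x - z) \<partial>lborel) / I" for x
  have contF: "continuous_on UNIV (\<lambda>z. F (x - z))" for x
    by (rule continuous_on_compose2[OF F]) (auto intro: continuous_intros)
  have avg: "\<phi> x - c = (\<integral>z. \<psi> z * (F (x - z) - c) \<partial>lborel) / I" for x c
  proof -
    have "(\<integral>z. \<psi> z * (F (x - z) - c) \<partial>lborel) = (\<integral>z. \<psi> z * F (x - z) - \<psi> z * c \<partial>lborel)"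
      by (simp add: algebra_simps)
    also have "\<dots> = (\<integral>z. \<psi> z * F (x - z) \<partial>lborel) - (\<integral>z. \<psi> z * c \<partial>lborel)"
      by (intro Bochner_Integration.integral_diff int contF continuous_on_const)
    finally show ?thesis using I by (simp add: \<phi>_def I_def diff_divide_distrib)
  qed
  have bnd: "\<bar>(\<integral>z. \<psi> z * g z \<partial>lborel) / I\<bar> \<le> B"
    if "continuous_on UNIV g" "\<And>z. norm z < r \<Longrightarrow> \<bar>g z\<bar> \<le> B" for g B
  proof -
    have "\<bar>\<integral>z. \<psi> z * g z \<partial>lborel\<bar> \<le> (\<integral>z. \<bar>\<psi> z * g z\<bar> \<partial>lborel)" by (rule integral_abs_bound)
    also have "\<dots> \<le> (\<integral>z. \<psi> z * B \<partial>lborel)"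
    proof (rule integral_mono)
      show "integrable lborel (\<lambda>z. \<bar>\<psi> z * g z\<bar>)" using int[OF that(1)] by simp
      show "\<bar>\<psi> z * g z\<bar> \<le> \<psi> z * B" for z
        using that(2)[of z] nn[of z] pos[of z]
        by (cases "\<psi> z = 0") (auto simp: abs_mult intro!: mult_left_mono)
    qed (intro int continuous_intros)
    also have "\<dots> = I * B" by (simp add: I_def)
    finally show ?thesis using I by (simp add: abs_divide field_simps)
  qed
  have lip: "\<bar>F x - F y\<bar> \<le> L * dist x y" for x y
    using lipschitz_onD[OF assms(1), of x y] by (simp add: dist_real_def)
  show ?thesis
  proof (intro exI[of _ \<phi>] conjI allI impI)
    fix m
    \<comment> \<open>Passage to the form with x in the bump. Since F vanishes off the box, the
      integral over the whole space becomes one over a compact box, as \<open>Ck_convolution\<close>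
      requires.\<close>
    have "(\<integral>z. \<psi> z * F (x - z) \<partial>lborel) = integral (cbox a b) (\<lambda>z. \<psi> (x - z) * F z)" for x
    proof -
      have "(\<integral>z. \<psi> z * F (x - z) \<partial>lborel) = (\<integral>z. \<psi> (x - z) * F z \<partial>lborel)"
        using lborel_integral_reflect[of "\<lambda>z. \<psi> z * F (x - z)" x] by simp
      also have "\<dots> = (\<integral>z\<in>cbox a b. \<psi> (x - z) * F z \<partial>lborel)"
        unfolding set_lebesgue_integral_def using F0 by (intro Bochner_Integration.integral_cong) (auto simp: indicator_def)
      also have "\<dots> = integral (cbox a b) (\<lambda>z. \<psi> (x - z) * F z)"
      proof (rule set_borel_integral_eq_integral(2))
        have "continuous_on (cbox a b) (\<lambda>z. \<psi> (x - z) * F z)"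
          by (intro continuous_intros continuous_on_compose2[OF cont] continuous_on_subset[OF F])
            (auto intro: continuous_intros)
        then show "set_integrable lborel (cbox a b) (\<lambda>z. \<psi> (x - z) * F z)"
          unfolding set_integrable_def by (intro borel_integrable_compact) auto
      qed
      finally show ?thesis .
    qed
    then have "\<phi> = (\<lambda>x. integral (cbox a b) (\<lambda>z. \<psi> (x - z) * F z) * (1 / I))"
      by (simp add: \<phi>_def fun_eq_iff)
    then show "Ck m \<phi>" by (simp only: Ck_mult[OF Ck_convolution[OF F Ck] Ck_const])
  next
    fix x
    show "0 \<le> \<phi> x" unfolding \<phi>_def using I nn assms(3) by (intro divide_nonneg_pos Bochner_Integration.integral_nonneg) auto
    have "\<bar>\<phi> x\<bar> \<le> N" unfolding \<phi>_def using assms(3,4) by (intro bnd contF) auto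
    then show "\<phi> x \<le> N" by simp
    show "\<bar>\<phi> x - F x\<bar> \<le> L * r" unfolding avg
    proof (intro bnd continuous_intros contF)
      fix z :: 'a assume "norm z < r"
      then have "L * norm z \<le> L * r" using lipschitz_on_nonneg[OF assms(1)] by (intro mult_left_mono) auto
      then show "\<bar>F (x - z) - F x\<bar> \<le> L * r" using lip[of "x - z" x] by (simp add: dist_norm)
    qed
  next
    show "L-lipschitz_on UNIV \<phi>"
    proof (rule lipschitz_onI)
      fix x y :: 'a
      have "\<phi> x - \<phi> y = (\<integral>z. \<psi> z * F (x - z) - \<psi> z * F (y - z) \<partial>lborel) / I"
        unfolding \<phi>_def using contF
        by (subst Bochner_Integration.integral_diff) (auto intro: int simp: diff_divide_distrib)
      also have "\<dots> = (\<integral>z. \<psi> z * (F (x - z) - F (y - z)) \<partial>lborel) / I" by (simp add: algebra_simps)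
      finally have eq: "\<phi> x - \<phi> y = (\<integral>z. \<psi> z * (F (x - z) - F (y - z)) \<partial>lborel) / I" .
      have "\<bar>\<phi> x - \<phi> y\<bar> \<le> L * dist x y" unfolding eq
      proof (rule bnd)
        show "continuous_on UNIV (\<lambda>z. F (x - z) - F (y - z))" by (intro continuous_on_diff contF)
        show "\<bar>F (x - z) - F (y - z)\<bar> \<le> L * dist x y" for z
          using lip[of "x - z" "y - z"] by (simp add: dist_norm)
      qed
      then show "dist (\<phi> x) (\<phi> y) \<le> L * dist x y" by (simp add: dist_real_def)
    qed (rule lipschitz_on_nonneg[OF assms(1)])
  next
    fix x assume x: "\<phi> x \<noteq> 0"
    show "\<exists>z. F z \<noteq> 0 \<and> dist x z \<le> r"
    proof (rule ccontr)
      assume no: "\<nexists>z. F z \<noteq> 0 \<and> dist x z \<le> r"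
      have "\<psi> z * F (x - z) = 0" for z
        using no[simplified, rule_format, of "x - z"] pos[of z] by (auto simp: dist_norm)
      then have "(\<lambda>z. \<psi> z * F (x - z)) = (\<lambda>_. 0)" by (rule ext)
      then have "\<phi> x = 0" unfolding \<phi>_def by simp
      then show False using x by simp
    qed
  qed
qed

text \<open>One bound N, one Lipschitz constant and one compact set S serve all j, so that a single
  integrable majorant dominates the whole sequence in \<open>tested_Lipschitz\<close>.\<close>

lemma smooth_approximation:
  fixes F :: "'a::euclidean_space \<Rightarrow> real"
  assumes "L-lipschitz_on UNIV F" "compact (supp F)" "\<And>x. 0 \<le> F x" "\<And>x. F x \<le> N"
    and "open \<Omega>" "supp F \<subseteq> \<Omega>"
  obtains \<phi> :: "nat \<Rightarrow> 'a \<Rightarrow> real" and S where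
    "\<And>j. \<phi> j \<in> test_functions \<Omega>" "\<And>j x. 0 \<le> \<phi> j x" "\<And>j x. \<phi> j x \<le> N"
    "\<And>j. L-lipschitz_on UNIV (\<phi> j)" "\<And>x. (\<lambda>j. \<phi> j x) \<longlonglongrightarrow> F x"
    "compact S" "S \<subseteq> \<Omega>" "\<And>j x. x \<notin> S \<Longrightarrow> \<phi> j x = 0"
proof -
  obtain e where e: "0 < e" "(\<Union>x\<in>supp F. ball x e) \<subseteq> \<Omega>"
    using compact_subset_open_imp_ball_epsilon_subset[OF assms(2,5,6)] by metis
  define S where "S = {x + y |x y. x \<in> supp F \<and> y \<in> cball 0 (e / 2)}"
  have S: "compact S" unfolding S_def by (intro compact_sums assms(2) compact_cball)
  have S\<Omega>: "S \<subseteq> \<Omega>"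
  proof
    fix z assume "z \<in> S"
    then obtain x y where "x \<in> supp F" "norm y \<le> e / 2" "z = x + y" by (auto simp: S_def)
    then have "x \<in> supp F" "z \<in> ball x e" using e(1) by (auto simp: dist_norm)
    then show "z \<in> \<Omega>" using e(2) by blast
  qed
  define r where "r j = e / 2 / real (Suc j)" for j
  have r: "0 < r j" "r j \<le> e / 2" for j
    using e(1) by (auto simp: r_def divide_le_eq)
  have "\<forall>j. \<exists>\<phi>. (\<forall>m. Ck m \<phi>) \<and> (\<forall>x. 0 \<le> \<phi> x \<and> \<phi> x \<le> N \<and> \<bar>\<phi> x - F x\<bar> \<le> L * r j)
    \<and> L-lipschitz_on UNIV \<phi> \<and> (\<forall>x. \<phi> x \<noteq> 0 \<longrightarrow> (\<exists>z. F z \<noteq> 0 \<and> dist x z \<le> r j))"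
    using assms(1-4) r by (intro allI mollification) auto
  then obtain \<phi> where \<phi>: "\<And>j m. Ck m (\<phi> j)" "\<And>j x. 0 \<le> \<phi> j x \<and> \<phi> j x \<le> N \<and> \<bar>\<phi> j x - F x\<bar> \<le> L * r j"
    "\<And>j. L-lipschitz_on UNIV (\<phi> j)" "\<And>j x. \<phi> j x \<noteq> 0 \<Longrightarrow> \<exists>z. F z \<noteq> 0 \<and> dist x z \<le> r j"
    by metis
  have out: "\<phi> j x = 0" if "x \<notin> S" for j x
  proof (rule ccontr)
    assume "\<phi> j x \<noteq> 0"
    then obtain z where z: "F z \<noteq> 0" "dist x z \<le> r j" using \<phi>(4) by blast
    have "z \<in> supp F" unfolding supp_def by (rule subsetD[OF closure_subset]) (simp add: z(1))
    moreover have "x - z \<in> cball 0 (e / 2)" using z(2) r(2)[of j] by (simp add: dist_norm norm_minus_commute)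
    moreover have "x = z + (x - z)" by simp
    ultimately have "x \<in> S" unfolding S_def by blast
    then show False using that by simp
  qed
  have suppS: "supp (\<phi> j) \<subseteq> S" for j
    unfolding supp_def using out compact_imp_closed[OF S] by (intro closure_minimal) auto
  show ?thesis
  proof (rule that)
    show "\<phi> j \<in> test_functions \<Omega>" for j
    proof -
      have "closed (supp (\<phi> j))" by (simp add: supp_def)
      from compact_Int_closed[OF S this] have "compact (supp (\<phi> j))"
        using suppS[of j] by (simp add: Int_absorb1)
      then show ?thesis using \<phi>(1) suppS[of j] S\<Omega> by (auto simp: test_functions_def)
    qed
    show "(\<lambda>j. \<phi> j x) \<longlonglongrightarrow> F x" for x
    proof (rule Lim_null[THEN iffD2], rule Lim_null_comparison)
      show "eventually (\<lambda>j. norm (\<phi> j x - F x) \<le> L * r j) sequentially" using \<phi>(2) by auto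
      have "(\<lambda>j. L * (e / 2) * (1 / real (Suc j))) \<longlonglongrightarrow> L * (e / 2) * 0"
        by (intro tendsto_mult tendsto_const lim_1_over_n[THEN LIMSEQ_Suc])
      then show "(\<lambda>j. L * r j) \<longlonglongrightarrow> 0" by (simp add: r_def)
    qed
  qed (use \<phi> out S S\<Omega> in auto)
qed

subsection \<open>The Caccioppoli inequality\<close>

definition frac_kernel :: "real \<Rightarrow> real \<Rightarrow> 'a::euclidean_space \<Rightarrow> 'a \<Rightarrow> real" where
  "frac_kernel s p x y = norm (x - y) powr (- real DIM('a) - s * p)"

lemma frac_kernel_commute: "frac_kernel s p x y = frac_kernel s p y x"
  by (simp add: frac_kernel_def norm_minus_commute)

lemma frac_kernel_nonneg [simp]: "0 \<le> frac_kernel s p x y"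
  by (simp add: frac_kernel_def)

lemma frac_kernel_refl [simp]: "frac_kernel s p x x = 0"
  by (simp add: frac_kernel_def)

lemma borel_measurable_frac_kernel [measurable (raw)]:
  fixes f g :: "'b \<Rightarrow> 'a::euclidean_space"
  assumes [measurable]: "f \<in> borel_measurable M" "g \<in> borel_measurable M"
  shows "(\<lambda>z. frac_kernel s p (f z) (g z)) \<in> borel_measurable M"
  unfolding frac_kernel_def by measurable

lemma borel_measurable_fst_snd [measurable]:
  "(fst :: 'a::euclidean_space \<times> 'b::euclidean_space \<Rightarrow> 'a) \<in> borel_measurable borel"
  "(snd :: 'a::euclidean_space \<times> 'b::euclidean_space \<Rightarrow> 'b) \<in> borel_measurable borel"
  by (auto intro!: borel_measurable_continuous_onI continuous_intros)

lemma nn_integral_lborel_pair: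
  fixes f :: "'a::euclidean_space \<times> 'a \<Rightarrow> ennreal"
  assumes "f \<in> borel_measurable borel"
  shows "(\<integral>\<^sup>+z. f z \<partial>lborel) = (\<integral>\<^sup>+x. \<integral>\<^sup>+y. f (x, y) \<partial>lborel \<partial>lborel)"
proof -
  have "f \<in> borel_measurable (lborel \<Otimes>\<^sub>M lborel)" using assms by (simp add: lborel_prod)
  then show ?thesis using lborel.nn_integral_fst[of f lborel] by (simp add: lborel_prod)
qed

lemma nn_integral_lborel_swap:
  fixes f :: "'a::euclidean_space \<times> 'a \<Rightarrow> ennreal"
  assumes [measurable]: "f \<in> borel_measurable borel"
  shows "(\<integral>\<^sup>+z. f (snd z, fst z) \<partial>lborel) = (\<integral>\<^sup>+z. f z \<partial>lborel)"
proof -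
  have f: "f \<in> borel_measurable (lborel \<Otimes>\<^sub>M lborel)" by (simp add: lborel_prod assms)
  have "(\<integral>\<^sup>+z. f (snd z, fst z) \<partial>lborel) = (\<integral>\<^sup>+x. \<integral>\<^sup>+y. f (y, x) \<partial>lborel \<partial>lborel)"
  proof (subst nn_integral_lborel_pair)
    have "(\<lambda>z. (snd z, fst z)) \<in> borel_measurable (borel :: ('a \<times> 'a) measure)"
      by (intro borel_measurable_continuous_onI continuous_intros)
    from measurable_compose[OF this assms]
    show "(\<lambda>z. f (snd z, fst z)) \<in> borel_measurable borel" .
  qed simp
  also have "\<dots> = (\<integral>\<^sup>+z. f z \<partial>lborel)" using lborel_pair.nn_integral_snd[OF f] by (simp add: lborel_prod)
  finally show ?thesis .
qed

text \<open>The kernel is a Borel function of the pair and the bounds hold almost everywhere: this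
  is what survives when a Lebesgue measurable kernel is replaced by a Borel representative.\<close>

definition kernel_bounds :: "real \<Rightarrow> real \<Rightarrow> real \<Rightarrow> ('a::euclidean_space \<times> 'a \<Rightarrow> ennreal) \<Rightarrow> bool" where
  "kernel_bounds s p \<Lambda> k \<longleftrightarrow> k \<in> borel_measurable borel \<and>
     (AE z in lborel. fst z \<noteq> snd z \<longrightarrow>
        ennreal (inverse \<Lambda> * frac_kernel s p (fst z) (snd z)) \<le> k z \<and>
        k z \<le> ennreal (\<Lambda> * frac_kernel s p (fst z) (snd z)))"

text \<open>The inequality \<open>\<E>(u, v) \<le> 0\<close>, including the finiteness that gives it a meaning.\<close>

definition tested :: "real \<Rightarrow> ('a::euclidean_space \<times> 'a \<Rightarrow> ennreal) \<Rightarrow> ('a \<Rightarrow> real) \<Rightarrow> ('a \<Rightarrow> real) \<Rightarrow> bool" where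
  "tested p k u v \<longleftrightarrow>
     (\<integral>\<^sup>+z. ennreal (energy_diff p u v (fst z) (snd z)) * k z \<partial>lborel)
       \<le> (\<integral>\<^sup>+z. ennreal (- energy_diff p u v (fst z) (snd z)) * k z \<partial>lborel) \<and>
     (\<integral>\<^sup>+z. ennreal (- energy_diff p u v (fst z) (snd z)) * k z \<partial>lborel) < \<infinity>"

text \<open>Brings the kernel into a pointwise inequality whose energy term X has no sign: the lower
  bound on \<kappa> is used where X >= 0, the upper bound where X < 0.\<close>

lemma kernel_weighted_le:
  fixes X D m Q K \<kappa> c C \<Lambda> :: real
  assumes "D \<le> c * X + C * m" "0 < c" "0 \<le> C" "0 \<le> m" "0 \<le> D" "1 \<le> \<Lambda>" "0 \<le> K"
    and "inverse \<Lambda> * K \<le> \<kappa>" "\<kappa> \<le> \<Lambda> * K"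
  shows "D * K / (c * \<Lambda>) \<le> X * \<kappa> + \<Lambda> * C / c * m * K"
proof (cases "0 \<le> X")
  case True
  have "D * K / (c * \<Lambda>) \<le> (c * X + C * m) * K / (c * \<Lambda>)"
    using assms by (intro divide_right_mono mult_right_mono) auto
  also have "\<dots> = X * (inverse \<Lambda> * K) + inverse \<Lambda> * (C / c * m * K)"
    using assms by (simp add: field_simps)
  also have "\<dots> \<le> X * \<kappa> + \<Lambda> * (C / c * m * K)"
  proof (intro add_mono mult_left_mono mult_right_mono)
    have "inverse \<Lambda> \<le> 1" using assms by (simp add: inverse_le_1_iff)
    then show "inverse \<Lambda> \<le> \<Lambda>" using assms by linarith
  qed (use True assms in auto)
  finally show ?thesis by (simp add: mult_ac)
next
  case False
  have DcL: "D * K / (c * \<Lambda>) \<le> \<Lambda> * (D * K / c)"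
  proof -
    have "D * K / c \<le> \<Lambda> * \<Lambda> * (D * K / c)"
      using assms mult_mono[of 1 \<Lambda> 1 \<Lambda>] mult_right_mono[of 1 "\<Lambda> * \<Lambda>" "D * K / c"] by auto
    then show ?thesis using assms by (simp add: field_simps)
  qed
  have "X * (\<Lambda> * K) \<le> X * \<kappa>" using False assms by (intro mult_left_mono_neg) auto
  moreover have "\<Lambda> * K * (D / c) \<le> \<Lambda> * K * (X + C / c * m)"
    using assms by (intro mult_left_mono) (auto simp: field_simps)
  ultimately show ?thesis using DcL by (simp add: algebra_simps)
qed

text \<open>Moves the negative part of X to the other side, so that the inequality can be integrated
  in [0, \<infinity>] with the positive and negative parts of the energy kept apart.\<close>

lemma ennreal_split_le:
  fixes D X Q :: real
  assumes "D \<le> X * \<kappa> + Q" "0 \<le> D" "0 \<le> Q" "0 \<le> \<kappa>"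
  shows "ennreal D + ennreal (- X) * ennreal \<kappa> \<le> ennreal X * ennreal \<kappa> + ennreal Q"
proof (cases "0 \<le> X")
  case True
  then show ?thesis using assms by (simp add: ennreal_neg flip: ennreal_mult ennreal_plus)
next
  case False
  then have X: "0 \<le> - X * \<kappa>" using assms by (intro mult_nonneg_nonneg) auto
  have "ennreal D + ennreal (- X) * ennreal \<kappa> = ennreal (D + - X * \<kappa>)"
    using False assms X by (simp only: ennreal_plus ennreal_mult)
  also have "\<dots> \<le> ennreal Q" using assms by (intro ennreal_leI) simp
  finally show ?thesis using False by (simp add: ennreal_neg)
qed

text \<open>Pairs are sorted by membership in the ball. Both points inside:
  \<open>Caccioppoli_pointwise\<close>. One inside: the cutoff vanishes at the other point, so
  \<open>Caccioppoli_pointwise_exterior\<close> applies and yields the tail. Both outside: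
  everything vanishes. The distance d between the support of \<eta> and the complement of the ball
  gives the powers of d.\<close>

lemma Caccioppoli_energy:
  fixes s p \<Lambda> :: real
  assumes s: "0 < s" "s < 1" and p: "1 < p" and \<Lambda>: "1 \<le> \<Lambda>"
  shows "\<exists>C>0. \<forall>(u :: 'a::euclidean_space \<Rightarrow> real) k x0 r d \<eta> l.
    u \<in> borel_measurable borel \<longrightarrow> kernel_bounds s p \<Lambda> k \<longrightarrow> 0 < d \<longrightarrow> d \<le> r \<longrightarrow> \<eta> \<in> borel_measurable borel \<longrightarrow>
    (\<forall>x. 0 \<le> \<eta> x \<and> \<eta> x \<le> 1) \<longrightarrow> (\<forall>x y. \<bar>\<eta> x - \<eta> y\<bar> \<le> norm (x - y) / d) \<longrightarrow>
    (\<forall>x. r - d \<le> dist x0 x \<longrightarrow> \<eta> x = 0) \<longrightarrow>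
    tested p k u (\<lambda>x. \<eta> x powr p * max (u x - l) 0) \<longrightarrow>
    (\<integral>\<^sup>+x. \<integral>\<^sup>+y. ennreal (\<bar>\<eta> x * max (u x - l) 0 - \<eta> y * max (u y - l) 0\<bar> powr p * frac_kernel s p x y) \<partial>lborel \<partial>lborel)
    \<le> ennreal C * (ennreal (d powr (- (s * p))) * (\<integral>\<^sup>+x\<in>ball x0 r. ennreal (max (u x - l) 0 powr p) \<partial>lborel)
      + ennreal ((r / d) powr (real DIM('a) + s * p))
        * (\<integral>\<^sup>+y\<in>- ball x0 r. ennreal (max (u y - l) 0 powr (p - 1) * frac_kernel s p y x0) \<partial>lborel)
        * (\<integral>\<^sup>+x\<in>ball x0 r. ennreal (max (u x - l) 0) \<partial>lborel))"
proof -
  obtain Ck where Ck: "0 < Ck" "\<And>d (x::'a). 0 < d \<Longrightarrow>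
    (\<integral>\<^sup>+y. ennreal (min 1 (norm (x - y) / d) powr p * frac_kernel s p x y) \<partial>lborel) \<le> ennreal (Ck * d powr (- (s * p)))"
    using kernel_integral[OF s p, where 'a = 'a] unfolding frac_kernel_def by blast
  define c where "c = (2::real) powr (p + 1)"
  have c: "0 < c" by (simp add: c_def)
  define C1 where "C1 = \<Lambda> * Caccioppoli_const p / c"
  have C1: "0 < C1" using \<Lambda> c Caccioppoli_const_pos[OF p] by (simp add: C1_def)
  define c' where "c' = 1 / (c * \<Lambda>)"
  have c': "0 < c'" using \<Lambda> c by (simp add: c'_def)
  define q where "q = real DIM('a) + s * p"
  have q: "0 < q" using s p by (simp add: q_def add_pos_pos)
  \<comment> \<open>The factor 2 counts each error together with its transpose, division by
    \<open>c'\<close> frees the left-hand side, and one constant covers both error terms.\<close>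
  define C where "C = 2 * (C1 * Ck + c' * Ck + \<Lambda>) / c'"
  have Cpos: "0 < C" unfolding C_def using C1 Ck c' \<Lambda> by (intro divide_pos_pos mult_pos_pos add_pos_pos) auto
  show ?thesis
  proof (intro exI[of _ C] conjI allI impI Cpos)
    fix u :: "'a \<Rightarrow> real" and k x0 and r d :: real and \<eta> l
    assume [measurable]: "u \<in> borel_measurable borel" and kb: "kernel_bounds s p \<Lambda> k" and d: "0 < d" "d \<le> r"
      and [measurable]: "\<eta> \<in> borel_measurable borel"
      and \<eta>01: "\<forall>x. 0 \<le> \<eta> x \<and> \<eta> x \<le> 1" and \<eta>lip: "\<forall>x y. \<bar>\<eta> x - \<eta> y\<bar> \<le> norm (x - y) / d"
      and \<eta>0: "\<forall>x. r - d \<le> dist x0 x \<longrightarrow> \<eta> x = 0"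
      and test: "tested p k u (\<lambda>x. \<eta> x powr p * max (u x - l) 0)"
    define B where "B = ball x0 r"
    have [measurable]: "B \<in> sets borel" by (simp add: B_def)
    have [measurable]: "k \<in> borel_measurable borel" using kb by (simp add: kernel_bounds_def)
    define w where "w x = max (u x - l) 0" for x
    have w0: "0 \<le> w x" for x by (simp add: w_def)
    have [measurable]: "w \<in> borel_measurable borel" unfolding w_def by measurable
    let ?K = "frac_kernel s p :: 'a \<Rightarrow> 'a \<Rightarrow> real"
    let ?X = "\<lambda>x y. energy_diff p u (\<lambda>x. \<eta> x powr p * w x) x y"
    have \<eta>B: "\<eta> x = 0" if "x \<notin> B" for x using \<eta>0 d that by (auto simp: B_def)
    define D where "D x y = \<bar>\<eta> x * w x - \<eta> y * w y\<bar> powr p" for x y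
    \<comment> \<open>\<open>q1\<close> is the error of pairs inside B and \<open>q2\<close> that of
      pairs with only x inside. For the latter the left-hand side, which is just (\<eta> w)^p at x
      times the kernel, is itself put into the error: the energy gives no positive control
      there.\<close>
    define q1 where "q1 x y = C1 * ((w x powr p + w y powr p) * \<bar>\<eta> x - \<eta> y\<bar> powr p) * ?K x y * indicator B x * indicator B y" for x y
    define q2 where "q2 x y = (c' * (\<eta> x * w x) powr p + \<Lambda> * (w y powr (p - 1) * (\<eta> x powr p * w x))) * ?K x y * indicator B x * indicator (- B) y" for x y
    have q1n: "0 \<le> q1 x y" for x y using C1 by (auto simp: q1_def)
    have q2n: "0 \<le> q2 x y" for x y using c' \<Lambda> w0 by (auto simp: q2_def intro!: mult_nonneg_nonneg add_nonneg_nonneg)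
    have cross: "c' * (D x y * ?K x y) \<le> ?X x y * \<kappa> + q2 x y"
      if "x \<in> B" "y \<notin> B" "\<kappa> \<le> \<Lambda> * ?K x y" "0 \<le> \<kappa>" for x y \<kappa>
    proof -
      have Y: "\<eta> y = 0" using \<eta>B that by simp
      have "- ?X x y \<le> w y powr (p - 1) * (\<eta> x powr p * w x)"
        using Caccioppoli_pointwise_exterior[OF p, of "\<eta> x powr p" "u x" "u y" l] by (simp add: energy_diff_def Y w_def)
      then have "- ?X x y * \<kappa> \<le> w y powr (p - 1) * (\<eta> x powr p * w x) * \<kappa>"
        using that by (intro mult_right_mono) auto
      also have "\<dots> \<le> w y powr (p - 1) * (\<eta> x powr p * w x) * (\<Lambda> * ?K x y)"
        using that w0 by (intro mult_left_mono) auto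
      finally show ?thesis using that \<eta>01 w0 by (simp add: D_def Y q2_def algebra_simps)
    qed
    have sym: "?X x y = ?X y x" "D x y = D y x" "?K x y = ?K y x" for x y
      by (auto simp: energy_diff_def D_def abs_minus_commute frac_kernel_commute algebra_simps)
    have pw: "c' * (D x y * ?K x y) \<le> ?X x y * \<kappa> + (q1 x y + q2 x y + q2 y x)"
      if "inverse \<Lambda> * ?K x y \<le> \<kappa>" "\<kappa> \<le> \<Lambda> * ?K x y" for x y \<kappa>
    proof -
      have \<kappa>: "0 \<le> \<kappa>" using that(1) \<Lambda> order_trans[of 0 "inverse \<Lambda> * ?K x y" \<kappa>] by simp
      consider "x \<in> B" "y \<in> B" | "x \<in> B" "y \<notin> B" | "x \<notin> B" "y \<in> B" | "x \<notin> B" "y \<notin> B" by blast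
      then show ?thesis
      proof cases
        case 1
        have "D x y \<le> c * ?X x y + Caccioppoli_const p * ((w x powr p + w y powr p) * \<bar>\<eta> x - \<eta> y\<bar> powr p)"
          using Caccioppoli_pointwise[OF p, of "\<eta> x" "\<eta> y" "u x" l "u y"] \<eta>01
          by (simp add: D_def c_def energy_diff_def w_def)
        from kernel_weighted_le[OF this c _ _ _ \<Lambda> _ that] Caccioppoli_const_pos[OF p]
        have "D x y * ?K x y / (c * \<Lambda>) \<le> ?X x y * \<kappa> + \<Lambda> * Caccioppoli_const p / c * ((w x powr p + w y powr p) * \<bar>\<eta> x - \<eta> y\<bar> powr p) * ?K x y"
          by (simp add: D_def)
        then show ?thesis using 1 by (simp add: c'_def q1_def q2_def C1_def)
      next
        case 2
        then show ?thesis using cross[of x y \<kappa>] that \<kappa> q1n[of x y] q2n[of y x] by simp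
      next
        case 3
        then have "c' * (D y x * ?K y x) \<le> ?X y x * \<kappa> + q2 y x"
          using cross[of y x \<kappa>] that \<kappa> sym(3)[of x y] by simp
        then show ?thesis using q1n[of x y] q2n[of x y] sym[of x y] by simp
      next
        case 4
        then show ?thesis using \<eta>B p by (simp add: D_def q1_def q2_def energy_diff_def)
      qed
    qed
    define E1 where "E1 z = ennreal (?X (fst z) (snd z)) * k z" for z
    define E2 where "E2 z = ennreal (- ?X (fst z) (snd z)) * k z" for z
    define P where "P z = ennreal (c' * (D (fst z) (snd z) * ?K (fst z) (snd z)))" for z
    define Q1 where "Q1 z = ennreal (q1 (fst z) (snd z))" for z
    define Q2 where "Q2 z = ennreal (q2 (fst z) (snd z))" for z
    have [measurable]: "E1 \<in> borel_measurable borel" "E2 \<in> borel_measurable borel" "P \<in> borel_measurable borel"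
      "Q1 \<in> borel_measurable borel" "Q2 \<in> borel_measurable borel"
      unfolding E1_def E2_def P_def Q1_def Q2_def energy_diff_def D_def q1_def q2_def by measurable
    have [measurable]: "(\<lambda>z. Q2 (snd z, fst z)) \<in> borel_measurable borel"
      unfolding Q2_def q2_def by simp
    have "AE z in lborel. fst z \<noteq> snd z \<longrightarrow> ennreal (inverse \<Lambda> * ?K (fst z) (snd z)) \<le> k z \<and> k z \<le> ennreal (\<Lambda> * ?K (fst z) (snd z))"
      using kb by (simp add: kernel_bounds_def)
    then have "AE z in lborel. P z + E2 z \<le> E1 z + (Q1 z + Q2 z + Q2 (snd z, fst z))"
    proof eventually_elim
      fix z :: "'a \<times> 'a"
      assume H: "fst z \<noteq> snd z \<longrightarrow> ennreal (inverse \<Lambda> * ?K (fst z) (snd z)) \<le> k z \<and> k z \<le> ennreal (\<Lambda> * ?K (fst z) (snd z))"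
      obtain x y where z: "z = (x, y)" by force
      show "P z + E2 z \<le> E1 z + (Q1 z + Q2 z + Q2 (snd z, fst z))"
      proof (cases "x = y")
        case True
        then show ?thesis by (simp add: z P_def E2_def energy_diff_def)
      next
        case False
        then have k1: "ennreal (inverse \<Lambda> * ?K x y) \<le> k z" "k z \<le> ennreal (\<Lambda> * ?K x y)" using H z by auto
        then obtain \<kappa> where \<kappa>: "k z = ennreal \<kappa>" "0 \<le> \<kappa>" by (cases "k z") (auto simp: top_unique)
        have "inverse \<Lambda> * ?K x y \<le> \<kappa>" using k1 \<kappa> \<Lambda> by (simp add: ennreal_le_iff)
        moreover have "\<kappa> \<le> \<Lambda> * ?K x y" using k1 \<kappa> \<Lambda> by (simp add: ennreal_le_iff)
        ultimately have "c' * (D x y * ?K x y) \<le> ?X x y * \<kappa> + (q1 x y + q2 x y + q2 y x)" by (rule pw)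
        from ennreal_split_le[OF this _ _ \<kappa>(2)] q1n q2n c'
        show ?thesis by (simp add: z P_def E1_def E2_def Q1_def Q2_def \<kappa>(1)[unfolded z] D_def add_nonneg_nonneg)
      qed
    qed
    then have "(\<integral>\<^sup>+z. P z + E2 z \<partial>lborel) \<le> (\<integral>\<^sup>+z. E1 z + (Q1 z + Q2 z + Q2 (snd z, fst z)) \<partial>lborel)"
      by (rule nn_integral_mono_AE)
    also have "\<dots> = (\<integral>\<^sup>+z. E1 z \<partial>lborel) + ((\<integral>\<^sup>+z. Q1 z \<partial>lborel) + (\<integral>\<^sup>+z. Q2 z \<partial>lborel) + (\<integral>\<^sup>+z. Q2 z \<partial>lborel))"
      by (simp add: nn_integral_add nn_integral_lborel_swap)
    also have "(\<integral>\<^sup>+z. E1 z \<partial>lborel) \<le> (\<integral>\<^sup>+z. E2 z \<partial>lborel)"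
      using test by (simp add: tested_def E1_def E2_def w_def)
    finally have "(\<integral>\<^sup>+z. E2 z \<partial>lborel) + (\<integral>\<^sup>+z. P z \<partial>lborel)
      \<le> (\<integral>\<^sup>+z. E2 z \<partial>lborel) + ((\<integral>\<^sup>+z. Q1 z \<partial>lborel) + (\<integral>\<^sup>+z. Q2 z \<partial>lborel) + (\<integral>\<^sup>+z. Q2 z \<partial>lborel))"
      by (simp add: nn_integral_add add.commute add_right_mono)
    \<comment> \<open>The negative part of the energy occurs on both sides; it may be cancelled only
      because \<open>tested\<close> includes its finiteness.\<close>
    moreover have "(\<integral>\<^sup>+z. E2 z \<partial>lborel) < \<infinity>"
      using test by (simp add: tested_def E2_def w_def)
    ultimately have PQ: "(\<integral>\<^sup>+z. P z \<partial>lborel) \<le> (\<integral>\<^sup>+z. Q1 z \<partial>lborel) + (\<integral>\<^sup>+z. Q2 z \<partial>lborel) + (\<integral>\<^sup>+z. Q2 z \<partial>lborel)"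
      by (auto simp: ennreal_add_left_cancel_le)
    define W where "W = (\<integral>\<^sup>+x\<in>B. ennreal (w x powr p) \<partial>lborel)"
    define W1 where "W1 = (\<integral>\<^sup>+x\<in>B. ennreal (w x) \<partial>lborel)"
    define T where "T = (\<integral>\<^sup>+y\<in>- B. ennreal (w y powr (p - 1) * ?K y x0) \<partial>lborel)"
    define M where "M x y = ennreal (min 1 (norm (x - y) / d) powr p * ?K x y)" for x y :: 'a
    define dk where "dk = Ck * d powr (- (s * p))"
    have dk: "0 \<le> dk" using Ck by (simp add: dk_def)
    have M: "(\<integral>\<^sup>+y. M x y \<partial>lborel) \<le> ennreal dk" for x
      unfolding M_def dk_def using Ck d by auto
    have [measurable]: "case_prod M \<in> borel_measurable (lborel \<Otimes>\<^sub>M lborel)" "M x \<in> borel_measurable borel" for x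
      unfolding M_def by measurable
    have MW: "(\<integral>\<^sup>+x. \<integral>\<^sup>+y. ennreal (w x powr p) * indicator B x * M x y \<partial>lborel \<partial>lborel) \<le> ennreal dk * W"
    proof -
      have "(\<integral>\<^sup>+x. \<integral>\<^sup>+y. ennreal (w x powr p) * indicator B x * M x y \<partial>lborel \<partial>lborel)
        \<le> (\<integral>\<^sup>+x. ennreal (w x powr p) * indicator B x * ennreal dk \<partial>lborel)"
        by (intro nn_integral_mono) (auto simp: nn_integral_cmult intro!: mult_left_mono M)
      also have "\<dots> = W * ennreal dk" unfolding W_def by (rule nn_integral_multc) measurable
      also have "\<dots> = ennreal dk * W" by (rule mult.commute)
      finally show ?thesis .
    qed
    \<comment> \<open>Common majorant for \<open>q1\<close> and for the first half of
      \<open>q2\<close>; its inner integral is bounded by \<open>kernel_integral\<close>.\<close>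
    define H where "H z = ennreal (w (fst z) powr p) * indicator B (fst z) * M (fst z) (snd z)" for z
    have [measurable]: "H \<in> borel_measurable borel" unfolding H_def M_def by measurable
    have HW: "(\<integral>\<^sup>+z. H z \<partial>lborel) \<le> ennreal dk * W"
      using MW by (subst nn_integral_lborel_pair) (simp_all add: H_def)
    have [measurable]: "(\<lambda>z. H (snd z, fst z)) \<in> borel_measurable borel"
      unfolding H_def M_def by simp
    have Q1b: "(\<integral>\<^sup>+z. Q1 z \<partial>lborel) \<le> ennreal (2 * C1) * (ennreal dk * W)"
    proof -
      have "Q1 z \<le> ennreal C1 * (H z + H (snd z, fst z))" for z
      proof -
        obtain x y where z: "z = (x, y)" by force
        have \<eta>m: "\<bar>\<eta> x - \<eta> y\<bar> powr p \<le> min 1 (norm (x - y) / d) powr p"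
        proof (intro powr_mono2 min.boundedI)
          show "\<bar>\<eta> x - \<eta> y\<bar> \<le> 1"
            using \<eta>01[rule_format, of x] \<eta>01[rule_format, of y] by linarith
        qed (use \<eta>lip p in auto)
        have "q1 x y \<le> C1 * (w x powr p * (indicator B x * (min 1 (norm (x - y) / d) powr p * ?K x y))
            + w y powr p * (indicator B y * (min 1 (norm (x - y) / d) powr p * ?K x y)))"
          unfolding q1_def using C1 mult_right_mono[OF \<eta>m, of "?K x y"]
          by (auto simp: indicator_def algebra_simps intro!: add_mono mult_left_mono)
        then have "Q1 z \<le> ennreal (C1 * (w x powr p * (indicator B x * (min 1 (norm (x - y) / d) powr p * ?K x y))
            + w y powr p * (indicator B y * (min 1 (norm (x - y) / d) powr p * ?K x y))))"
          unfolding Q1_def z by (simp add: ennreal_leI)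
        also have "\<dots> = ennreal C1 * (H z + H (snd z, fst z))"
          using C1 by (auto simp: H_def M_def z indicator_def norm_minus_commute frac_kernel_commute[of s p y x] ennreal_mult
              simp flip: ennreal_plus ennreal_mult)
        finally show ?thesis .
      qed
      then have "(\<integral>\<^sup>+z. Q1 z \<partial>lborel) \<le> (\<integral>\<^sup>+z. ennreal C1 * (H z + H (snd z, fst z)) \<partial>lborel)"
        by (intro nn_integral_mono) auto
      also have "\<dots> = ennreal C1 * ((\<integral>\<^sup>+z. H z \<partial>lborel) + (\<integral>\<^sup>+z. H z \<partial>lborel))"
        by (simp add: nn_integral_cmult nn_integral_add nn_integral_lborel_swap)
      also have "\<dots> \<le> ennreal C1 * (ennreal dk * W + ennreal dk * W)"
        by (intro mult_left_mono add_mono HW) auto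
      also have "\<dots> = ennreal (2 * C1) * (ennreal dk * W)"
      proof -
        have "ennreal (2 * C1) = ennreal C1 + ennreal C1" using C1 by (simp flip: ennreal_plus)
        then show ?thesis by (simp only: distrib_left distrib_right)
      qed
      finally show ?thesis .
    qed
    have Q2b: "(\<integral>\<^sup>+z. Q2 z \<partial>lborel) \<le> ennreal c' * (ennreal dk * W) + ennreal \<Lambda> * (ennreal ((r / d) powr q) * T * W1)"
    proof -
      define J where "J z = ennreal (w (fst z)) * indicator B (fst z)
        * (ennreal (w (snd z) powr (p - 1) * ?K (snd z) x0) * indicator (- B) (snd z))" for z
      have [measurable]: "J \<in> borel_measurable borel" unfolding J_def by measurable
      have "Q2 z \<le> ennreal c' * H z + ennreal \<Lambda> * (ennreal ((r / d) powr q) * J z)" for z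
      proof -
        obtain x y where z: "z = (x, y)" by force
        show ?thesis
        proof (cases "x \<in> B \<and> y \<notin> B \<and> \<eta> x \<noteq> 0")
          case False
          then have "q2 x y = 0" using p by (auto simp: q2_def)
          then show ?thesis by (simp add: Q2_def z)
        next
          case True
          then have x: "dist x0 x < r - d" using \<eta>0 not_less by blast
          have y: "r \<le> dist x0 y" using True by (simp add: B_def)
          have dxy: "d \<le> norm (x - y)" using x y dist_triangle[of x0 y x] by (simp add: dist_norm)
          \<comment> \<open>Moves the centre of the kernel from x to x0: since x stays d away from
            the boundary, |y - x0| <= (r/d) |x - y|, at the price of the factor (r/d)^q.\<close>
          have "norm (y - x0) * d \<le> norm (x - y) * r"
          proof -
            have "norm (y - x0) \<le> norm (x - y) + (r - d)"
              using x dist_triangle[of y x0 x] by (simp add: dist_norm norm_minus_commute)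
            then have "norm (y - x0) * d \<le> (norm (x - y) + (r - d)) * d"
              using d by (intro mult_right_mono) auto
            also have "\<dots> \<le> norm (x - y) * d + (r - d) * norm (x - y)"
              using mult_left_mono[OF dxy, of "r - d"] d by (simp add: algebra_simps)
            finally show ?thesis by (simp add: algebra_simps)
          qed
          then have le: "norm (y - x0) / (r / d) \<le> norm (x - y)" using d by (simp add: field_simps)
          have yx0: "0 < norm (y - x0)" using y d by auto
          have Kq: "?K a b = norm (a - b) powr (- q)" for a b by (simp add: frac_kernel_def q_def)
          have "?K x y \<le> (norm (y - x0) / (r / d)) powr (- q)"
            unfolding Kq using le yx0 d q by (intro powr_mono2') auto
          also have "\<dots> = (r / d) powr q * ?K y x0"
            unfolding Kq using yx0 d by (simp add: powr_divide powr_minus powr_mult field_simps)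
          finally have Kle: "?K x y \<le> (r / d) powr q * ?K y x0" .
          have \<eta>1: "\<eta> x powr p \<le> 1" using \<eta>01 p powr_mono2[of p "\<eta> x" 1] by simp
          \<comment> \<open>The points are at distance at least d, so the truncated factor in
            \<open>H\<close> is 1 and \<open>H\<close> contains the full kernel here.\<close>
          have m1: "min 1 (norm (x - y) / d) = 1" using dxy d by simp
          have A1: "(\<eta> x * w x) powr p * ?K x y \<le> w x powr p * ?K x y"
            using \<eta>1 \<eta>01 w0 by (auto simp: powr_mult intro!: mult_right_mono mult_left_le_one_le)
          have "w y powr (p - 1) * (\<eta> x powr p * w x) * ?K x y
              \<le> w y powr (p - 1) * (1 * w x) * ((r / d) powr q * ?K y x0)"
            using Kle \<eta>1 w0 by (intro mult_mono mult_left_mono mult_right_mono mult_nonneg_nonneg) auto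
          then have A2: "w y powr (p - 1) * (\<eta> x powr p * w x) * ?K x y
              \<le> (r / d) powr q * (w x * (w y powr (p - 1) * ?K y x0))" by (simp add: mult_ac)
          have "q2 x y = c' * ((\<eta> x * w x) powr p * ?K x y) + \<Lambda> * (w y powr (p - 1) * (\<eta> x powr p * w x) * ?K x y)"
            using True by (simp add: q2_def algebra_simps)
          also have "\<dots> \<le> c' * (w x powr p * ?K x y) + \<Lambda> * ((r / d) powr q * (w x * (w y powr (p - 1) * ?K y x0)))"
            using A1 A2 c' \<Lambda> by (intro add_mono mult_left_mono) auto
          finally have "Q2 z \<le> ennreal (c' * (w x powr p * ?K x y) + \<Lambda> * ((r / d) powr q * (w x * (w y powr (p - 1) * ?K y x0))))"
            by (simp add: Q2_def z ennreal_leI)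
          also have "\<dots> = ennreal c' * H z + ennreal \<Lambda> * (ennreal ((r / d) powr q) * J z)"
            using True c' \<Lambda> w0 by (simp add: H_def M_def J_def z m1 ennreal_mult)
          finally show ?thesis .
        qed
      qed
      then have "(\<integral>\<^sup>+z. Q2 z \<partial>lborel) \<le> (\<integral>\<^sup>+z. ennreal c' * H z + ennreal \<Lambda> * (ennreal ((r / d) powr q) * J z) \<partial>lborel)"
        by (intro nn_integral_mono) auto
      also have "\<dots> = ennreal c' * (\<integral>\<^sup>+z. H z \<partial>lborel) + ennreal \<Lambda> * (ennreal ((r / d) powr q) * (\<integral>\<^sup>+z. J z \<partial>lborel))"
        by (simp add: nn_integral_cmult nn_integral_add)
      also have "(\<integral>\<^sup>+z. J z \<partial>lborel) = T * W1"
        by (subst nn_integral_lborel_pair)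
          (simp_all add: J_def T_def W1_def nn_integral_cmult nn_integral_multc mult.commute)
      also have "ennreal c' * (\<integral>\<^sup>+z. H z \<partial>lborel) + ennreal \<Lambda> * (ennreal ((r / d) powr q) * (T * W1))
        \<le> ennreal c' * (ennreal dk * W) + ennreal \<Lambda> * (ennreal ((r / d) powr q) * T * W1)"
        using HW by (simp add: mult.assoc mult_left_mono)
      finally show ?thesis .
    qed
    define G where "G = (\<integral>\<^sup>+x. \<integral>\<^sup>+y. ennreal (D x y * ?K x y) \<partial>lborel \<partial>lborel)"
    have "(\<integral>\<^sup>+z. P z \<partial>lborel) = ennreal c' * G"
    proof -
      have "(\<integral>\<^sup>+z. P z \<partial>lborel) = (\<integral>\<^sup>+z. ennreal c' * ennreal (D (fst z) (snd z) * ?K (fst z) (snd z)) \<partial>lborel)"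
        using c' by (simp add: P_def D_def ennreal_mult)
      also have "\<dots> = ennreal c' * (\<integral>\<^sup>+z. ennreal (D (fst z) (snd z) * ?K (fst z) (snd z)) \<partial>lborel)"
        unfolding D_def by (subst nn_integral_cmult) auto
      also have "(\<integral>\<^sup>+z. ennreal (D (fst z) (snd z) * ?K (fst z) (snd z)) \<partial>lborel) = G"
        unfolding G_def D_def by (subst nn_integral_lborel_pair) auto
      finally show ?thesis .
    qed
    then have "ennreal c' * G \<le> ennreal (2 * C1) * (ennreal dk * W)
        + (ennreal c' * (ennreal dk * W) + ennreal \<Lambda> * (ennreal ((r / d) powr q) * T * W1))
        + (ennreal c' * (ennreal dk * W) + ennreal \<Lambda> * (ennreal ((r / d) powr q) * T * W1))"
      using PQ Q1b Q2b by (auto intro: order_trans add_mono)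
    also have "\<dots> = ennreal (2 * (C1 * Ck + c' * Ck)) * (ennreal (d powr (- (s * p))) * W)
        + ennreal (2 * \<Lambda>) * (ennreal ((r / d) powr q) * T * W1)"
    proof -
      have "ennreal (2 * C1) * (ennreal dk * W) + ennreal c' * (ennreal dk * W) + ennreal c' * (ennreal dk * W)
        = ennreal (2 * C1 * dk + c' * dk + c' * dk) * W"
      proof -
        have nn: "0 \<le> 2 * C1" "0 \<le> c'" "0 \<le> 2 * C1 * dk" "0 \<le> c' * dk" "0 \<le> 2 * C1 * dk + c' * dk"
          using C1 c' dk by auto
        have "ennreal (2 * C1) * (ennreal dk * W) = ennreal (2 * C1 * dk) * W"
          by (subst ennreal_mult[OF nn(1) dk]) (rule mult.assoc[symmetric])
        moreover have "ennreal c' * (ennreal dk * W) = ennreal (c' * dk) * W"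
          by (subst ennreal_mult[OF nn(2) dk]) (rule mult.assoc[symmetric])
        ultimately show ?thesis
          by (simp only: ennreal_plus[OF nn(5,4)] ennreal_plus[OF nn(3,4)] distrib_right)
      qed
      also have "2 * C1 * dk + c' * dk + c' * dk = (2 * (C1 * Ck + c' * Ck)) * d powr (- (s * p))"
        by (simp add: dk_def algebra_simps)
      also have "ennreal \<dots> = ennreal (2 * (C1 * Ck + c' * Ck)) * ennreal (d powr (- (s * p)))"
        using C1 c' Ck by (intro ennreal_mult) auto
      finally have 1: "ennreal (2 * C1) * (ennreal dk * W) + ennreal c' * (ennreal dk * W) + ennreal c' * (ennreal dk * W)
        = ennreal (2 * (C1 * Ck + c' * Ck)) * (ennreal (d powr (- (s * p))) * W)" by (simp add: mult.assoc)
      have 2: "ennreal \<Lambda> * Y + ennreal \<Lambda> * Y = ennreal (2 * \<Lambda>) * Y" for Y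
      proof -
        have "ennreal (2 * \<Lambda>) = ennreal \<Lambda> + ennreal \<Lambda>" using \<Lambda> by (simp flip: ennreal_plus)
        then show ?thesis by (simp only: distrib_right)
      qed
      show ?thesis unfolding 1[symmetric] 2[symmetric] by (simp add: add_ac)
    qed
    also have "\<dots> \<le> ennreal (C * c') * (ennreal (d powr (- (s * p))) * W)
        + ennreal (C * c') * (ennreal ((r / d) powr q) * T * W1)"
    proof -
      have "C * c' = 2 * (C1 * Ck + c' * Ck + \<Lambda>)" using c' by (simp add: C_def)
      then have "2 * (C1 * Ck + c' * Ck) \<le> C * c'" "2 * \<Lambda> \<le> C * c'" using C1 Ck c' \<Lambda> by auto
      then show ?thesis by (intro add_mono mult_right_mono ennreal_leI) auto
    qed
    also have "\<dots> = ennreal c' * (ennreal C * (ennreal (d powr (- (s * p))) * W + ennreal ((r / d) powr q) * T * W1))"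
      using Cpos c' by (simp add: ennreal_mult distrib_left mult_ac)
    finally have "G \<le> ennreal C * (ennreal (d powr (- (s * p))) * W + ennreal ((r / d) powr q) * T * W1)"
      using c' by (subst (asm) ennreal_mult_le_mult_iff) auto
    then show "(\<integral>\<^sup>+x. \<integral>\<^sup>+y. ennreal (\<bar>\<eta> x * max (u x - l) 0 - \<eta> y * max (u y - l) 0\<bar> powr p * ?K x y) \<partial>lborel \<partial>lborel)
    \<le> ennreal C * (ennreal (d powr (- (s * p))) * (\<integral>\<^sup>+x\<in>ball x0 r. ennreal (max (u x - l) 0 powr p) \<partial>lborel)
      + ennreal ((r / d) powr (real DIM('a) + s * p))
        * (\<integral>\<^sup>+y\<in>- ball x0 r. ennreal (max (u y - l) 0 powr (p - 1) * ?K y x0) \<partial>lborel)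
        * (\<integral>\<^sup>+x\<in>ball x0 r. ennreal (max (u x - l) 0) \<partial>lborel))"
      unfolding G_def D_def W_def T_def W1_def w_def B_def q_def .
  qed
qed

subsection \<open>De Giorgi iteration\<close>

lemma powr_divide_eq_mult:
  fixes a b x :: real
  assumes "0 \<le> a" "0 < b"
  shows "(a / b) powr x = a powr x * b powr (- x)"
  using assms powr_divide[of a b x] by (simp add: powr_minus_divide)

text \<open>By induction a_j <= A r^j. The ratio r = b^(-1/\<theta>) makes b^j (r^j)^\<theta> equal
  to 1, and the threshold A is the value with D A^\<theta> = r, so each step gains exactly one
  factor r.\<close>

lemma fast_geometric_convergence:
  fixes a :: "nat \<Rightarrow> real"
  assumes "0 < \<theta>" "1 < b" "0 < D" "\<And>j. 0 \<le> a j"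
    and step: "\<And>j. a (Suc j) \<le> D * b ^ j * (a j powr \<theta> * a j)"
    and start: "a 0 \<le> D powr (- (1 / \<theta>)) * b powr (- (1 / \<theta>\<^sup>2))"
  shows "a \<longlonglongrightarrow> 0"
proof -
  define A where "A = D powr (- (1 / \<theta>)) * b powr (- (1 / \<theta>\<^sup>2))"
  define r where "r = b powr (- (1 / \<theta>))"
  have A: "0 < A" using assms by (simp add: A_def)
  have r: "0 < r" "r < 1" using assms by (auto simp: r_def powr_less_one)
  have "A powr \<theta> = D powr (- 1) * b powr (- (1 / \<theta>))"
    using assms by (simp add: A_def powr_mult powr_powr power2_eq_square)
  then have A\<theta>: "D * A powr \<theta> = r" using assms by (simp add: r_def powr_minus field_simps)
  have br: "b ^ j * (r ^ j) powr \<theta> = 1" for j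
  proof -
    have "(r ^ j) powr \<theta> = r powr (real j * \<theta>)" using r by (simp add: powr_powr flip: powr_realpow)
    also have "\<dots> = b powr (- real j)" using assms by (simp add: r_def powr_powr)
    finally show ?thesis using assms by (simp add: powr_minus powr_realpow)
  qed
  have bound: "a j \<le> A * r ^ j" for j
  proof (induction j)
    case 0
    then show ?case using start by (simp add: A_def)
  next
    case (Suc j)
    have "a (Suc j) \<le> D * b ^ j * (a j powr \<theta> * a j)" by (rule step)
    also have "\<dots> \<le> D * b ^ j * ((A * r ^ j) powr \<theta> * (A * r ^ j))"
      using Suc assms A r by (intro mult_left_mono mult_mono powr_mono2) auto
    also have "\<dots> = (D * A powr \<theta>) * (b ^ j * (r ^ j) powr \<theta>) * (A * r ^ j)"
      using A r by (simp add: powr_mult mult_ac)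
    also have "\<dots> = A * r ^ Suc j" by (simp add: A\<theta> br)
    finally show ?case .
  qed
  have "(\<lambda>j. A * r ^ j) \<longlonglongrightarrow> A * 0" using r by (intro tendsto_mult tendsto_const LIMSEQ_power_zero) auto
  then show ?thesis using assms bound
    by (intro tendsto_sandwich[OF _ _ tendsto_const, of 0 a sequentially "\<lambda>j. A * r ^ j"]) auto
qed

text \<open>Where u exceeds l', the truncation at l is at least h = l' - l. By Chebyshev the support
  of the upper truncation has measure at most h^(-p) m and its integral is at most h^(1-p) m. So
  \<open>Caccioppoli_energy\<close> and \<open>Faber_Krahn\<close> can be expressed through m alone,
  with a power of m larger than 1.\<close>

lemma De_Giorgi_step:
  fixes s p \<Lambda> :: real
  assumes s: "0 < s" "s < 1" and p: "1 < p" and \<Lambda>: "1 \<le> \<Lambda>"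
  shows "\<exists>C>0. \<forall>(u :: 'a::euclidean_space \<Rightarrow> real) k x0 r d \<eta> l l' m T.
    u \<in> borel_measurable borel \<longrightarrow> kernel_bounds s p \<Lambda> k \<longrightarrow> 0 < d \<longrightarrow> d \<le> r \<longrightarrow> \<eta> \<in> borel_measurable borel \<longrightarrow>
    (\<forall>x. 0 \<le> \<eta> x \<and> \<eta> x \<le> 1) \<longrightarrow> (\<forall>x y. \<bar>\<eta> x - \<eta> y\<bar> \<le> norm (x - y) / d) \<longrightarrow>
    (\<forall>x. r - d \<le> dist x0 x \<longrightarrow> \<eta> x = 0) \<longrightarrow>
    tested p k u (\<lambda>x. \<eta> x powr p * max (u x - l') 0) \<longrightarrow> l < l' \<longrightarrow> 0 \<le> m \<longrightarrow> 0 \<le> T \<longrightarrow>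
    (\<integral>\<^sup>+x\<in>ball x0 r. ennreal (max (u x - l) 0 powr p) \<partial>lborel) = ennreal m \<longrightarrow>
    (\<integral>\<^sup>+y\<in>- ball x0 r. ennreal (max (u y - l') 0 powr (p - 1) * frac_kernel s p y x0) \<partial>lborel) \<le> ennreal T \<longrightarrow>
    (\<integral>\<^sup>+x. ennreal (\<bar>\<eta> x * max (u x - l') 0\<bar> powr p) \<partial>lborel)
    \<le> ennreal (C * (m * (l' - l) powr (- p)) powr (s * p / DIM('a))
        * ((d powr (- (s * p)) + (r / d) powr (real DIM('a) + s * p) * T * (l' - l) powr (1 - p)) * m))"
proof -
  obtain C1 where C1: "0 < C1" and FK: "\<And>(f :: 'a \<Rightarrow> real) m.
    f \<in> borel_measurable borel \<Longrightarrow> 0 \<le> m \<Longrightarrow> emeasure lborel {x. f x \<noteq> 0} \<le> ennreal m \<Longrightarrow>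
    (\<integral>\<^sup>+x. ennreal (\<bar>f x\<bar> powr p) \<partial>lborel) \<le> ennreal (C1 * m powr (s * p / DIM('a))) *
      (\<integral>\<^sup>+x. \<integral>\<^sup>+y. ennreal (\<bar>f x - f y\<bar> powr p * frac_kernel s p x y) \<partial>lborel \<partial>lborel)"
    using Faber_Krahn[OF s(1) p, where 'a = 'a] unfolding frac_kernel_def by blast
  obtain C2 where C2: "0 < C2" and cacc: "\<And>(u :: 'a \<Rightarrow> real) k x0 r d \<eta> l.
    u \<in> borel_measurable borel \<Longrightarrow> kernel_bounds s p \<Lambda> k \<Longrightarrow> 0 < d \<Longrightarrow> d \<le> r \<Longrightarrow> \<eta> \<in> borel_measurable borel \<Longrightarrow>
    (\<forall>x. 0 \<le> \<eta> x \<and> \<eta> x \<le> 1) \<Longrightarrow> (\<forall>x y. \<bar>\<eta> x - \<eta> y\<bar> \<le> norm (x - y) / d) \<Longrightarrow>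
    (\<forall>x. r - d \<le> dist x0 x \<longrightarrow> \<eta> x = 0) \<Longrightarrow>
    tested p k u (\<lambda>x. \<eta> x powr p * max (u x - l) 0) \<Longrightarrow>
    (\<integral>\<^sup>+x. \<integral>\<^sup>+y. ennreal (\<bar>\<eta> x * max (u x - l) 0 - \<eta> y * max (u y - l) 0\<bar> powr p * frac_kernel s p x y) \<partial>lborel \<partial>lborel)
    \<le> ennreal C2 * (ennreal (d powr (- (s * p))) * (\<integral>\<^sup>+x\<in>ball x0 r. ennreal (max (u x - l) 0 powr p) \<partial>lborel)
      + ennreal ((r / d) powr (real DIM('a) + s * p))
        * (\<integral>\<^sup>+y\<in>- ball x0 r. ennreal (max (u y - l) 0 powr (p - 1) * frac_kernel s p y x0) \<partial>lborel)
        * (\<integral>\<^sup>+x\<in>ball x0 r. ennreal (max (u x - l) 0) \<partial>lborel))"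
    using Caccioppoli_energy[OF s p \<Lambda>, where 'a = 'a] by blast
  show ?thesis
  proof (intro exI[of _ "C1 * C2"] conjI allI impI mult_pos_pos C1 C2)
    fix u :: "'a \<Rightarrow> real" and k x0 and r d :: real and \<eta> and l l' m T :: real
    assume u [measurable]: "u \<in> borel_measurable borel" and kb: "kernel_bounds s p \<Lambda> k" and d: "0 < d" "d \<le> r"
      and \<eta>m [measurable]: "\<eta> \<in> borel_measurable borel"
      and \<eta>01: "\<forall>x. 0 \<le> \<eta> x \<and> \<eta> x \<le> 1" and \<eta>lip: "\<forall>x y. \<bar>\<eta> x - \<eta> y\<bar> \<le> norm (x - y) / d"
      and \<eta>0: "\<forall>x. r - d \<le> dist x0 x \<longrightarrow> \<eta> x = 0"
      and test: "tested p k u (\<lambda>x. \<eta> x powr p * max (u x - l') 0)"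
      and l: "l < l'" and m: "0 \<le> m" and T: "0 \<le> T"
      and A: "(\<integral>\<^sup>+x\<in>ball x0 r. ennreal (max (u x - l) 0 powr p) \<partial>lborel) = ennreal m"
      and Tl: "(\<integral>\<^sup>+y\<in>- ball x0 r. ennreal (max (u y - l') 0 powr (p - 1) * frac_kernel s p y x0) \<partial>lborel) \<le> ennreal T"
    define h where "h = l' - l"
    have h: "0 < h" using l by (simp add: h_def)
    define w where "w x = max (u x - l) 0" for x
    define w' where "w' x = max (u x - l') 0" for x
    have [measurable]: "w \<in> borel_measurable borel" "w' \<in> borel_measurable borel"
      unfolding w_def w'_def by measurable
    have w: "0 \<le> w' x" "w' x \<le> w x" for x using l by (auto simp: w_def w'_def)
    have big: "h \<le> w x" if "w' x \<noteq> 0" for x using that by (auto simp: w_def w'_def h_def max_def split: if_splits)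
    define B where "B = ball x0 r"
    have [measurable]: "B \<in> sets borel" by (simp add: B_def)
    have A': "(\<integral>\<^sup>+x\<in>B. ennreal (w x powr p) \<partial>lborel) = ennreal m" using A by (simp add: B_def w_def)
    have cmp: "(\<integral>\<^sup>+x. F x \<partial>lborel) \<le> ennreal (c * m)"
      if "\<And>x. F x \<le> ennreal c * (ennreal (w x powr p) * indicator B x)" "0 \<le> c" for F c
    proof -
      have "(\<integral>\<^sup>+x. F x \<partial>lborel) \<le> (\<integral>\<^sup>+x. ennreal c * (ennreal (w x powr p) * indicator B x) \<partial>lborel)"
        by (intro nn_integral_mono that)
      also have "\<dots> = ennreal c * ennreal m" by (simp add: nn_integral_cmult A')
      finally show ?thesis using that m by (simp add: ennreal_mult)
    qed
    have W: "(\<integral>\<^sup>+x\<in>B. ennreal (w' x powr p) \<partial>lborel) \<le> ennreal (1 * m)"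
      using w p by (intro cmp) (auto simp: indicator_def intro!: ennreal_leI powr_mono2)
    have W1: "(\<integral>\<^sup>+x\<in>B. ennreal (w' x) \<partial>lborel) \<le> ennreal (h powr (1 - p) * m)"
    proof (intro cmp)
      fix x
      have "w' x \<le> h powr (1 - p) * w x powr p"
      proof (cases "w' x = 0")
        case False
        then have hw: "h \<le> w x" by (rule big)
        have "w' x \<le> w x" by (rule w)
        also have "w x = w x powr (1 - p) * w x powr p" using hw h by (simp flip: powr_add)
        also have "\<dots> \<le> h powr (1 - p) * w x powr p"
          using hw h p by (intro mult_right_mono powr_mono2') auto
        finally show ?thesis .
      qed auto
      then show "ennreal (w' x) * indicator B x \<le> ennreal (h powr (1 - p)) * (ennreal (w x powr p) * indicator B x)"
        by (auto simp: indicator_def ennreal_leI simp flip: ennreal_mult)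
    qed auto
    have \<mu>: "emeasure lborel {x. \<eta> x * w' x \<noteq> 0} \<le> ennreal (h powr (- p) * m)"
    proof -
      have "emeasure lborel {x. \<eta> x * w' x \<noteq> 0} = (\<integral>\<^sup>+x. indicator {x. \<eta> x * w' x \<noteq> 0} x \<partial>lborel)"
        by (subst nn_integral_indicator) auto
      also have "\<dots> \<le> ennreal (h powr (- p) * m)"
      proof (intro cmp)
        fix x
        show "indicator {x. \<eta> x * w' x \<noteq> 0} x \<le> ennreal (h powr (- p)) * (ennreal (w x powr p) * indicator B x)"
        proof (cases "\<eta> x * w' x = 0")
          case False
          then have "\<not> r - d \<le> dist x0 x" using \<eta>0 by auto
          then have x: "x \<in> B" using d by (simp add: B_def)
          have hw: "h \<le> w x" using False big by auto
          have "1 = h powr (- p) * h powr p" using h by (simp flip: powr_add)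
          also have "\<dots> \<le> h powr (- p) * w x powr p" using hw h p by (intro mult_left_mono powr_mono2) auto
          finally show ?thesis using x False by (simp flip: ennreal_mult ennreal_1)
        qed auto
      qed auto
      finally show ?thesis .
    qed
    let ?G = "\<integral>\<^sup>+x. \<integral>\<^sup>+y. ennreal (\<bar>\<eta> x * w' x - \<eta> y * w' y\<bar> powr p * frac_kernel s p x y) \<partial>lborel \<partial>lborel"
    have "?G \<le> ennreal C2 * (ennreal (d powr (- (s * p))) * (\<integral>\<^sup>+x\<in>B. ennreal (w' x powr p) \<partial>lborel)
      + ennreal ((r / d) powr (real DIM('a) + s * p))
        * (\<integral>\<^sup>+y\<in>- B. ennreal (w' y powr (p - 1) * frac_kernel s p y x0) \<partial>lborel)
        * (\<integral>\<^sup>+x\<in>B. ennreal (w' x) \<partial>lborel))"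
      using cacc[OF u kb d \<eta>m \<eta>01 \<eta>lip \<eta>0 test] by (simp add: w'_def B_def)
    also have "\<dots> \<le> ennreal C2 * (ennreal (d powr (- (s * p))) * ennreal (1 * m)
      + ennreal ((r / d) powr (real DIM('a) + s * p)) * ennreal T * ennreal (h powr (1 - p) * m))"
      using Tl by (intro mult_left_mono add_mono mult_mono W W1) (auto simp: w'_def B_def)
    also have "\<dots> = ennreal (C2 * ((d powr (- (s * p)) + (r / d) powr (real DIM('a) + s * p) * T * h powr (1 - p)) * m))"
      using C2 m T by (simp add: algebra_simps flip: ennreal_mult ennreal_plus)
    finally have G: "?G \<le> ennreal (C2 * ((d powr (- (s * p)) + (r / d) powr (real DIM('a) + s * p) * T * h powr (1 - p)) * m))" .
    have "(\<integral>\<^sup>+x. ennreal (\<bar>\<eta> x * w' x\<bar> powr p) \<partial>lborel)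
      \<le> ennreal (C1 * (h powr (- p) * m) powr (s * p / DIM('a))) * ?G"
      using \<mu> m by (intro FK) auto
    also have "\<dots> \<le> ennreal (C1 * (h powr (- p) * m) powr (s * p / DIM('a))) *
        ennreal (C2 * ((d powr (- (s * p)) + (r / d) powr (real DIM('a) + s * p) * T * h powr (1 - p)) * m))"
      by (intro mult_left_mono G) auto
    also have "\<dots> = ennreal (C1 * C2 * (m * h powr (- p)) powr (s * p / DIM('a))
        * ((d powr (- (s * p)) + (r / d) powr (real DIM('a) + s * p) * T * h powr (1 - p)) * m))"
      using C1 C2 m T by (simp add: mult_ac flip: ennreal_mult)
    finally show "(\<integral>\<^sup>+x. ennreal (\<bar>\<eta> x * max (u x - l') 0\<bar> powr p) \<partial>lborel)
    \<le> ennreal (C1 * C2 * (m * (l' - l) powr (- p)) powr (s * p / DIM('a))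
        * ((d powr (- (s * p)) + (r / d) powr (real DIM('a) + s * p) * T * (l' - l) powr (1 - p)) * m))"
      by (simp add: w'_def h_def)
  qed
qed

lemma cutoff_Lipschitz:
  fixes x0 x y :: "'a::real_normed_vector"
  assumes "0 < d"
  shows "\<bar>max 0 (min 1 ((\<rho> - dist x0 x) / d)) - max 0 (min 1 ((\<rho> - dist x0 y) / d))\<bar> \<le> norm (x - y) / d"
proof -
  have "\<bar>max 0 (min 1 ((\<rho> - dist x0 x) / d)) - max 0 (min 1 ((\<rho> - dist x0 y) / d))\<bar>
    \<le> \<bar>(\<rho> - dist x0 x) / d - (\<rho> - dist x0 y) / d\<bar>" by (auto simp: max_def min_def)
  also have "\<dots> = \<bar>dist x0 y - dist x0 x\<bar> / d" using assms by (simp add: diff_divide_distrib[symmetric] abs_divide)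
  also have "\<dots> \<le> norm (x - y) / d"
    using assms dist_triangle[of x0 y x] dist_triangle[of x0 x y]
    by (intro divide_right_mono) (auto simp: dist_norm norm_minus_commute abs_le_iff)
  finally show ?thesis .
qed

text \<open>The equation enters only through the hypothesis on \<open>tested\<close>, so that the
  iteration does not see \<Omega>. The tail hypothesis with h/\<delta> in place of h is what trades
  smallness of the tail for smallness of the initial energy.\<close>

lemma De_Giorgi_bound:
  fixes s p \<Lambda> :: real
  assumes s: "0 < s" "s < 1" and p: "1 < p" and \<Lambda>: "1 \<le> \<Lambda>"
  shows "\<exists>c>0. \<forall>(u :: 'a::euclidean_space \<Rightarrow> real) k x0 R l0 h \<delta>.
    u \<in> borel_measurable borel \<longrightarrow> kernel_bounds s p \<Lambda> k \<longrightarrow> 0 < R \<longrightarrow> 0 < h \<longrightarrow> 0 < \<delta> \<longrightarrow> \<delta> \<le> 1 \<longrightarrow>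
    (\<forall>\<eta> l \<rho> d. l0 \<le> l \<longrightarrow> \<rho> < R \<longrightarrow> 0 < d \<longrightarrow> (\<forall>x. 0 \<le> \<eta> x \<and> \<eta> x \<le> 1) \<longrightarrow>
      (\<forall>x y. \<bar>\<eta> x - \<eta> y\<bar> \<le> norm (x - y) / d) \<longrightarrow> (\<forall>x. \<rho> \<le> dist x0 x \<longrightarrow> \<eta> x = 0) \<longrightarrow>
      tested p k u (\<lambda>x. \<eta> x powr p * max (u x - l) 0)) \<longrightarrow>
    (\<integral>\<^sup>+y\<in>- ball x0 (R / 2). ennreal (max (u y - l0) 0 powr (p - 1) * frac_kernel s p y x0) \<partial>lborel)
      \<le> ennreal ((R / 2) powr (- (s * p)) * (h / \<delta>) powr (p - 1)) \<longrightarrow>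
    (\<integral>\<^sup>+x\<in>ball x0 R. ennreal (max (u x - l0) 0 powr p) \<partial>lborel)
      \<le> ennreal (c * \<delta> powr ((p - 1) * DIM('a) / (s * p)) * R ^ DIM('a) * h powr p) \<longrightarrow>
    (AE x in lborel. x \<in> ball x0 (3 * R / 4) \<longrightarrow> u x \<le> l0 + h)"
proof -
  obtain C where C: "0 < C" and step: "\<And>(u :: 'a \<Rightarrow> real) k x0 r d \<eta> l l' m T.
    u \<in> borel_measurable borel \<Longrightarrow> kernel_bounds s p \<Lambda> k \<Longrightarrow> 0 < d \<Longrightarrow> d \<le> r \<Longrightarrow> \<eta> \<in> borel_measurable borel \<Longrightarrow>
    (\<forall>x. 0 \<le> \<eta> x \<and> \<eta> x \<le> 1) \<Longrightarrow> (\<forall>x y. \<bar>\<eta> x - \<eta> y\<bar> \<le> norm (x - y) / d) \<Longrightarrow>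
    (\<forall>x. r - d \<le> dist x0 x \<longrightarrow> \<eta> x = 0) \<Longrightarrow>
    tested p k u (\<lambda>x. \<eta> x powr p * max (u x - l') 0) \<Longrightarrow> l < l' \<Longrightarrow> 0 \<le> m \<Longrightarrow> 0 \<le> T \<Longrightarrow>
    (\<integral>\<^sup>+x\<in>ball x0 r. ennreal (max (u x - l) 0 powr p) \<partial>lborel) = ennreal m \<Longrightarrow>
    (\<integral>\<^sup>+y\<in>- ball x0 r. ennreal (max (u y - l') 0 powr (p - 1) * frac_kernel s p y x0) \<partial>lborel) \<le> ennreal T \<Longrightarrow>
    (\<integral>\<^sup>+x. ennreal (\<bar>\<eta> x * max (u x - l') 0\<bar> powr p) \<partial>lborel)
    \<le> ennreal (C * (m * (l' - l) powr (- p)) powr (s * p / DIM('a))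
        * ((d powr (- (s * p)) + (r / d) powr (real DIM('a) + s * p) * T * (l' - l) powr (1 - p)) * m))"
    using De_Giorgi_step[OF s p \<Lambda>, where 'a = 'a] by blast
  define n where "n = real DIM('a)"
  have n: "0 < n" by (simp add: n_def)
  define \<theta> where "\<theta> = s * p / n"
  have sp: "0 < s * p" using s p by simp
  have \<theta>: "0 < \<theta>" using n sp by (simp add: \<theta>_def)
  \<comment> \<open>Collects the powers of 2^j lost in one step: n + sp from (r_j/d_j)^(n+sp),
    another sp to absorb the factor 2^(sp) of the tail bound, at most p from the level gap to the
    power 1 - p, and p \<theta> from the measure of the support. The power sp from d_j^(-sp) is
    smaller than the sum of the first three.\<close>
  define \<gamma> where "\<gamma> = (n + s * p + s * p + p) + p * \<theta>"
  have \<gamma>: "0 < \<gamma>" unfolding \<gamma>_def using n sp p mult_pos_pos[OF _ \<theta>, of p] by linarith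
  define D0 where "D0 = 2 * C * 16 powr \<gamma>"
  define b where "b = (2::real) powr \<gamma>"
  have D0: "0 < D0" using C by (simp add: D0_def)
  have b: "1 < b" using \<gamma> by (simp add: b_def)
  \<comment> \<open>The threshold of \<open>fast_geometric_convergence\<close> for the recursion
    constant \<open>D0\<close>, that is, for \<delta> = 1.\<close>
  define c where "c = D0 powr (- (1 / \<theta>)) * b powr (- (1 / \<theta>\<^sup>2))"
  have c: "0 < c" using D0 b by (simp add: c_def)
  show ?thesis
  proof (intro exI[of _ c] conjI allI impI c)
    fix u :: "'a \<Rightarrow> real" and k x0 and R l0 h \<delta> :: real
    assume u [measurable]: "u \<in> borel_measurable borel" and kb: "kernel_bounds s p \<Lambda> k"
      and R: "0 < R" and h: "0 < h" and \<delta>: "0 < \<delta>" "\<delta> \<le> 1"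
      and test: "\<forall>\<eta> l \<rho> d. l0 \<le> l \<longrightarrow> \<rho> < R \<longrightarrow> 0 < d \<longrightarrow> (\<forall>x. 0 \<le> \<eta> x \<and> \<eta> x \<le> 1) \<longrightarrow>
        (\<forall>x y. \<bar>\<eta> x - \<eta> y\<bar> \<le> norm (x - y) / d) \<longrightarrow> (\<forall>x. \<rho> \<le> dist x0 x \<longrightarrow> \<eta> x = 0) \<longrightarrow>
        tested p k u (\<lambda>x. \<eta> x powr p * max (u x - l) 0)"
      and tail: "(\<integral>\<^sup>+y\<in>- ball x0 (R / 2). ennreal (max (u y - l0) 0 powr (p - 1) * frac_kernel s p y x0) \<partial>lborel)
        \<le> ennreal ((R / 2) powr (- (s * p)) * (h / \<delta>) powr (p - 1))"
      and start: "(\<integral>\<^sup>+x\<in>ball x0 R. ennreal (max (u x - l0) 0 powr p) \<partial>lborel)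
        \<le> ennreal (c * \<delta> powr ((p - 1) * DIM('a) / (s * p)) * R ^ DIM('a) * h powr p)"
    define T where "T = (R / 2) powr (- (s * p)) * (h / \<delta>) powr (p - 1)"
    define e where "e j = (1 / 2 :: real) ^ j" for j
    have e: "0 < e j" "e j \<le> 1" "e (Suc j) = e j / 2" for j
      by (auto simp: e_def power_le_one)
    \<comment> \<open>The radii decrease from R to 3R/4 and satisfy r_(j+1) = r_j - 2 d_j: half of
      the gap is for the decay of the cutoff, the other half keeps its support at distance d_j from
      the complement of the ball of radius r_j.\<close>
    define r where "r j = R * (3 / 4 + e j / 4)" for j
    define d where "d j = R * e j / 16" for j
    define l where "l j = l0 + h * (1 - e j)" for j
    have d: "0 < d j" "d j \<le> r j" for j
    proof -
      show "0 < d j" using R e[of j] by (simp add: d_def)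
      have "e j / 16 \<le> 3 / 4 + e j / 4" using e[of j] by simp
      from mult_left_mono[OF this, of R] show "d j \<le> r j" using R by (simp add: d_def r_def)
    qed
    have r: "R / 2 \<le> r j" "3 * R / 4 \<le> r j" "r j \<le> R" for j
    proof -
      have "R * (3 / 4) \<le> R * (3 / 4 + e j / 4)" using R e[of j] by (intro mult_left_mono) auto
      then show "3 * R / 4 \<le> r j" by (simp add: r_def)
      then show "R / 2 \<le> r j" using R by simp
      have "R * (3 / 4 + e j / 4) \<le> R * 1" using R e[of j] by (intro mult_left_mono) auto
      then show "r j \<le> R" by (simp add: r_def)
    qed
    have l: "l0 \<le> l j" "l j < l (Suc j)" "l (Suc j) - l j = h * e (Suc j)" "l j \<le> l0 + h" for j
      using h e[of j] e(2)[of "Suc j"] by (auto simp: l_def e(3) algebra_simps)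
    define w where "w j x = max (u x - l j) 0" for j x
    have [measurable]: "w j \<in> borel_measurable borel" for j unfolding w_def by measurable
    define A where "A j = (\<integral>\<^sup>+x\<in>ball x0 (r j). ennreal (w j x powr p) \<partial>lborel)" for j
    have A0: "A 0 \<le> ennreal (c * \<delta> powr ((p - 1) * n / (s * p)) * R ^ DIM('a) * h powr p)"
      using start by (simp add: A_def w_def l_def r_def e_def n_def)
    have Afin: "A j \<le> A 0" for j
      unfolding A_def
    proof (intro nn_integral_mono)
      fix x
      have "ball x0 (r j) \<subseteq> ball x0 (r 0)" using r(3)[of j] by (auto simp: r_def e_def)
      moreover have "w j x powr p \<le> w 0 x powr p"
        using l(1)[of j] p by (intro powr_mono2) (auto simp: w_def l_def e_def)
      ultimately show "ennreal (w j x powr p) * indicator (ball x0 (r j)) x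
        \<le> ennreal (w 0 x powr p) * indicator (ball x0 (r 0)) x"
        by (auto simp: indicator_def ennreal_leI)
    qed
    \<comment> \<open>After this normalisation the recursion contains neither R nor h.\<close>
    define a where "a j = enn2real (A j) / (R ^ DIM('a) * h powr p)" for j
    have a0: "0 \<le> a j" for j using R by (simp add: a_def)
    have Aa: "A j = ennreal (R ^ DIM('a) * h powr p * a j)" for j
    proof -
      have "A j < \<infinity>" using Afin[of j] A0 le_less_trans[OF order_trans] by (metis ennreal_less_top infinity_ennreal_def)
      then show ?thesis using R h by (simp add: a_def)
    qed
    have astep: "a (Suc j) \<le> D0 * \<delta> powr (1 - p) * b ^ j * (a j powr \<theta> * a j)" for j
    proof -
      define \<eta> where "\<eta> x = max 0 (min 1 ((r j - d j - dist x0 x) / d j))" for x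
      have \<eta>01: "\<forall>x. 0 \<le> \<eta> x \<and> \<eta> x \<le> 1" by (auto simp: \<eta>_def)
      have \<eta>lip: "\<forall>x y. \<bar>\<eta> x - \<eta> y\<bar> \<le> norm (x - y) / d j"
        unfolding \<eta>_def using cutoff_Lipschitz[OF d(1)] by blast
      have \<eta>0: "\<forall>x. r j - d j \<le> dist x0 x \<longrightarrow> \<eta> x = 0"
      proof (intro allI impI)
        fix x assume "r j - d j \<le> dist x0 x"
        then have "(r j - d j - dist x0 x) / d j \<le> 0" using d(1)[of j] by (intro divide_nonpos_pos) auto
        then show "\<eta> x = 0" by (simp add: \<eta>_def)
      qed
      have \<eta>1: "\<eta> x = 1" if "x \<in> ball x0 (r (Suc j))" for x
      proof -
        have "r (Suc j) = r j - 2 * d j" by (simp add: r_def d_def e(3) field_simps)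
        then have "1 \<le> (r j - d j - dist x0 x) / d j" using that d[of j] by (simp add: le_divide_eq)
        then show ?thesis by (simp add: \<eta>_def)
      qed
      have \<eta>m: "\<eta> \<in> borel_measurable borel" unfolding \<eta>_def by measurable
      have test': "tested p k u (\<lambda>x. \<eta> x powr p * max (u x - l (Suc j)) 0)"
      proof -
        have "r j - d j < R" using r(3)[of j] d(1)[of j] by linarith
        then show ?thesis using test[rule_format, of "l (Suc j)" "r j - d j" "d j" \<eta>] l(1)[of "Suc j"] d(1)[of j] \<eta>01 \<eta>lip \<eta>0
          by blast
      qed
      have tail': "(\<integral>\<^sup>+y\<in>- ball x0 (r j). ennreal (max (u y - l (Suc j)) 0 powr (p - 1) * frac_kernel s p y x0) \<partial>lborel) \<le> ennreal T"
      proof -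
        have "(\<integral>\<^sup>+y\<in>- ball x0 (r j). ennreal (max (u y - l (Suc j)) 0 powr (p - 1) * frac_kernel s p y x0) \<partial>lborel)
          \<le> (\<integral>\<^sup>+y\<in>- ball x0 (R / 2). ennreal (max (u y - l0) 0 powr (p - 1) * frac_kernel s p y x0) \<partial>lborel)"
        proof (intro nn_integral_mono)
          fix y
          have "- ball x0 (r j) \<subseteq> - ball x0 (R / 2)" using r(1)[of j] by auto
          moreover have "max (u y - l (Suc j)) 0 powr (p - 1) \<le> max (u y - l0) 0 powr (p - 1)"
            using l(1)[of "Suc j"] p by (intro powr_mono2) auto
          ultimately show "ennreal (max (u y - l (Suc j)) 0 powr (p - 1) * frac_kernel s p y x0) * indicator (- ball x0 (r j)) y
            \<le> ennreal (max (u y - l0) 0 powr (p - 1) * frac_kernel s p y x0) * indicator (- ball x0 (R / 2)) y"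
            by (auto simp: indicator_def intro!: ennreal_leI mult_right_mono)
        qed
        then show ?thesis using tail by (simp add: T_def)
      qed
      define m where "m = R ^ DIM('a) * h powr p * a j"
      have m0: "0 \<le> m" using R a0[of j] by (simp add: m_def)
      define g where "g = h * e (Suc j)"
      have g: "0 < g" using h e by (simp add: g_def)
      have T0: "0 \<le> T" by (simp add: T_def)
      have "A (Suc j) \<le> (\<integral>\<^sup>+x. ennreal (\<bar>\<eta> x * max (u x - l (Suc j)) 0\<bar> powr p) \<partial>lborel)"
        unfolding A_def w_def by (intro nn_integral_mono) (auto simp: indicator_def \<eta>1)
      also have "\<dots> \<le> ennreal (C * (m * (l (Suc j) - l j) powr (- p)) powr (s * p / DIM('a))
        * ((d j powr (- (s * p)) + (r j / d j) powr (real DIM('a) + s * p) * T * (l (Suc j) - l j) powr (1 - p)) * m))"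
        using Aa[of j] by (intro step[OF u kb d \<eta>m \<eta>01 \<eta>lip \<eta>0 test' l(2) m0 T0 _ tail']) (simp add: A_def w_def m_def)
      finally have Am: "A (Suc j) \<le> ennreal (C * (m * g powr (- p)) powr \<theta>
        * ((d j powr (- (s * p)) + (r j / d j) powr (n + s * p) * T * g powr (1 - p)) * m))"
        by (simp add: \<theta>_def n_def g_def l(3))
      \<comment> \<open>Both R/d_j and the reciprocal of the relative level gap, 2^(j+1), are at
        most t, so all losses are measured in powers of t; the factor 16 goes into
        \<open>D0\<close>.\<close>
      define t where "t = 16 * (2::real) ^ j"
      have t: "1 \<le> t" "2 ^ Suc j \<le> t" by (auto simp: t_def) (metis one_le_power one_le_numeral mult_mono' mult_1 zero_le_one)
      have te: "e (Suc j) = 1 / 2 ^ Suc j" "d j = R / t"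
        by (auto simp: e_def t_def d_def power_one_over)
      have gt: "g powr (- p) \<le> h powr (- p) * t powr p" "g powr (1 - p) \<le> h powr (1 - p) * t powr (p - 1)"
      proof -
        have ge: "h / t \<le> g" using h t by (auto simp: g_def te frac_le simp del: power_Suc)
        have pd: "(h / t) powr x = h powr x * t powr (- x)" for x
          using h t by (intro powr_divide_eq_mult) auto
        have "g powr (- p) \<le> (h / t) powr (- p)" using ge h t p by (intro powr_mono2') auto
        then show "g powr (- p) \<le> h powr (- p) * t powr p" by (simp only: pd minus_minus)
        have "g powr (1 - p) \<le> (h / t) powr (1 - p)" using ge h t p by (intro powr_mono2') auto
        also have "\<dots> = h powr (1 - p) * t powr (p - 1)" by (simp only: pd minus_diff_eq)
        finally show "g powr (1 - p) \<le> h powr (1 - p) * t powr (p - 1)" .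
      qed
      have f1: "(m * g powr (- p)) powr \<theta> \<le> R powr (s * p) * a j powr \<theta> * t powr (p * \<theta>)"
      proof -
        have "m * g powr (- p) \<le> m * (h powr (- p) * t powr p)" by (intro mult_left_mono gt m0)
        also have "\<dots> = R ^ DIM('a) * a j * t powr p"
          using h by (simp add: m_def powr_minus field_simps)
        finally have "(m * g powr (- p)) powr \<theta> \<le> (R ^ DIM('a) * a j * t powr p) powr \<theta>"
          using m0 \<theta> by (intro powr_mono2) auto
        also have "\<dots> = (R powr n) powr \<theta> * a j powr \<theta> * (t powr p) powr \<theta>"
          using R a0[of j] t by (simp add: powr_mult n_def powr_realpow)
        also have "(R powr n) powr \<theta> = R powr (s * p)" using n by (simp add: powr_powr \<theta>_def)
        finally show ?thesis by (simp add: powr_powr)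
      qed
      have f2: "d j powr (- (s * p)) \<le> R powr (- (s * p)) * \<delta> powr (1 - p) * t powr (n + s * p + s * p + p)"
      proof -
        have "d j powr (- (s * p)) = R powr (- (s * p)) * t powr (s * p)"
          using R t powr_divide_eq_mult[of R t "- (s * p)"] by (simp add: te)
        also have "\<dots> \<le> R powr (- (s * p)) * (\<delta> powr (1 - p) * t powr (n + s * p + s * p + p))"
        proof (intro mult_left_mono)
          have "s * p \<le> n + s * p + s * p + p" using n sp p by linarith
          then have "t powr (s * p) \<le> t powr (n + s * p + s * p + p)" using t by (intro powr_mono) auto
          moreover have "1 \<le> \<delta> powr (1 - p)" using powr_mono2'[of "1 - p" \<delta> 1] \<delta> p by simp
          ultimately show "t powr (s * p) \<le> \<delta> powr (1 - p) * t powr (n + s * p + s * p + p)"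
            using mult_mono[of 1 "\<delta> powr (1 - p)" "t powr (s * p)" "t powr (n + s * p + s * p + p)"] by simp
        qed simp
        finally show ?thesis by (simp add: mult.assoc)
      qed
      have f3: "(r j / d j) powr (n + s * p) * T * g powr (1 - p)
          \<le> R powr (- (s * p)) * \<delta> powr (1 - p) * t powr (n + s * p + s * p + p)"
      proof -
        have "r j / d j \<le> t" using r(3)[of j] R t by (simp add: te field_simps)
        then have 1: "(r j / d j) powr (n + s * p) \<le> t powr (n + s * p)"
          using d[of j] n sp by (intro powr_mono2) auto
        have 2: "T = R powr (- (s * p)) * 2 powr (s * p) * (h powr (p - 1) * \<delta> powr (1 - p))"
          using R h \<delta> powr_divide_eq_mult[of R 2 "- (s * p)"] powr_divide_eq_mult[of h \<delta> "p - 1"]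
          by (simp add: T_def)
        have "(1::real) \<le> 2 ^ j" by simp
        then have "2 \<le> t" unfolding t_def by linarith
        then have 3: "2 powr (s * p) \<le> t powr (s * p)" using sp by (intro powr_mono2) auto
        have "(r j / d j) powr (n + s * p) * T * g powr (1 - p)
          \<le> t powr (n + s * p) * (R powr (- (s * p)) * t powr (s * p) * (h powr (p - 1) * \<delta> powr (1 - p)))
            * (h powr (1 - p) * t powr (p - 1))"
          unfolding 2 using 1 3 gt by (intro mult_mono mult_left_mono mult_right_mono mult_nonneg_nonneg) auto
        also have "\<dots> = R powr (- (s * p)) * \<delta> powr (1 - p) * (h powr (p - 1) * h powr (1 - p))
            * (t powr (n + s * p) * t powr (s * p) * t powr (p - 1))" by (simp add: mult_ac)
        also have "h powr (p - 1) * h powr (1 - p) = 1" using h by (simp flip: powr_add)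
        also have "t powr (n + s * p) * t powr (s * p) * t powr (p - 1) = t powr (n + s * p + s * p + (p - 1))"
          by (simp only: powr_add mult.assoc)
        also have "R powr (- (s * p)) * \<delta> powr (1 - p) * 1 * t powr (n + s * p + s * p + (p - 1))
          \<le> R powr (- (s * p)) * \<delta> powr (1 - p) * 1 * t powr (n + s * p + s * p + p)"
          using t by (intro mult_left_mono powr_mono) auto
        finally show ?thesis by simp
      qed
      have "C * (m * g powr (- p)) powr \<theta>
        * ((d j powr (- (s * p)) + (r j / d j) powr (n + s * p) * T * g powr (1 - p)) * m)
        \<le> C * (R powr (s * p) * a j powr \<theta> * t powr (p * \<theta>))
          * ((R powr (- (s * p)) * \<delta> powr (1 - p) * t powr (n + s * p + s * p + p)
             + R powr (- (s * p)) * \<delta> powr (1 - p) * t powr (n + s * p + s * p + p)) * m)"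
      proof (rule mult_mono)
        show "C * (m * g powr (- p)) powr \<theta> \<le> C * (R powr (s * p) * a j powr \<theta> * t powr (p * \<theta>))"
          using f1 C by (intro mult_left_mono) auto
        show "(d j powr (- (s * p)) + (r j / d j) powr (n + s * p) * T * g powr (1 - p)) * m
          \<le> (R powr (- (s * p)) * \<delta> powr (1 - p) * t powr (n + s * p + s * p + p)
             + R powr (- (s * p)) * \<delta> powr (1 - p) * t powr (n + s * p + s * p + p)) * m"
          by (intro mult_right_mono add_mono f2 f3 m0)
      qed (use C m0 T0 in \<open>auto intro!: mult_nonneg_nonneg add_nonneg_nonneg\<close>)
      also have "\<dots> = 2 * C * (R powr (s * p) * R powr (- (s * p))) * (t powr (n + s * p + s * p + p) * t powr (p * \<theta>))
          * \<delta> powr (1 - p) * (a j powr \<theta> * m)" by (simp add: algebra_simps)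
      also have "R powr (s * p) * R powr (- (s * p)) = 1" using R by (simp flip: powr_add)
      also have "t powr (n + s * p + s * p + p) * t powr (p * \<theta>) = 16 powr \<gamma> * b ^ j"
      proof -
        have "t powr (n + s * p + s * p + p) * t powr (p * \<theta>) = t powr \<gamma>" by (simp add: \<gamma>_def powr_add)
        also have "\<dots> = 16 powr \<gamma> * ((2::real) ^ j) powr \<gamma>" by (simp add: t_def powr_mult)
        also have "((2::real) ^ j) powr \<gamma> = b ^ j"
          by (simp add: b_def powr_powr mult.commute flip: powr_realpow)
        finally show ?thesis .
      qed
      finally have "A (Suc j) \<le> ennreal (D0 * b ^ j * \<delta> powr (1 - p) * (a j powr \<theta> * m))"
        using order_trans[OF Am ennreal_leI] by (simp add: D0_def mult_ac)
      then have "R ^ DIM('a) * h powr p * a (Suc j) \<le> D0 * b ^ j * \<delta> powr (1 - p) * (a j powr \<theta> * m)"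
        unfolding Aa using D0 b m0 by (subst (asm) ennreal_le_iff) auto
      also have "\<dots> = R ^ DIM('a) * h powr p * (D0 * \<delta> powr (1 - p) * b ^ j * (a j powr \<theta> * a j))"
        by (simp add: m_def mult_ac)
      finally show ?thesis using R h by simp
    qed
    have "a \<longlonglongrightarrow> 0"
    proof (rule fast_geometric_convergence[OF \<theta> b _ a0 astep])
      show "0 < D0 * \<delta> powr (1 - p)" using D0 \<delta> by simp
      \<comment> \<open>The factor \<delta>^(1-p) of the recursion enters the threshold with the
        power -1/\<theta> = -n/(sp), which is the power of \<delta> in the hypothesis on the initial
        energy.\<close>
      have "(D0 * \<delta> powr (1 - p)) powr (- (1 / \<theta>)) = D0 powr (- (1 / \<theta>)) * \<delta> powr ((p - 1) * n / (s * p))"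
      proof -
        have "(1 - p) * (- (1 / \<theta>)) = (p - 1) * (1 / \<theta>)" by (simp add: diff_divide_distrib)
        then have "(1 - p) * (- (1 / \<theta>)) = (p - 1) * n / (s * p)" by (simp add: \<theta>_def)
        then have "(\<delta> powr (1 - p)) powr (- (1 / \<theta>)) = \<delta> powr ((p - 1) * n / (s * p))"
          by (simp only: powr_powr)
        then show ?thesis using D0 by (simp add: powr_mult)
      qed
      moreover have "R ^ DIM('a) * h powr p * a 0 \<le> c * \<delta> powr ((p - 1) * n / (s * p)) * R ^ DIM('a) * h powr p"
        using A0 c R unfolding Aa by (subst (asm) ennreal_le_iff) auto
      then have "a 0 \<le> c * \<delta> powr ((p - 1) * n / (s * p))"
        using R h by (simp add: mult_ac)
      ultimately show "a 0 \<le> (D0 * \<delta> powr (1 - p)) powr (- (1 / \<theta>)) * b powr (- (1 / \<theta>\<^sup>2))"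
        by (simp add: c_def mult_ac)
    qed
    then have "(\<lambda>j. ennreal (R ^ DIM('a) * h powr p * a j)) \<longlonglongrightarrow> ennreal (R ^ DIM('a) * h powr p * 0)"
      by (intro tendsto_ennrealI tendsto_mult tendsto_const)
    moreover have "(\<lambda>j. ennreal (R ^ DIM('a) * h powr p * a j)) = A"
      by (rule ext) (rule Aa[symmetric])
    ultimately have lim: "A \<longlonglongrightarrow> 0" by (simp only: mult_zero_right ennreal_0)
    define Z where "Z = (\<integral>\<^sup>+x\<in>ball x0 (3 * R / 4). ennreal (max (u x - (l0 + h)) 0 powr p) \<partial>lborel)"
    have "Z \<le> A j" for j
      unfolding Z_def A_def
    proof (intro nn_integral_mono)
      fix x
      have "ball x0 (3 * R / 4) \<subseteq> ball x0 (r j)" using r(2)[of j] by auto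
      moreover have "max (u x - (l0 + h)) 0 powr p \<le> w j x powr p"
        using l(4)[of j] p by (intro powr_mono2) (auto simp: w_def)
      ultimately show "ennreal (max (u x - (l0 + h)) 0 powr p) * indicator (ball x0 (3 * R / 4)) x
        \<le> ennreal (w j x powr p) * indicator (ball x0 (r j)) x"
        by (auto simp: indicator_def ennreal_leI)
    qed
    then have "Z \<le> 0" by (intro LIMSEQ_le_const[OF lim]) auto
    then have "Z = 0" by simp
    moreover have [measurable]: "ball x0 (3 * R / 4) \<in> sets borel" by simp
    have "(\<lambda>x. ennreal (max (u x - (l0 + h)) 0 powr p) * indicator (ball x0 (3 * R / 4)) x) \<in> borel_measurable lborel"
      by measurable
    ultimately have "AE x in lborel. ennreal (max (u x - (l0 + h)) 0 powr p) * indicator (ball x0 (3 * R / 4)) x = 0"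
      unfolding Z_def by (simp only: nn_integral_0_iff_AE)
    then show "AE x in lborel. x \<in> ball x0 (3 * R / 4) \<longrightarrow> u x \<le> l0 + h"
      by eventually_elim (auto simp: max_def split: if_splits)
  qed
qed

subsection \<open>Admissible test functions\<close>

lemma AE_lborel_fst:
  assumes "AE x in lborel. P x"
  shows "AE z in (lborel :: ('a::euclidean_space \<times> 'b::euclidean_space) measure). P (fst z)"
proof -
  obtain N where N: "N \<in> null_sets lborel" "{x. \<not> P x} \<subseteq> N"
    using assms by (auto elim: AE_E simp: null_sets_def)
  have "N \<times> (UNIV :: 'b set) \<in> null_sets (lborel \<Otimes>\<^sub>M lborel)"
    using N(1) by (auto simp: null_sets_def lborel.emeasure_pair_measure_Times)
  then have "N \<times> UNIV \<in> null_sets (lborel :: ('a \<times> 'b) measure)" by (simp add: lborel_prod)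
  then show ?thesis by (rule AE_I') (use N(2) in auto)
qed

lemma AE_lborel_snd:
  assumes "AE x in lborel. P x"
  shows "AE z in (lborel :: ('a::euclidean_space \<times> 'b::euclidean_space) measure). P (snd z)"
proof -
  obtain N where N: "N \<in> null_sets lborel" "{x. \<not> P x} \<subseteq> N"
    using assms by (auto elim: AE_E simp: null_sets_def)
  have "(UNIV :: 'a set) \<times> N \<in> null_sets (lborel \<Otimes>\<^sub>M lborel)"
    using N(1) by (auto simp: null_sets_def lborel.emeasure_pair_measure_Times)
  then have "UNIV \<times> N \<in> null_sets (lborel :: ('a \<times> 'b) measure)" by (simp add: lborel_prod)
  then show ?thesis by (rule AE_I') (use N(2) in auto)
qed

section \<open>Energies as Borel integrals, and limits of test functions\<close>

lemma Lp_energy_lborel: "Lp_energy p A u = (\<integral>\<^sup>+x\<in>A. ennreal (\<bar>u x\<bar> powr p) \<partial>lborel)"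
  by (simp add: Lp_energy_def nn_integral_completion)

lemma gagliardo_lborel:
  "gagliardo s p A u = (\<integral>\<^sup>+z\<in>A. ennreal (\<bar>u (fst z) - u (snd z)\<bar> powr p * frac_kernel s p (fst z) (snd z)) \<partial>lborel)"
proof -
  have "a / norm (x - y) powr (real DIM('a) + s * p) = a * frac_kernel s p x y" for a and x y :: 'a
    using powr_minus_divide[of "norm (x - y)" "real DIM('a) + s * p"] by (simp add: frac_kernel_def)
  then show ?thesis by (simp add: gagliardo_def nn_integral_completion)
qed

lemma Lp_energy_cong_AE: "AE x in lborel. u x = v x \<Longrightarrow> Lp_energy p A u = Lp_energy p A v"
  unfolding Lp_energy_lborel by (intro nn_integral_cong_AE) auto

lemma gagliardo_cong_AE:
  assumes "AE x in lborel. u x = v x"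
  shows "gagliardo s p A u = gagliardo s p A v"
  unfolding gagliardo_lborel
proof (rule nn_integral_cong_AE)
  show "AE z in lborel. ennreal (\<bar>u (fst z) - u (snd z)\<bar> powr p * frac_kernel s p (fst z) (snd z)) * indicator A z
    = ennreal (\<bar>v (fst z) - v (snd z)\<bar> powr p * frac_kernel s p (fst z) (snd z)) * indicator A z"
    using AE_lborel_fst[OF assms] AE_lborel_snd[OF assms] by eventually_elim simp
qed

lemma swap_measurable:
  fixes f :: "'a::euclidean_space \<times> 'a \<Rightarrow> ennreal"
  assumes "f \<in> borel_measurable borel"
  shows "(\<lambda>z. f (snd z, fst z)) \<in> borel_measurable borel"
proof (rule measurable_compose[OF _ assms])
  show "(\<lambda>z. (snd z, fst z)) \<in> borel_measurable (borel :: ('a \<times> 'a) measure)"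
    by (intro borel_measurable_continuous_onI continuous_intros)
qed

text \<open>Dominated convergence for the positive and the negative part of the energy separately.
  The domination rests on |a|^(p-1) |b| <= |a|^p + |b|^p, which separates the fixed energy of u from
  the bound on the v_j; it also supplies the finiteness in \<open>tested\<close>.\<close>

lemma tested_limit:
  fixes u :: "'a::euclidean_space \<Rightarrow> real"
  assumes p: "1 < p" and \<Lambda>: "1 \<le> \<Lambda>" and \<Omega>: "open \<Omega>"
    and [measurable]: "u \<in> borel_measurable borel" and u: "gagliardo s p (\<Omega> \<times> UNIV) u < \<infinity>"
    and kb: "kernel_bounds s p \<Lambda> k"
    and [measurable]: "\<And>j::nat. v j \<in> borel_measurable borel" "v' \<in> borel_measurable borel"
    and out: "\<And>j x. x \<notin> \<Omega> \<Longrightarrow> v j x = 0"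
    and lim: "AE x in lborel. (\<lambda>j. v j x) \<longlonglongrightarrow> v' x"
    and bm [measurable]: "b \<in> borel_measurable borel" and b: "(\<integral>\<^sup>+z\<in>\<Omega> \<times> UNIV. b z \<partial>lborel) < \<infinity>"
    and dom: "\<And>j x y. x \<in> \<Omega> \<Longrightarrow> ennreal (\<bar>v j x - v j y\<bar> powr p * frac_kernel s p x y) \<le> b (x, y)"
    and test: "\<And>j. (\<integral>\<^sup>+z. ennreal (energy_diff p u (v j) (fst z) (snd z)) * k z \<partial>lborel)
       \<le> (\<integral>\<^sup>+z. ennreal (- energy_diff p u (v j) (fst z) (snd z)) * k z \<partial>lborel)"
  shows "tested p k u v'"
proof -
  let ?K = "frac_kernel s p :: 'a \<Rightarrow> 'a \<Rightarrow> real"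
  have [measurable]: "k \<in> borel_measurable borel" using kb by (simp add: kernel_bounds_def)
  have [measurable]: "\<Omega> \<times> (UNIV :: 'a set) \<in> sets borel"
    using \<Omega> by (intro borel_open open_Times) auto
  \<comment> \<open>The V seminorm controls only pairs whose first point is in \<Omega>. Adding the
    transpose covers every pair at which the difference of \<open>v j\<close> can be
    nonzero.\<close>
  define H0 where "H0 z = (ennreal (\<bar>u (fst z) - u (snd z)\<bar> powr p * ?K (fst z) (snd z)) + b z) * indicator (\<Omega> \<times> UNIV) z" for z
  define H where "H z = ennreal \<Lambda> * (H0 z + H0 (snd z, fst z))" for z
  have [measurable]: "H0 \<in> borel_measurable borel" unfolding H0_def by measurable
  have [measurable]: "(\<lambda>z. H0 (snd z, fst z)) \<in> borel_measurable borel" by (rule swap_measurable) measurable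
  have [measurable]: "H \<in> borel_measurable borel" unfolding H_def by measurable
  have "(\<integral>\<^sup>+z. H0 z \<partial>lborel) = gagliardo s p (\<Omega> \<times> UNIV) u + (\<integral>\<^sup>+z\<in>\<Omega> \<times> UNIV. b z \<partial>lborel)"
    unfolding H0_def gagliardo_lborel distrib_right by (subst nn_integral_add) auto
  then have H0: "(\<integral>\<^sup>+z. H0 z \<partial>lborel) < \<infinity>" using u b by (simp add: ennreal_add_less_top)
  have "(\<integral>\<^sup>+z. H z \<partial>lborel) = ennreal \<Lambda> * ((\<integral>\<^sup>+z. H0 z \<partial>lborel) + (\<integral>\<^sup>+z. H0 z \<partial>lborel))"
    unfolding H_def by (simp add: nn_integral_cmult nn_integral_add nn_integral_lborel_swap)
  then have Hfin: "(\<integral>\<^sup>+z. H z \<partial>lborel) < \<infinity>" using H0 by (simp add: ennreal_mult_less_top)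
  have kAE: "AE z in lborel. fst z \<noteq> snd z \<longrightarrow> k z \<le> ennreal (\<Lambda> * ?K (fst z) (snd z))"
    using kb unfolding kernel_bounds_def by auto
  have bound: "AE z in lborel. ennreal \<bar>energy_diff p u (v j) (fst z) (snd z)\<bar> * k z \<le> H z" for j
    using kAE
  proof eventually_elim
    fix z :: "'a \<times> 'a"
    assume kz: "fst z \<noteq> snd z \<longrightarrow> k z \<le> ennreal (\<Lambda> * ?K (fst z) (snd z))"
    obtain x y where z: "z = (x, y)" by force
    show "ennreal \<bar>energy_diff p u (v j) (fst z) (snd z)\<bar> * k z \<le> H z"
    proof (cases "x = y \<or> (x \<notin> \<Omega> \<and> y \<notin> \<Omega>)")
      case True
      then show ?thesis using out by (auto simp: z energy_diff_def)
    next
      case False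
      have powr: "\<bar>t\<bar> powr (p - 2) * \<bar>t\<bar> = \<bar>t\<bar> powr (p - 1)" for t :: real
        using powr_mult_base[of "\<bar>t\<bar>" "p - 2"] by (cases "t = 0") (auto simp: mult.commute)
      have "\<bar>energy_diff p u (v j) x y\<bar> = \<bar>u x - u y\<bar> powr (p - 1) * \<bar>v j x - v j y\<bar>"
        by (simp add: energy_diff_def abs_mult powr)
      also have "\<dots> \<le> \<bar>u x - u y\<bar> powr p + \<bar>v j x - v j y\<bar> powr p"
        using p by (intro powr_minus_one_mult_le) auto
      finally have ed: "\<bar>energy_diff p u (v j) x y\<bar> \<le> \<bar>u x - u y\<bar> powr p + \<bar>v j x - v j y\<bar> powr p" .
      have "ennreal \<bar>energy_diff p u (v j) x y\<bar> * k z \<le> ennreal \<bar>energy_diff p u (v j) x y\<bar> * ennreal (\<Lambda> * ?K x y)"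
        using kz False by (intro mult_left_mono) (auto simp: z)
      also have "\<dots> \<le> ennreal (\<bar>u x - u y\<bar> powr p + \<bar>v j x - v j y\<bar> powr p) * ennreal (\<Lambda> * ?K x y)"
        by (intro mult_right_mono ennreal_leI ed) auto
      also have "\<dots> = ennreal \<Lambda> * (ennreal (\<bar>u x - u y\<bar> powr p * ?K x y) + ennreal (\<bar>v j x - v j y\<bar> powr p * ?K x y))"
        using \<Lambda> by (simp add: algebra_simps flip: ennreal_mult ennreal_plus)
      also have "\<dots> \<le> ennreal \<Lambda> * (H0 z + H0 (snd z, fst z))"
      proof (intro mult_left_mono)
        show "ennreal (\<bar>u x - u y\<bar> powr p * ?K x y) + ennreal (\<bar>v j x - v j y\<bar> powr p * ?K x y) \<le> H0 z + H0 (snd z, fst z)"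
        proof (cases "x \<in> \<Omega>")
          case True
          then show ?thesis using dom[of x j y]
            by (intro add_increasing2) (auto simp: H0_def z intro!: add_left_mono)
        next
          case xF: False
          then have "y \<in> \<Omega>" using False by simp
          then show ?thesis using dom[of y j x]
            by (intro add_increasing) (auto simp: H0_def z abs_minus_commute frac_kernel_commute intro!: add_left_mono)
        qed
      qed auto
      finally show ?thesis by (simp add: H_def z)
    qed
  qed
  \<comment> \<open>The cases c = 1 and c = -1 are the positive and the negative part.\<close>
  have conv: "(\<lambda>j. \<integral>\<^sup>+z. ennreal (c * energy_diff p u (v j) (fst z) (snd z)) * k z \<partial>lborel)
      \<longlonglongrightarrow> (\<integral>\<^sup>+z. ennreal (c * energy_diff p u v' (fst z) (snd z)) * k z \<partial>lborel)"
    and fin: "(\<integral>\<^sup>+z. ennreal (c * energy_diff p u v' (fst z) (snd z)) * k z \<partial>lborel) < \<infinity>"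
    if c: "\<bar>c\<bar> = 1" for c
  proof -
    have le: "AE z in lborel. ennreal (c * energy_diff p u (v j) (fst z) (snd z)) * k z \<le> H z" for j
      using bound[of j]
    proof eventually_elim
      case (elim z)
      have "c * e \<le> \<bar>e\<bar>" for e
        using c abs_ge_self[of "c * e"] by (simp add: abs_mult)
      then have "ennreal (c * energy_diff p u (v j) (fst z) (snd z)) * k z \<le> ennreal \<bar>energy_diff p u (v j) (fst z) (snd z)\<bar> * k z"
        by (intro mult_right_mono ennreal_leI) auto
      then show ?case using elim by (rule order_trans)
    qed
    have ptw: "AE z in lborel. (\<lambda>j. ennreal (c * energy_diff p u (v j) (fst z) (snd z)) * k z)
      \<longlonglongrightarrow> ennreal (c * energy_diff p u v' (fst z) (snd z)) * k z"
      using kAE AE_lborel_fst[OF lim] AE_lborel_snd[OF lim]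
    proof eventually_elim
      case (elim z)
      show ?case
      proof (cases "fst z = snd z")
        case False
        then have "k z < top" using elim(1) by (auto intro: le_less_trans)
        moreover have "(\<lambda>j. ennreal (c * energy_diff p u (v j) (fst z) (snd z))) \<longlonglongrightarrow> ennreal (c * energy_diff p u v' (fst z) (snd z))"
          unfolding energy_diff_def by (intro tendsto_ennrealI tendsto_intros elim)
        ultimately have "(\<lambda>j. k z * ennreal (c * energy_diff p u (v j) (fst z) (snd z)))
          \<longlonglongrightarrow> k z * ennreal (c * energy_diff p u v' (fst z) (snd z))" by (rule ennreal_tendsto_cmult)
        then show ?thesis by (simp only: mult.commute)
      qed (simp add: energy_diff_def)
    qed
    have [measurable]: "(\<lambda>z. ennreal (c * energy_diff p u f (fst z) (snd z)) * k z) \<in> borel_measurable borel"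
      if [measurable]: "f \<in> borel_measurable borel" for f
      unfolding energy_diff_def by measurable
    show C: "(\<lambda>j. \<integral>\<^sup>+z. ennreal (c * energy_diff p u (v j) (fst z) (snd z)) * k z \<partial>lborel)
      \<longlonglongrightarrow> (\<integral>\<^sup>+z. ennreal (c * energy_diff p u v' (fst z) (snd z)) * k z \<partial>lborel)"
      by (rule nn_integral_dominated_convergence[OF _ _ _ le Hfin ptw]) auto
    have "(\<integral>\<^sup>+z. ennreal (c * energy_diff p u v' (fst z) (snd z)) * k z \<partial>lborel) \<le> (\<integral>\<^sup>+z. H z \<partial>lborel)"
      by (rule LIMSEQ_le_const2[OF C]) (auto intro!: nn_integral_mono_AE le)
    then show "(\<integral>\<^sup>+z. ennreal (c * energy_diff p u v' (fst z) (snd z)) * k z \<partial>lborel) < \<infinity>"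
      using Hfin by (rule le_less_trans)
  qed
  have "(\<integral>\<^sup>+z. ennreal (1 * energy_diff p u v' (fst z) (snd z)) * k z \<partial>lborel)
     \<le> (\<integral>\<^sup>+z. ennreal (-1 * energy_diff p u v' (fst z) (snd z)) * k z \<partial>lborel)"
    by (rule LIMSEQ_le[OF conv[of 1] conv[of "-1"]]) (use test in auto)
  then show ?thesis using fin[of "-1"] by (simp add: tested_def)
qed

text \<open>The function b dominates the energy density of a bounded Lipschitz function supported in
  S: near the diagonal the Lipschitz bound tames the singularity, far away boundedness suffices, and
  one of the two points runs through a set of finite measure.\<close>

lemma Lipschitz_kernel_integrable:
  fixes s p L N :: real and S \<Omega> :: "'a::euclidean_space set"
  assumes s: "0 < s" "s < 1" and p: "1 < p" and S: "compact S" and L: "0 \<le> L" and N: "0 \<le> N"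
  defines "b \<equiv> \<lambda>z. ennreal (min N (L * norm (fst z - snd z)) powr p * frac_kernel s p (fst z) (snd z))
      * (indicator S (fst z) + indicator S (snd z))"
  shows "b \<in> borel_measurable borel" "(\<integral>\<^sup>+z. b z \<partial>lborel) < \<infinity>"
proof -
  have [measurable]: "S \<in> sets borel" using S by (simp add: borel_compact)
  show [measurable]: "b \<in> borel_measurable borel" unfolding b_def by measurable
  obtain Ck where Ck: "0 < Ck" "\<And>d (x::'a). 0 < d \<Longrightarrow>
    (\<integral>\<^sup>+y. ennreal (min 1 (norm (x - y) / d) powr p * frac_kernel s p x y) \<partial>lborel) \<le> ennreal (Ck * d powr (- (s * p)))"
    using kernel_integral[OF s p, where 'a = 'a] unfolding frac_kernel_def by blast
  define c where "c = max N L + 1"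
  have c: "0 < c" "N \<le> c" "L \<le> c" using L N by (auto simp: c_def)
  define M where "M z = ennreal (min 1 (norm (fst z - snd z) / 1) powr p * frac_kernel s p (fst z) (snd z)) * indicator S (fst z)" for z
  have [measurable]: "M \<in> borel_measurable borel" unfolding M_def by measurable
  have [measurable]: "(\<lambda>z. M (snd z, fst z)) \<in> borel_measurable borel" by (rule swap_measurable) measurable
  have le: "b z \<le> ennreal (c powr p) * (M z + M (snd z, fst z))" for z
  proof -
    obtain x y where z: "z = (x, y)" by force
    have "min N (L * norm (x - y)) \<le> c * min 1 (norm (x - y))"
      using c L mult_right_mono[OF c(3), of "norm (x - y)"] by (auto simp: min_def)
    then have "min N (L * norm (x - y)) powr p \<le> (c * min 1 (norm (x - y))) powr p"
      using L N p by (intro powr_mono2) auto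
    then have "min N (L * norm (x - y)) powr p * frac_kernel s p x y
      \<le> (c * min 1 (norm (x - y))) powr p * frac_kernel s p x y"
      by (intro mult_right_mono) auto
    also have "\<dots> = c powr p * (min 1 (norm (x - y)) powr p * frac_kernel s p x y)"
      using c by (simp add: powr_mult mult.assoc)
    finally have "min N (L * norm (x - y)) powr p * frac_kernel s p x y
      \<le> c powr p * (min 1 (norm (x - y)) powr p * frac_kernel s p x y)" .
    then have 1: "ennreal (min N (L * norm (x - y)) powr p * frac_kernel s p x y)
      \<le> ennreal (c powr p) * ennreal (min 1 (norm (x - y)) powr p * frac_kernel s p x y)"
      by (simp add: ennreal_leI flip: ennreal_mult)
    have "b z \<le> (ennreal (c powr p) * ennreal (min 1 (norm (x - y)) powr p * frac_kernel s p x y))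
        * (indicator S x + indicator S y)"
      unfolding b_def z fst_conv snd_conv by (intro mult_right_mono 1) simp
    also have "\<dots> = ennreal (c powr p) * (M z + M (snd z, fst z))"
      by (simp add: M_def z distrib_left mult.assoc norm_minus_commute frac_kernel_commute)
    finally show ?thesis .
  qed
  have "(\<integral>\<^sup>+z. M z \<partial>lborel) = (\<integral>\<^sup>+x. (\<integral>\<^sup>+y. ennreal (min 1 (norm (x - y) / 1) powr p * frac_kernel s p x y) \<partial>lborel) * indicator S x \<partial>lborel)"
    by (subst nn_integral_lborel_pair) (auto simp: M_def nn_integral_multc)
  also have "\<dots> \<le> (\<integral>\<^sup>+x. ennreal (Ck * 1 powr (- (s * p))) * indicator S x \<partial>lborel)"
    by (intro nn_integral_mono mult_right_mono Ck) auto
  also have "\<dots> = ennreal Ck * emeasure lborel S" by (simp add: nn_integral_cmult)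
  also have "\<dots> < \<infinity>" using emeasure_compact_finite[OF S] by (simp add: ennreal_mult_less_top)
  finally have M: "(\<integral>\<^sup>+z. M z \<partial>lborel) < \<infinity>" .
  have "(\<integral>\<^sup>+z. b z \<partial>lborel) \<le> (\<integral>\<^sup>+z. ennreal (c powr p) * (M z + M (snd z, fst z)) \<partial>lborel)"
    by (intro nn_integral_mono le)
  also have "\<dots> = ennreal (c powr p) * ((\<integral>\<^sup>+z. M z \<partial>lborel) + (\<integral>\<^sup>+z. M z \<partial>lborel))"
    by (simp add: nn_integral_cmult nn_integral_add nn_integral_lborel_swap)
  also have "\<dots> < \<infinity>" using M by (simp add: ennreal_mult_less_top)
  finally show "(\<integral>\<^sup>+z. b z \<partial>lborel) < \<infinity>" .
qed

section \<open>Lipschitz functions of compact support in V and as test functions\<close>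

lemma supp_outside: "x \<notin> supp f \<Longrightarrow> f x = 0"
  unfolding supp_def using closure_subset[of "{x. f x \<noteq> 0}"] by auto

lemma Lipschitz_compact_supp_bounded:
  fixes F :: "'a::euclidean_space \<Rightarrow> real"
  assumes "L-lipschitz_on UNIV F" "compact (supp F)"
  shows "\<exists>N\<ge>0. \<forall>x. \<bar>F x\<bar> \<le> N"
proof -
  have "compact (F ` supp F)"
    using assms lipschitz_on_continuous_on[OF assms(1)]
    by (intro compact_continuous_image) (auto intro: continuous_on_subset)
  then obtain N where "\<forall>y\<in>F ` supp F. norm y \<le> N"
    using compact_imp_bounded bounded_iff by blast
  then have N: "\<And>x. x \<in> supp F \<Longrightarrow> \<bar>F x\<bar> \<le> N" by auto
  have "\<bar>F x\<bar> \<le> max N 0" for x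
    using N[of x] supp_outside[of x F] by (cases "x \<in> supp F") auto
  then show ?thesis by (intro exI[of _ "max N 0"]) auto
qed

lemma Lipschitz_difference_bound:
  fixes F :: "'a::euclidean_space \<Rightarrow> real"
  assumes "L-lipschitz_on UNIV F" "\<And>x. \<bar>F x\<bar> \<le> N" "\<And>x. x \<notin> S \<Longrightarrow> F x = 0" "0 \<le> p"
  shows "ennreal (\<bar>F x - F y\<bar> powr p * frac_kernel s p x y)
    \<le> ennreal (min (2 * N) (L * norm (x - y)) powr p * frac_kernel s p x y) * (indicator S x + indicator S y)"
proof (cases "x \<in> S \<or> y \<in> S")
  case True
  have "\<bar>F x - F y\<bar> \<le> min (2 * N) (L * norm (x - y))"
    using lipschitz_onD[OF assms(1), of x y] assms(2)[of x] assms(2)[of y]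
    by (auto simp: dist_norm)
  then have 1: "ennreal (\<bar>F x - F y\<bar> powr p * frac_kernel s p x y)
    \<le> ennreal (min (2 * N) (L * norm (x - y)) powr p * frac_kernel s p x y)"
    using assms(4) by (intro ennreal_leI mult_right_mono powr_mono2) auto
  have "(1::ennreal) \<le> indicator S x + indicator S y" using True by (auto simp: indicator_def)
  from mult_mono[OF 1 this] show ?thesis by simp
qed (use assms(3) in auto)

text \<open>\<open>V_le0_on\<close> asks for membership in \<open>V_space\<close> explicitly; this
  discharges it for the approximants constructed in \<open>V_le0_on_ball\<close>.\<close>

lemma Lipschitz_compact_supp_V_space:
  fixes F :: "'a::euclidean_space \<Rightarrow> real"
  assumes "0 < s" "s < 1" "1 < p" "L-lipschitz_on UNIV F" "compact (supp F)"
  shows "F \<in> V_space s p \<Omega>"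
proof -
  obtain N where N: "0 \<le> N" "\<And>x. \<bar>F x\<bar> \<le> N" using Lipschitz_compact_supp_bounded[OF assms(4,5)] by auto
  have [measurable]: "F \<in> borel_measurable borel"
    using lipschitz_on_continuous_on[OF assms(4)] by (rule borel_measurable_continuous_onI)
  have "Lp_energy p \<Omega> F \<le> (\<integral>\<^sup>+x. ennreal (N powr p) * indicator (supp F) x \<partial>lborel)"
    unfolding Lp_energy_lborel
  proof (intro nn_integral_mono)
    fix x
    have "\<bar>F x\<bar> powr p \<le> N powr p" using N(2)[of x] assms by (intro powr_mono2) auto
    then show "ennreal (\<bar>F x\<bar> powr p) * indicator \<Omega> x \<le> ennreal (N powr p) * indicator (supp F) x"
      using supp_outside[of x F] by (cases "x \<in> supp F") (auto simp: indicator_def ennreal_leI)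
  qed
  also have "\<dots> = ennreal (N powr p) * emeasure lborel (supp F)"
    using assms(5) by (intro nn_integral_cmult_indicator) (simp add: borel_compact)
  also have "\<dots> < \<infinity>" using emeasure_compact_finite[OF assms(5)] by (simp add: ennreal_mult_less_top)
  finally have 1: "Lp_energy p \<Omega> F < \<infinity>" .
  have L: "0 \<le> L" by (rule lipschitz_on_nonneg[OF assms(4)])
  have "gagliardo s p (\<Omega> \<times> UNIV) F \<le> (\<integral>\<^sup>+z. ennreal (min (2 * N) (L * norm (fst z - snd z)) powr p * frac_kernel s p (fst z) (snd z))
      * (indicator (supp F) (fst z) + indicator (supp F) (snd z)) \<partial>lborel)"
    unfolding gagliardo_lborel
  proof (intro nn_integral_mono)
    fix z :: "'a \<times> 'a"
    have "ennreal (\<bar>F (fst z) - F (snd z)\<bar> powr p * frac_kernel s p (fst z) (snd z)) * indicator (\<Omega> \<times> UNIV) z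
      \<le> ennreal (\<bar>F (fst z) - F (snd z)\<bar> powr p * frac_kernel s p (fst z) (snd z))" by (auto simp: indicator_def)
    also have "\<dots> \<le> ennreal (min (2 * N) (L * norm (fst z - snd z)) powr p * frac_kernel s p (fst z) (snd z))
      * (indicator (supp F) (fst z) + indicator (supp F) (snd z))"
      using N(2) supp_outside assms by (intro Lipschitz_difference_bound) auto
    finally show "ennreal (\<bar>F (fst z) - F (snd z)\<bar> powr p * frac_kernel s p (fst z) (snd z)) * indicator (\<Omega> \<times> UNIV) z
      \<le> ennreal (min (2 * N) (L * norm (fst z - snd z)) powr p * frac_kernel s p (fst z) (snd z))
      * (indicator (supp F) (fst z) + indicator (supp F) (snd z))" .
  qed
  also have "\<dots> < \<infinity>" using Lipschitz_kernel_integrable(2)[OF assms(1-3,5) L, of "2 * N"] N by simp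
  finally show ?thesis using 1 measurable_completion[of F lborel borel] by (simp add: V_space_def)
qed

text \<open>First extension of the weak inequality, from smooth to Lipschitz functions of compact
  support in \<Omega>, by mollification.\<close>

lemma tested_Lipschitz:
  fixes u F :: "'a::euclidean_space \<Rightarrow> real"
  assumes s: "0 < s" "s < 1" and p: "1 < p" and \<Lambda>: "1 \<le> \<Lambda>" and \<Omega>: "open \<Omega>"
    and um [measurable]: "u \<in> borel_measurable borel" and u: "gagliardo s p (\<Omega> \<times> UNIV) u < \<infinity>"
    and kb: "kernel_bounds s p \<Lambda> k"
    and test: "\<And>\<phi>. \<phi> \<in> test_functions \<Omega> \<Longrightarrow> (\<And>x. 0 \<le> \<phi> x) \<Longrightarrow>
      (\<integral>\<^sup>+z. ennreal (energy_diff p u \<phi> (fst z) (snd z)) * k z \<partial>lborel)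
       \<le> (\<integral>\<^sup>+z. ennreal (- energy_diff p u \<phi> (fst z) (snd z)) * k z \<partial>lborel)"
    and F: "L-lipschitz_on UNIV F" "compact (supp F)" "supp F \<subseteq> \<Omega>" "\<And>x. 0 \<le> F x"
  shows "tested p k u F"
proof -
  obtain N where N: "0 \<le> N" "\<And>x. \<bar>F x\<bar> \<le> N" using Lipschitz_compact_supp_bounded[OF F(1,2)] by auto
  have FN: "F x \<le> N" for x using N(2)[of x] by simp
  obtain \<phi> :: "nat \<Rightarrow> 'a \<Rightarrow> real" and S where \<phi>:
    "\<And>j. \<phi> j \<in> test_functions \<Omega>" "\<And>j x. 0 \<le> \<phi> j x" "\<And>j x. \<phi> j x \<le> N"
    "\<And>j. L-lipschitz_on UNIV (\<phi> j)" "\<And>x. (\<lambda>j. \<phi> j x) \<longlonglongrightarrow> F x"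
    "compact S" "S \<subseteq> \<Omega>" "\<And>j x. x \<notin> S \<Longrightarrow> \<phi> j x = 0"
    using smooth_approximation[OF F(1,2,4) FN \<Omega> F(3)] by metis
  \<comment> \<open>Independent of j, since N, L and S are common to all mollifications.\<close>
  define b where "b z = ennreal (min (2 * N) (L * norm (fst z - snd z)) powr p * frac_kernel s p (fst z) (snd z))
      * (indicator S (fst z) + indicator S (snd z))" for z :: "'a \<times> 'a"
  have L: "0 \<le> L" by (rule lipschitz_on_nonneg[OF F(1)])
  have bm: "b \<in> borel_measurable borel" and bi: "(\<integral>\<^sup>+z. b z \<partial>lborel) < \<infinity>"
    unfolding b_def by (rule Lipschitz_kernel_integrable[OF s p \<phi>(6) L]; simp add: N(1))+
  show ?thesis
  proof (rule tested_limit[where v = \<phi> and b = b, OF p \<Lambda> \<Omega> um u kb])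
    show "\<phi> j \<in> borel_measurable borel" for j
      using lipschitz_on_continuous_on[OF \<phi>(4)] by (rule borel_measurable_continuous_onI)
    show "F \<in> borel_measurable borel"
      using lipschitz_on_continuous_on[OF F(1)] by (rule borel_measurable_continuous_onI)
    show "\<phi> j x = 0" if "x \<notin> \<Omega>" for j x using \<phi>(7,8) that by blast
    show "b \<in> borel_measurable borel" by (rule bm)
    have "(\<integral>\<^sup>+z\<in>\<Omega> \<times> UNIV. b z \<partial>lborel) \<le> (\<integral>\<^sup>+z. b z \<partial>lborel)"
      by (intro nn_integral_mono) (auto simp: indicator_def)
    then show "(\<integral>\<^sup>+z\<in>\<Omega> \<times> UNIV. b z \<partial>lborel) < \<infinity>" using bi by (rule le_less_trans)
    show "ennreal (\<bar>\<phi> j x - \<phi> j y\<bar> powr p * frac_kernel s p x y) \<le> b (x, y)" for j x y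
    proof -
      have "\<bar>\<phi> j x\<bar> \<le> N" for x using \<phi>(2)[of j x] \<phi>(3)[of j x] by simp
      from Lipschitz_difference_bound[OF \<phi>(4) this \<phi>(8), where s = s and p = p and x = x and y = y] p
      show ?thesis unfolding b_def fst_conv snd_conv by simp
    qed
  qed (use \<phi> test in auto)
qed

subsection \<open>Approximation in V\<close>

lemma summable_nn_integrals:
  fixes f :: "nat \<Rightarrow> 'b \<Rightarrow> ennreal"
  assumes [measurable]: "\<And>j. f j \<in> borel_measurable M"
    and le: "\<And>j. (\<integral>\<^sup>+x. f j x \<partial>M) \<le> ennreal ((1 / 2) ^ j)"
  shows "(\<integral>\<^sup>+x. (\<Sum>j. f j x) \<partial>M) < \<infinity>" "AE x in M. (\<lambda>j. f j x) \<longlonglongrightarrow> 0"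
proof -
  have "(\<integral>\<^sup>+x. (\<Sum>j. f j x) \<partial>M) = (\<Sum>j. \<integral>\<^sup>+x. f j x \<partial>M)" by (rule nn_integral_suminf) simp
  also have "\<dots> \<le> (\<Sum>j. ennreal ((1 / 2) ^ j))" by (intro suminf_le le) auto
  also have "\<dots> = ennreal (1 / (1 - 1 / 2))"
    by (intro suminf_ennreal_eq geometric_sums) auto
  also have "\<dots> < \<infinity>" by simp
  finally show fin: "(\<integral>\<^sup>+x. (\<Sum>j. f j x) \<partial>M) < \<infinity>" .
  then have "AE x in M. (\<Sum>j. f j x) \<noteq> \<infinity>" by (intro nn_integral_PInf_AE) auto
  then show "AE x in M. (\<lambda>j. f j x) \<longlonglongrightarrow> 0"
  proof eventually_elim
    fix x assume x: "(\<Sum>j. f j x) \<noteq> \<infinity>"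
    have "f j x < top" for j
      using ennreal_le_suminf[of "\<lambda>j. f j x" j] x by (metis infinity_ennreal_def less_top top_unique)
    then have eq: "f j x = ennreal (enn2real (f j x))" for j by simp
    have "(\<Sum>j. ennreal (enn2real (f j x))) \<noteq> top" using x eq by simp
    then have "summable (\<lambda>j. enn2real (f j x))" by (intro summable_suminf_not_top) auto
    then have "(\<lambda>j. ennreal (enn2real (f j x))) \<longlonglongrightarrow> ennreal 0"
      by (intro tendsto_ennrealI summable_LIMSEQ_zero)
    then show "(\<lambda>j. f j x) \<longlonglongrightarrow> 0" using eq by simp
  qed
qed

lemma tendsto_zero_of_powr:
  fixes a :: "nat \<Rightarrow> real"
  assumes "0 < p" "(\<lambda>j. ennreal (\<bar>a j\<bar> powr p)) \<longlonglongrightarrow> 0"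
  shows "a \<longlonglongrightarrow> 0"
proof -
  have "(\<lambda>j. ennreal (\<bar>a j\<bar> powr p)) \<longlonglongrightarrow> ennreal 0" using assms(2) by simp
  from tendsto_enn2real[OF this] have "(\<lambda>j. \<bar>a j\<bar> powr p) \<longlonglongrightarrow> 0" by simp
  then have "(\<lambda>j. (\<bar>a j\<bar> powr p) powr (1 / p)) \<longlonglongrightarrow> 0 powr (1 / p)"
    using assms(1) by (intro tendsto_powr') auto
  then have "(\<lambda>j. \<bar>a j\<bar>) \<longlonglongrightarrow> 0" using assms(1) by (simp add: powr_powr)
  then show ?thesis by (rule tendsto_rabs_zero_cancel)
qed

text \<open>Deliberately asymmetric: apart from the difference, only the value a at the first point
  occurs. That point will lie in \<Omega>, where p-th powers are integrable; nothing of the kind is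
  known at the second point.\<close>

lemma cutoff_truncation_difference:
  fixes \<zeta> \<zeta>' a b c :: real
  assumes "0 \<le> \<zeta>" "\<zeta> \<le> 1" "0 \<le> \<zeta>'" "\<zeta>' \<le> 1" "0 \<le> c"
  shows "\<bar>\<zeta> * max (a - c) 0 - \<zeta>' * max (b - c) 0\<bar> \<le> \<bar>a - b\<bar> + \<bar>a\<bar> * \<bar>\<zeta> - \<zeta>'\<bar>"
proof -
  let ?A = "max (a - c) 0" and ?B = "max (b - c) 0"
  have "\<zeta> * ?A - \<zeta>' * ?B = \<zeta>' * (?A - ?B) + ?A * (\<zeta> - \<zeta>')" by (simp add: algebra_simps)
  then have "\<bar>\<zeta> * ?A - \<zeta>' * ?B\<bar> \<le> \<bar>\<zeta>' * (?A - ?B)\<bar> + \<bar>?A * (\<zeta> - \<zeta>')\<bar>" by (metis abs_triangle_ineq)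
  also have "\<dots> = \<zeta>' * \<bar>?A - ?B\<bar> + \<bar>?A\<bar> * \<bar>\<zeta> - \<zeta>'\<bar>" using assms by (simp add: abs_mult)
  also have "\<zeta>' * \<bar>?A - ?B\<bar> \<le> 1 * \<bar>?A - ?B\<bar>" using assms by (intro mult_right_mono) auto
  also have "1 * \<bar>?A - ?B\<bar> \<le> \<bar>a - b\<bar>" by (auto simp: max_def)
  also have "\<bar>?A\<bar> * \<bar>\<zeta> - \<zeta>'\<bar> \<le> \<bar>a\<bar> * \<bar>\<zeta> - \<zeta>'\<bar>" using assms by (intro mult_right_mono) (auto simp: max_def)
  finally show ?thesis by simp
qed

lemma powr_four_le:
  fixes p a b c d m t :: real
  assumes "0 \<le> p" "0 \<le> a" "0 \<le> b" "0 \<le> c" "0 \<le> d" "0 \<le> m" "0 \<le> t" "t \<le> a + b + (c + d) * m"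
  shows "t powr p \<le> 4 powr p * (a powr p + b powr p + (c powr p + d powr p) * m powr p)"
proof -
  have four: "(4::real) powr p = 2 powr p * 2 powr p" by (simp flip: powr_mult)
  have "t powr p \<le> ((a + b) + (c + d) * m) powr p" using assms by (intro powr_mono2) auto
  also have "\<dots> \<le> 2 powr p * ((a + b) powr p + ((c + d) * m) powr p)" using assms by (intro powr_add_le) auto
  also have "((c + d) * m) powr p = (c + d) powr p * m powr p" using assms by (simp add: powr_mult)
  also have "2 powr p * ((a + b) powr p + (c + d) powr p * m powr p)
    \<le> 2 powr p * (2 powr p * (a powr p + b powr p) + 2 powr p * (c powr p + d powr p) * m powr p)"
    using assms by (intro mult_left_mono add_mono mult_right_mono powr_add_le) auto
  finally show ?thesis by (simp add: four algebra_simps)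
qed

text \<open>The geometric rate makes the sum of all errors an integrable majorant, so that convergence
  almost everywhere and dominated convergence are available without passing to subsequences.\<close>

locale fast_V_approximation =
  fixes s p :: real and \<Omega> :: "'a::euclidean_space set" and g :: "'a \<Rightarrow> real" and \<psi> :: "nat \<Rightarrow> 'a \<Rightarrow> real"
  assumes s: "0 < s" "s < 1" and p: "1 < p" and \<Omega>: "open \<Omega>" "\<Omega> \<noteq> {}"
    and g_measurable [measurable]: "g \<in> borel_measurable borel"
    and \<psi>_measurable [measurable]: "\<And>j. \<psi> j \<in> borel_measurable borel"
    and g_finite: "Lp_energy p \<Omega> g < \<infinity>" "gagliardo s p (\<Omega> \<times> UNIV) g < \<infinity>"
    and close: "\<And>j. Lp_energy p \<Omega> (\<lambda>x. g x - \<psi> j x) \<le> ennreal ((1 / 2) ^ j)"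
      "\<And>j. gagliardo s p (\<Omega> \<times> UNIV) (\<lambda>x. g x - \<psi> j x) \<le> ennreal ((1 / 2) ^ j)"
begin

lemma \<Omega>_sets [measurable]: "\<Omega> \<in> sets borel" "\<Omega> \<times> (UNIV :: 'a set) \<in> sets borel"
  using \<Omega> by (auto intro: borel_open open_Times)

definition Sp :: "'a \<Rightarrow> ennreal" where
  "Sp x = (\<Sum>j. ennreal (\<bar>g x - \<psi> j x\<bar> powr p))"

definition diff_energy :: "nat \<Rightarrow> 'a \<times> 'a \<Rightarrow> real" where
  "diff_energy j z = \<bar>(g (fst z) - \<psi> j (fst z)) - (g (snd z) - \<psi> j (snd z))\<bar> powr p * frac_kernel s p (fst z) (snd z)"

definition Sg :: "'a \<times> 'a \<Rightarrow> ennreal" where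
  "Sg z = (\<Sum>j. ennreal (diff_energy j z))"

lemma measurable_sums [measurable]:
  "Sp \<in> borel_measurable borel" "diff_energy j \<in> borel_measurable borel" "Sg \<in> borel_measurable borel"
  unfolding Sp_def Sg_def diff_energy_def by measurable

lemma Sp_finite: "(\<integral>\<^sup>+x\<in>\<Omega>. Sp x \<partial>lborel) < \<infinity>"
  and AE_\<Omega>: "AE x in lborel. x \<in> \<Omega> \<longrightarrow> (\<lambda>j. g x - \<psi> j x) \<longlonglongrightarrow> 0"
proof -
  have le: "(\<integral>\<^sup>+x. ennreal (\<bar>g x - \<psi> j x\<bar> powr p) * indicator \<Omega> x \<partial>lborel) \<le> ennreal ((1 / 2) ^ j)" for j
    using close(1) by (simp add: Lp_energy_lborel)
  have m: "(\<lambda>x. ennreal (\<bar>g x - \<psi> j x\<bar> powr p) * indicator \<Omega> x) \<in> borel_measurable lborel" for j by measurable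
  have "(\<integral>\<^sup>+x. (\<Sum>j. ennreal (\<bar>g x - \<psi> j x\<bar> powr p) * indicator \<Omega> x) \<partial>lborel) < \<infinity>"
    by (rule summable_nn_integrals(1)[OF m le])
  then show "(\<integral>\<^sup>+x\<in>\<Omega>. Sp x \<partial>lborel) < \<infinity>" by (simp add: Sp_def)
  have "AE x in lborel. (\<lambda>j. ennreal (\<bar>g x - \<psi> j x\<bar> powr p) * indicator \<Omega> x) \<longlonglongrightarrow> 0"
    by (rule summable_nn_integrals(2)[OF m le])
  then show "AE x in lborel. x \<in> \<Omega> \<longrightarrow> (\<lambda>j. g x - \<psi> j x) \<longlonglongrightarrow> 0"
    by eventually_elim (use p in \<open>auto intro: tendsto_zero_of_powr[of p]\<close>)
qed

lemma Sg_finite: "(\<integral>\<^sup>+z\<in>\<Omega> \<times> UNIV. Sg z \<partial>lborel) < \<infinity>"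
  and AE_\<Omega>_UNIV: "AE z in lborel. fst z \<in> \<Omega> \<longrightarrow>
    (\<lambda>j. (g (fst z) - \<psi> j (fst z)) - (g (snd z) - \<psi> j (snd z))) \<longlonglongrightarrow> 0"
proof -
  have le: "(\<integral>\<^sup>+z. ennreal (diff_energy j z) * indicator (\<Omega> \<times> UNIV) z \<partial>lborel) \<le> ennreal ((1 / 2) ^ j)" for j
    using close(2)[of j] by (simp add: gagliardo_lborel diff_energy_def)
  have m: "(\<lambda>z. ennreal (diff_energy j z) * indicator (\<Omega> \<times> UNIV) z) \<in> borel_measurable lborel" for j by measurable
  have "(\<integral>\<^sup>+z. (\<Sum>j. ennreal (diff_energy j z) * indicator (\<Omega> \<times> UNIV) z) \<partial>lborel) < \<infinity>"
    by (rule summable_nn_integrals(1)[OF m le])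
  then show "(\<integral>\<^sup>+z\<in>\<Omega> \<times> UNIV. Sg z \<partial>lborel) < \<infinity>" by (simp add: Sg_def)
  have "AE z in lborel. (\<lambda>j. ennreal (diff_energy j z) * indicator (\<Omega> \<times> UNIV) z) \<longlonglongrightarrow> 0"
    by (rule summable_nn_integrals(2)[OF m le])
  then show "AE z in lborel. fst z \<in> \<Omega> \<longrightarrow>
    (\<lambda>j. (g (fst z) - \<psi> j (fst z)) - (g (snd z) - \<psi> j (snd z))) \<longlonglongrightarrow> 0"
  proof eventually_elim
    fix z :: "'a \<times> 'a"
    assume conv: "(\<lambda>j. ennreal (diff_energy j z) * indicator (\<Omega> \<times> UNIV) z) \<longlonglongrightarrow> 0"
    show "fst z \<in> \<Omega> \<longrightarrow> (\<lambda>j. (g (fst z) - \<psi> j (fst z)) - (g (snd z) - \<psi> j (snd z))) \<longlonglongrightarrow> 0"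
    proof (intro impI, cases "fst z = snd z")
      case False
      assume "fst z \<in> \<Omega>"
      then have "indicator (\<Omega> \<times> UNIV) z = (1 :: ennreal)" by (cases z) auto
      then have 1: "(\<lambda>j. ennreal (diff_energy j z)) \<longlonglongrightarrow> 0" using conv by simp
      \<comment> \<open>Off the diagonal the kernel is a positive number independent of j and may be
        divided out.\<close>
      define K where "K = frac_kernel s p (fst z) (snd z)"
      have K: "0 < K" using False by (simp add: K_def frac_kernel_def)
      have "(\<lambda>j. ennreal (1 / K) * ennreal (diff_energy j z)) \<longlonglongrightarrow> ennreal (1 / K) * 0"
        using 1 by (intro ennreal_tendsto_cmult) auto
      moreover have "ennreal (1 / K) * ennreal (diff_energy j z)
        = ennreal (\<bar>(g (fst z) - \<psi> j (fst z)) - (g (snd z) - \<psi> j (snd z))\<bar> powr p)" for j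
        using K by (simp add: diff_energy_def K_def flip: ennreal_mult)
      ultimately show "(\<lambda>j. (g (fst z) - \<psi> j (fst z)) - (g (snd z) - \<psi> j (snd z))) \<longlonglongrightarrow> 0"
        using p by (intro tendsto_zero_of_powr[of p]) auto
    qed simp
  qed
qed

text \<open>The L^p part of the norm gives convergence in \<Omega> only. Fix one x in \<Omega> where
  \<psi>_j(x) converges and where, by Fubini, the differences with \<psi>_j(y) converge for almost
  every y in the whole space; subtracting gives convergence at y. This is where \<Omega> must be
  nonempty.\<close>

lemma AE_convergence: "AE x in lborel. (\<lambda>j. \<psi> j x) \<longlonglongrightarrow> g x"
proof -
  let ?P = "\<lambda>z. fst z \<in> \<Omega> \<longrightarrow> (\<lambda>j. (g (fst z) - \<psi> j (fst z)) - (g (snd z) - \<psi> j (snd z))) \<longlonglongrightarrow> 0"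
  have "AE z in lborel \<Otimes>\<^sub>M lborel. ?P z" unfolding lborel_prod by (rule AE_\<Omega>_UNIV)
  then have "AE x in lborel. AE y in lborel. ?P (x, y)" by (rule lborel_pair.AE_pair)
  with AE_\<Omega> have "AE x in lborel. x \<in> \<Omega> \<longrightarrow> (\<lambda>j. g x - \<psi> j x) \<longlonglongrightarrow> 0 \<and> (AE y in lborel. ?P (x, y))"
    by eventually_elim auto
  moreover have "\<not> (AE x in lborel. x \<notin> \<Omega>)"
  proof
    assume "AE x in lborel. x \<notin> \<Omega>"
    then have "emeasure lborel \<Omega> = 0" by (subst (asm) AE_iff_measurable) auto
    moreover obtain x e where "0 < e" "ball x e \<subseteq> \<Omega>" using \<Omega> openE by blast
    ultimately have "emeasure lborel (ball x e) = 0" using emeasure_mono[of "ball x e" \<Omega> lborel] by simp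
    then show False using emeasure_ball[of e x] \<open>0 < e\<close> unit_ball_vol_pos[of "real DIM('a)"]
      by (simp add: mult_le_0_iff not_le)
  qed
  ultimately obtain x where x: "x \<in> \<Omega>" "(\<lambda>j. g x - \<psi> j x) \<longlonglongrightarrow> 0" "AE y in lborel. ?P (x, y)"
    by (metis (mono_tags, lifting) eventually_mono)
  from x(3) show ?thesis
  proof eventually_elim
    fix y assume "?P (x, y)"
    then have "(\<lambda>j. (g x - \<psi> j x) - (g y - \<psi> j y)) \<longlonglongrightarrow> 0" using x(1) by simp
    from tendsto_diff[OF x(2) this] have "(\<lambda>j. g y - \<psi> j y) \<longlonglongrightarrow> 0" by simp
    from tendsto_diff[OF tendsto_const[of "g y"] this] show "(\<lambda>j. \<psi> j y) \<longlonglongrightarrow> g y" by simp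
  qed
qed

text \<open>Bounds the energy density of cutoff times truncation for g and for every \<psi>_j at
  once: \<open>Sg\<close> and \<open>Sp\<close> contain the error of each j as one summand. L is the
  Lipschitz constant of the cutoff, and 4^p comes from \<open>powr_four_le\<close>.\<close>

definition majorant :: "real \<Rightarrow> 'a \<times> 'a \<Rightarrow> ennreal" where
  "majorant L z = ennreal (4 powr p) *
     (ennreal (\<bar>g (fst z) - g (snd z)\<bar> powr p * frac_kernel s p (fst z) (snd z)) + Sg z
      + (ennreal (\<bar>g (fst z)\<bar> powr p) + Sp (fst z))
        * ennreal (min 1 (L * norm (fst z - snd z)) powr p * frac_kernel s p (fst z) (snd z)))"

lemma majorant_measurable [measurable]: "majorant L \<in> borel_measurable borel"
  unfolding majorant_def by measurable

text \<open>In the last summand the integral over y is bounded uniformly in x by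
  \<open>kernel_integral\<close> with d = 1/L. What remains is an integral over x in \<Omega> of the
  p-th powers at x, which the V norm controls.\<close>

lemma majorant_finite:
  assumes L: "0 < L"
  shows "(\<integral>\<^sup>+z\<in>\<Omega> \<times> UNIV. majorant L z \<partial>lborel) < \<infinity>"
proof -
  obtain Ck where Ck: "0 < Ck" "\<And>d (x::'a). 0 < d \<Longrightarrow>
    (\<integral>\<^sup>+y. ennreal (min 1 (norm (x - y) / d) powr p * frac_kernel s p x y) \<partial>lborel) \<le> ennreal (Ck * d powr (- (s * p)))"
    using kernel_integral[OF s p, where 'a = 'a] unfolding frac_kernel_def by blast
  define c where "c = Ck * (1 / L) powr (- (s * p))"
  have kern: "(\<integral>\<^sup>+y. ennreal (min 1 (L * norm (x - y)) powr p * frac_kernel s p x y) \<partial>lborel) \<le> ennreal c" for x :: 'a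
    using Ck(2)[of "1 / L" x] L by (simp add: c_def mult.commute)
  define f where "f x = ennreal (\<bar>g x\<bar> powr p) + Sp x" for x
  have [measurable]: "f \<in> borel_measurable borel" unfolding f_def by measurable
  define A where "A z = ennreal (\<bar>g (fst z) - g (snd z)\<bar> powr p * frac_kernel s p (fst z) (snd z)) * indicator (\<Omega> \<times> UNIV) z" for z
  define B where "B z = f (fst z) * indicator \<Omega> (fst z)
    * ennreal (min 1 (L * norm (fst z - snd z)) powr p * frac_kernel s p (fst z) (snd z))" for z
  have [measurable]: "A \<in> borel_measurable borel" "B \<in> borel_measurable borel" unfolding A_def B_def by measurable
  have "(\<integral>\<^sup>+x. f x * indicator \<Omega> x \<partial>lborel) = Lp_energy p \<Omega> g + (\<integral>\<^sup>+x\<in>\<Omega>. Sp x \<partial>lborel)"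
    unfolding f_def Lp_energy_lborel distrib_right by (subst nn_integral_add) auto
  then have f: "(\<integral>\<^sup>+x. f x * indicator \<Omega> x \<partial>lborel) < \<infinity>" using g_finite Sp_finite by (simp add: ennreal_add_less_top)
  have "(\<integral>\<^sup>+z. B z \<partial>lborel) = (\<integral>\<^sup>+x. f x * indicator \<Omega> x *
      (\<integral>\<^sup>+y. ennreal (min 1 (L * norm (x - y)) powr p * frac_kernel s p x y) \<partial>lborel) \<partial>lborel)"
    by (subst nn_integral_lborel_pair) (auto simp: B_def nn_integral_cmult)
  also have "\<dots> \<le> (\<integral>\<^sup>+x. f x * indicator \<Omega> x * ennreal c \<partial>lborel)"
    by (intro nn_integral_mono mult_left_mono kern) auto
  also have "\<dots> = (\<integral>\<^sup>+x. f x * indicator \<Omega> x \<partial>lborel) * ennreal c"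
    by (rule nn_integral_multc) measurable
  also have "\<dots> < \<infinity>" using f by (simp add: ennreal_mult_less_top)
  finally have B: "(\<integral>\<^sup>+z. B z \<partial>lborel) < \<infinity>" .
  have "majorant L z * indicator (\<Omega> \<times> UNIV) z = ennreal (4 powr p) * (A z + Sg z * indicator (\<Omega> \<times> UNIV) z + B z)" for z
    by (cases z) (auto simp: majorant_def A_def B_def f_def indicator_def)
  then have "(\<integral>\<^sup>+z\<in>\<Omega> \<times> UNIV. majorant L z \<partial>lborel)
    = ennreal (4 powr p) * ((\<integral>\<^sup>+z. A z \<partial>lborel) + (\<integral>\<^sup>+z\<in>\<Omega> \<times> UNIV. Sg z \<partial>lborel) + (\<integral>\<^sup>+z. B z \<partial>lborel))"
    by (simp add: nn_integral_cmult nn_integral_add)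
  moreover have "(\<integral>\<^sup>+z. A z \<partial>lborel) < \<infinity>" using g_finite(2) by (simp add: A_def gagliardo_lborel)
  ultimately show ?thesis using Sg_finite B by (simp add: ennreal_add_less_top ennreal_mult_less_top)
qed

section \<open>Cutoffs and truncations of the approximating sequence\<close>

context
  fixes \<zeta> :: "'a \<Rightarrow> real" and L c :: real
  assumes \<zeta>01: "\<And>x. 0 \<le> \<zeta> x" "\<And>x. \<zeta> x \<le> 1" and \<zeta>lip: "\<And>x y. \<bar>\<zeta> x - \<zeta> y\<bar> \<le> L * norm (x - y)"
    and L: "0 < L" and c: "0 \<le> c"
begin

text \<open>Up to the error of index j, the function \<psi>_j may be replaced by g both in
  differences and in values; each error is one term of the sums in the majorant.\<close>

lemma cutoff_difference_le_majorant:
  fixes f :: "'a \<Rightarrow> real"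
  assumes f: "f = g \<or> f = \<psi> j"
  shows "ennreal (\<bar>\<zeta> x * max (f x - c) 0 - \<zeta> y * max (f y - c) 0\<bar> powr p * frac_kernel s p x y) \<le> majorant L (x, y)"
proof -
  define K where "K = frac_kernel s p x y"
  define m where "m = min 1 (L * norm (x - y))"
  have m: "0 \<le> m" using L by (simp add: m_def)
  have "\<bar>\<zeta> x - \<zeta> y\<bar> \<le> m"
    using \<zeta>lip[of x y] \<zeta>01(1)[of x] \<zeta>01(2)[of x] \<zeta>01(1)[of y] \<zeta>01(2)[of y] by (auto simp: m_def abs_le_iff)
  let ?B = "\<bar>(g x - \<psi> j x) - (g y - \<psi> j y)\<bar>" and ?d = "\<bar>g x - \<psi> j x\<bar>"
  have "\<bar>\<zeta> x * max (f x - c) 0 - \<zeta> y * max (f y - c) 0\<bar> \<le> \<bar>f x - f y\<bar> + \<bar>f x\<bar> * \<bar>\<zeta> x - \<zeta> y\<bar>"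
    using \<zeta>01 c by (intro cutoff_truncation_difference) auto
  also have "\<dots> \<le> \<bar>f x - f y\<bar> + \<bar>f x\<bar> * m"
    using \<open>\<bar>\<zeta> x - \<zeta> y\<bar> \<le> m\<close> by (intro add_left_mono mult_left_mono) auto
  also have "\<dots> \<le> \<bar>g x - g y\<bar> + ?B + (\<bar>g x\<bar> + ?d) * m"
  proof (intro add_mono mult_right_mono m)
    show "\<bar>f x - f y\<bar> \<le> \<bar>g x - g y\<bar> + ?B" using f by auto
    show "\<bar>f x\<bar> \<le> \<bar>g x\<bar> + ?d" using f by auto
  qed
  finally have "\<bar>\<zeta> x * max (f x - c) 0 - \<zeta> y * max (f y - c) 0\<bar> powr p
    \<le> 4 powr p * (\<bar>g x - g y\<bar> powr p + ?B powr p + (\<bar>g x\<bar> powr p + ?d powr p) * m powr p)"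
    using p m by (intro powr_four_le) auto
  then have "\<bar>\<zeta> x * max (f x - c) 0 - \<zeta> y * max (f y - c) 0\<bar> powr p * K
    \<le> 4 powr p * (\<bar>g x - g y\<bar> powr p + ?B powr p + (\<bar>g x\<bar> powr p + ?d powr p) * m powr p) * K"
    unfolding K_def by (intro mult_right_mono) auto
  also have "\<dots> = 4 powr p * (\<bar>g x - g y\<bar> powr p * K + ?B powr p * K + (\<bar>g x\<bar> powr p + ?d powr p) * (m powr p * K))"
    by (simp add: algebra_simps)
  finally have "ennreal (\<bar>\<zeta> x * max (f x - c) 0 - \<zeta> y * max (f y - c) 0\<bar> powr p * K)
    \<le> ennreal (4 powr p * (\<bar>g x - g y\<bar> powr p * K + ?B powr p * K + (\<bar>g x\<bar> powr p + ?d powr p) * (m powr p * K)))"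
    by (rule ennreal_leI)
  also have "\<dots> = ennreal (4 powr p) * (ennreal (\<bar>g x - g y\<bar> powr p * K) + ennreal (?B powr p * K)
      + (ennreal (\<bar>g x\<bar> powr p) + ennreal (?d powr p)) * ennreal (m powr p * K))"
    by (simp add: K_def ennreal_mult)
  also have "\<dots> \<le> majorant L (x, y)"
    unfolding majorant_def fst_conv snd_conv K_def m_def Sg_def Sp_def
  proof (intro mult_left_mono mult_right_mono add_mono order_refl)
    show "ennreal (?B powr p * frac_kernel s p x y) \<le> (\<Sum>j. ennreal (diff_energy j (x, y)))"
      using ennreal_le_suminf[of "\<lambda>j. ennreal (diff_energy j (x, y))" j] by (simp add: diff_energy_def)
    show "ennreal (?d powr p) \<le> (\<Sum>j. ennreal (\<bar>g x - \<psi> j x\<bar> powr p))" by (rule ennreal_le_suminf)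
  qed auto
  finally show ?thesis by (simp add: K_def)
qed

text \<open>In L^p the operation is a contraction. The Gagliardo seminorm of a difference of
  truncations is not controlled by that of the difference (shift a function by a constant), so there
  convergence follows from \<open>AE_convergence\<close> and domination by the majorant.\<close>

lemma cutoff_energy_tendsto:
  shows "(\<lambda>j. Lp_energy p \<Omega> (\<lambda>x. \<zeta> x * max (g x - c) 0 - \<zeta> x * max (\<psi> j x - c) 0)
    + gagliardo s p (\<Omega> \<times> UNIV) (\<lambda>x. \<zeta> x * max (g x - c) 0 - \<zeta> x * max (\<psi> j x - c) 0)) \<longlonglongrightarrow> 0"
proof -
  have [measurable]: "\<zeta> \<in> borel_measurable borel"
  proof (intro borel_measurable_continuous_onI lipschitz_on_continuous_on lipschitz_onI)
    show "dist (\<zeta> x) (\<zeta> y) \<le> L * dist x y" for x y using \<zeta>lip[of x y] by (simp add: dist_norm)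
  qed (use L in auto)
  define D where "D j x = \<zeta> x * max (g x - c) 0 - \<zeta> x * max (\<psi> j x - c) 0" for j x
  have [measurable]: "D j \<in> borel_measurable borel" for j unfolding D_def by measurable
  have "(\<lambda>j. Lp_energy p \<Omega> (D j)) \<longlonglongrightarrow> 0"
  proof (rule tendsto_sandwich[OF _ _ tendsto_const])
    have "Lp_energy p \<Omega> (D j) \<le> Lp_energy p \<Omega> (\<lambda>x. g x - \<psi> j x)" for j
      unfolding Lp_energy_lborel
    proof (intro nn_integral_mono mult_right_mono ennreal_leI powr_mono2)
      fix x
      have "\<bar>D j x\<bar> = \<zeta> x * \<bar>max (g x - c) 0 - max (\<psi> j x - c) 0\<bar>"
        using \<zeta>01 by (simp add: D_def abs_mult flip: right_diff_distrib)
      also have "\<dots> \<le> 1 * \<bar>max (g x - c) 0 - max (\<psi> j x - c) 0\<bar>" using \<zeta>01 by (intro mult_right_mono) auto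
      also have "\<dots> \<le> \<bar>g x - \<psi> j x\<bar>" by (auto simp: max_def)
      finally show "\<bar>D j x\<bar> \<le> \<bar>g x - \<psi> j x\<bar>" .
    qed (use p in auto)
    from order_trans[OF this close(1)]
    show "eventually (\<lambda>j. Lp_energy p \<Omega> (D j) \<le> ennreal ((1 / 2) ^ j)) sequentially" by simp
    have "(\<lambda>j. ennreal ((1 / 2) ^ j)) \<longlonglongrightarrow> ennreal 0"
      by (intro tendsto_ennrealI LIMSEQ_power_zero) auto
    then show "(\<lambda>j. ennreal ((1 / 2) ^ j)) \<longlonglongrightarrow> 0" by simp
  qed simp
  moreover have "(\<lambda>j. gagliardo s p (\<Omega> \<times> UNIV) (D j)) \<longlonglongrightarrow> 0"
  proof -
    let ?f = "\<lambda>j z. ennreal (\<bar>D j (fst z) - D j (snd z)\<bar> powr p * frac_kernel s p (fst z) (snd z)) * indicator (\<Omega> \<times> UNIV) z"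
    let ?w = "\<lambda>z. ennreal (2 powr p) * (2 * majorant L z * indicator (\<Omega> \<times> UNIV) z)"
    have "(\<lambda>j. \<integral>\<^sup>+z. ?f j z \<partial>lborel) \<longlonglongrightarrow> (\<integral>\<^sup>+z. 0 \<partial>(lborel :: ('a \<times> 'a) measure))"
    proof (rule nn_integral_dominated_convergence[where w = ?w])
      show "?f j \<in> borel_measurable lborel" for j by measurable
      show "?w \<in> borel_measurable lborel" by measurable
      show "(\<lambda>_. 0) \<in> borel_measurable (lborel :: ('a \<times> 'a) measure)" by measurable
      show "AE z in lborel. ?f j z \<le> ?w z" for j
      proof (rule AE_I2)
        fix z :: "'a \<times> 'a"
        obtain x y where z: "z = (x, y)" by force
        let ?a = "\<bar>\<zeta> x * max (g x - c) 0 - \<zeta> y * max (g y - c) 0\<bar>"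
        let ?b = "\<bar>\<zeta> x * max (\<psi> j x - c) 0 - \<zeta> y * max (\<psi> j y - c) 0\<bar>"
        have "\<bar>(t1 - t2) - (t3 - t4)\<bar> \<le> \<bar>t1 - t3\<bar> + \<bar>t2 - t4\<bar>" for t1 t2 t3 t4 :: real by arith
        then have "\<bar>D j x - D j y\<bar> \<le> ?a + ?b" unfolding D_def .
        then have "\<bar>D j x - D j y\<bar> powr p \<le> (?a + ?b) powr p" using p by (intro powr_mono2) auto
        also have "\<dots> \<le> 2 powr p * (?a powr p + ?b powr p)" using p by (intro powr_add_le) auto
        finally have "\<bar>D j x - D j y\<bar> powr p * frac_kernel s p x y \<le> 2 powr p * (?a powr p + ?b powr p) * frac_kernel s p x y"
          by (intro mult_right_mono) auto
        then have "ennreal (\<bar>D j x - D j y\<bar> powr p * frac_kernel s p x y)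
          \<le> ennreal (2 powr p * (?a powr p * frac_kernel s p x y + ?b powr p * frac_kernel s p x y))"
          by (intro ennreal_leI) (simp add: algebra_simps)
        also have "\<dots> = ennreal (2 powr p) * (ennreal (?a powr p * frac_kernel s p x y) + ennreal (?b powr p * frac_kernel s p x y))"
          by (simp add: ennreal_mult)
        also have "\<dots> \<le> ennreal (2 powr p) * (majorant L z + majorant L z)"
          unfolding z by (intro mult_left_mono add_mono cutoff_difference_le_majorant[of _ j]) auto
        finally have "ennreal (\<bar>D j x - D j y\<bar> powr p * frac_kernel s p x y) \<le> ennreal (2 powr p) * (2 * majorant L z)"
          by (simp add: mult_2)
        then show "?f j z \<le> ?w z" by (auto simp: z indicator_def)
      qed
      have "(\<integral>\<^sup>+z. ?w z \<partial>lborel) = ennreal (2 powr p) * (2 * (\<integral>\<^sup>+z\<in>\<Omega> \<times> UNIV. majorant L z \<partial>lborel))"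
        by (simp add: nn_integral_cmult mult.assoc)
      then show "(\<integral>\<^sup>+z. ?w z \<partial>lborel) < \<infinity>" using majorant_finite[OF L] by (simp add: ennreal_mult_less_top)
      have "AE x in lborel. (\<lambda>j. D j x) \<longlonglongrightarrow> 0" using AE_convergence
      proof eventually_elim
        fix x assume "(\<lambda>j. \<psi> j x) \<longlonglongrightarrow> g x"
        then have "(\<lambda>j. D j x) \<longlonglongrightarrow> \<zeta> x * max (g x - c) 0 - \<zeta> x * max (g x - c) 0"
          unfolding D_def by (intro tendsto_intros)
        then show "(\<lambda>j. D j x) \<longlonglongrightarrow> 0" by simp
      qed
      from AE_lborel_fst[OF this] AE_lborel_snd[OF this]
      show "AE z in lborel. (\<lambda>j. ?f j z) \<longlonglongrightarrow> 0"
      proof eventually_elim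
        fix z :: "'a \<times> 'a"
        assume "(\<lambda>j. D j (fst z)) \<longlonglongrightarrow> 0" "(\<lambda>j. D j (snd z)) \<longlonglongrightarrow> 0"
        then have "(\<lambda>j. \<bar>D j (fst z) - D j (snd z)\<bar>) \<longlonglongrightarrow> \<bar>0 - 0\<bar>" by (intro tendsto_intros)
        then have "(\<lambda>j. \<bar>D j (fst z) - D j (snd z)\<bar> powr p) \<longlonglongrightarrow> 0 powr p"
          using p by (intro tendsto_powr') auto
        then have "(\<lambda>j. \<bar>D j (fst z) - D j (snd z)\<bar> powr p * frac_kernel s p (fst z) (snd z)) \<longlonglongrightarrow> 0 powr p * frac_kernel s p (fst z) (snd z)"
          by (intro tendsto_mult tendsto_const)
        from tendsto_ennrealI[OF this] show "(\<lambda>j. ?f j z) \<longlonglongrightarrow> 0"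
          by (auto simp: indicator_def)
      qed
    qed
    then show ?thesis by (simp add: gagliardo_lborel)
  qed
  ultimately have "(\<lambda>j. Lp_energy p \<Omega> (D j) + gagliardo s p (\<Omega> \<times> UNIV) (D j)) \<longlonglongrightarrow> 0 + 0"
    by (rule tendsto_add)
  then show ?thesis by (simp add: D_def[abs_def])
qed

lemma cutoff_Lipschitz_compact:
  assumes "K-lipschitz_on UNIV (\<psi> j)" "compact (supp (\<psi> j))"
  defines "f \<equiv> \<lambda>x. \<zeta> x * max (\<psi> j x - c) 0"
  shows "\<exists>K. K-lipschitz_on UNIV f" "supp f \<subseteq> supp (\<psi> j)" "compact (supp f)"
proof -
  obtain N where N: "0 \<le> N" "\<And>x. \<bar>\<psi> j x\<bar> \<le> N" using Lipschitz_compact_supp_bounded[OF assms(1,2)] by auto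
  have "(K + N * L)-lipschitz_on UNIV f"
  proof (rule lipschitz_onI)
    fix x y
    have "\<bar>f x - f y\<bar> \<le> \<bar>\<psi> j x - \<psi> j y\<bar> + \<bar>\<psi> j x\<bar> * \<bar>\<zeta> x - \<zeta> y\<bar>"
      unfolding f_def using \<zeta>01 c by (intro cutoff_truncation_difference) auto
    also have "\<dots> \<le> K * dist x y + N * (L * norm (x - y))"
      using lipschitz_onD[OF assms(1), of x y] N \<zeta>lip[of x y]
      by (intro add_mono mult_mono) (auto simp: dist_real_def)
    finally show "dist (f x) (f y) \<le> (K + N * L) * dist x y"
      by (simp add: dist_real_def dist_norm algebra_simps)
  qed (use lipschitz_on_nonneg[OF assms(1)] N L in auto)
  then show "\<exists>K. K-lipschitz_on UNIV f" ..
  have "{x. f x \<noteq> 0} \<subseteq> {x. \<psi> j x \<noteq> 0}" using c by (auto simp: f_def max_def split: if_splits)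
  then show sub: "supp f \<subseteq> supp (\<psi> j)" unfolding supp_def by (rule closure_mono)
  have "closed (supp f)" by (simp add: supp_def)
  from compact_Int_closed[OF assms(2) this] show "compact (supp f)" using sub by (simp add: Int_absorb1)
qed

text \<open>Second extension of the weak inequality, from Lipschitz functions to limits in V. The
  support condition concerns only the products with the approximants: neither the cutoff nor the
  limit has to have compact support in \<Omega>.\<close>

lemma tested_cutoff_truncation:
  assumes \<Lambda>: "1 \<le> \<Lambda>"
    and um: "u \<in> borel_measurable borel" and u: "gagliardo s p (\<Omega> \<times> UNIV) u < \<infinity>"
    and kb: "kernel_bounds s p \<Lambda> k"
    and test: "\<And>\<phi>. \<phi> \<in> test_functions \<Omega> \<Longrightarrow> (\<And>x. 0 \<le> \<phi> x) \<Longrightarrow>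
      (\<integral>\<^sup>+z. ennreal (energy_diff p u \<phi> (fst z) (snd z)) * k z \<partial>lborel)
       \<le> (\<integral>\<^sup>+z. ennreal (- energy_diff p u \<phi> (fst z) (snd z)) * k z \<partial>lborel)"
    and \<psi>: "\<And>j. \<exists>K. K-lipschitz_on UNIV (\<psi> j)" "\<And>j. compact (supp (\<psi> j))"
    and sub: "\<And>j. supp (\<lambda>x. \<zeta> x * max (\<psi> j x - c) 0) \<subseteq> \<Omega>"
  shows "tested p k u (\<lambda>x. \<zeta> x * max (g x - c) 0)"
proof -
  define f where "f j x = \<zeta> x * max (\<psi> j x - c) 0" for j x
  have f: "\<exists>K. K-lipschitz_on UNIV (f j)" "compact (supp (f j))" "supp (f j) \<subseteq> \<Omega>" for j
    using cutoff_Lipschitz_compact[of _ j] \<psi>[of j] sub[of j] unfolding f_def by blast+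
  have [measurable]: "\<zeta> \<in> borel_measurable borel"
  proof (intro borel_measurable_continuous_onI lipschitz_on_continuous_on lipschitz_onI)
    show "dist (\<zeta> x) (\<zeta> y) \<le> L * dist x y" for x y using \<zeta>lip[of x y] by (simp add: dist_norm)
  qed (use L in auto)
  show ?thesis
  proof (rule tested_limit[where v = f and b = "majorant L", OF p \<Lambda> \<Omega>(1) um u kb])
    show "f j \<in> borel_measurable borel" for j unfolding f_def by measurable
    show "(\<lambda>x. \<zeta> x * max (g x - c) 0) \<in> borel_measurable borel" by measurable
    show "f j x = 0" if "x \<notin> \<Omega>" for j x using f(3)[of j] that by (intro supp_outside) auto
    show "AE x in lborel. (\<lambda>j. f j x) \<longlonglongrightarrow> \<zeta> x * max (g x - c) 0"
      using AE_convergence by eventually_elim (auto simp: f_def intro!: tendsto_intros)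
    show "majorant L \<in> borel_measurable borel" by measurable
    show "(\<integral>\<^sup>+z\<in>\<Omega> \<times> UNIV. majorant L z \<partial>lborel) < \<infinity>" by (rule majorant_finite[OF L])
    show "ennreal (\<bar>f j x - f j y\<bar> powr p * frac_kernel s p x y) \<le> majorant L (x, y)" for j x y
      unfolding f_def by (rule cutoff_difference_le_majorant[of _ j]) simp
    show "(\<integral>\<^sup>+z. ennreal (energy_diff p u (f j) (fst z) (snd z)) * k z \<partial>lborel)
       \<le> (\<integral>\<^sup>+z. ennreal (- energy_diff p u (f j) (fst z) (snd z)) * k z \<partial>lborel)" for j
    proof -
      obtain K where "K-lipschitz_on UNIV (f j)" using f(1) by blast
      from tested_Lipschitz[OF s p \<Lambda> \<Omega>(1) um u kb test this f(2,3)]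
      show ?thesis using \<zeta>01 by (simp add: tested_def f_def)
    qed
  qed
qed

end

end

subsection \<open>Suprema in the sense of V\<close>

lemma max_ereal_zero: "max (ereal a) 0 = ereal (max a 0)"
  by (cases "a \<le> 0") (auto simp: max_def)

lemma epowr_ennreal: "0 \<le> t \<Longrightarrow> epowr (ennreal t) a = ennreal (t powr a)"
  by (simp add: epowr_def)

lemma epowr_top [simp]: "epowr top a = top"
  by (simp add: epowr_def)

lemma epowr_root_eq:
  assumes "0 < a" "0 \<le> t" "epowr Y (1 / a) = ennreal t"
  shows "Y = ennreal (t powr a)"
proof (cases Y)
  case (real y)
  then have "ennreal (y powr (1 / a)) = ennreal t" using assms by (simp add: epowr_ennreal)
  then have "y powr (1 / a) = t" using assms by (simp add: ennreal_inj)
  then have "t powr a = y" using real assms by (auto simp: powr_powr)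
  then show ?thesis using real by simp
qed (use assms in simp)

lemma energy_finite_diff:
  fixes f h :: "'a::euclidean_space \<Rightarrow> real"
  assumes p: "0 \<le> p" and \<Omega>: "open \<Omega>"
    and [measurable]: "f \<in> borel_measurable borel" "h \<in> borel_measurable borel"
    and "Lp_energy p \<Omega> f < \<infinity>" "gagliardo s p (\<Omega> \<times> UNIV) f < \<infinity>"
    and "Lp_energy p \<Omega> h < \<infinity>" "gagliardo s p (\<Omega> \<times> UNIV) h < \<infinity>"
  shows "Lp_energy p \<Omega> (\<lambda>x. f x - h x) < \<infinity>" "gagliardo s p (\<Omega> \<times> UNIV) (\<lambda>x. f x - h x) < \<infinity>"
proof -
  have [measurable]: "\<Omega> \<in> sets borel" "\<Omega> \<times> (UNIV :: 'a set) \<in> sets borel"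
    using \<Omega> by (auto intro: borel_open open_Times)
  have pw: "\<bar>a - b\<bar> powr p \<le> 2 powr p * (\<bar>a\<bar> powr p + \<bar>b\<bar> powr p)" for a b :: real
  proof -
    have "\<bar>a - b\<bar> powr p \<le> (\<bar>a\<bar> + \<bar>b\<bar>) powr p" using p by (intro powr_mono2) auto
    also have "\<dots> \<le> 2 powr p * (\<bar>a\<bar> powr p + \<bar>b\<bar> powr p)" using p by (intro powr_add_le) auto
    finally show ?thesis .
  qed
  have "Lp_energy p \<Omega> (\<lambda>x. f x - h x)
    \<le> (\<integral>\<^sup>+x. ennreal (2 powr p) * (ennreal (\<bar>f x\<bar> powr p) * indicator \<Omega> x + ennreal (\<bar>h x\<bar> powr p) * indicator \<Omega> x) \<partial>lborel)"
    unfolding Lp_energy_lborel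
  proof (intro nn_integral_mono)
    fix x
    have "ennreal (\<bar>f x - h x\<bar> powr p) \<le> ennreal (2 powr p) * (ennreal (\<bar>f x\<bar> powr p) + ennreal (\<bar>h x\<bar> powr p))"
      using pw[of "f x" "h x"] by (simp add: ennreal_leI flip: ennreal_plus ennreal_mult)
    then show "ennreal (\<bar>f x - h x\<bar> powr p) * indicator \<Omega> x
      \<le> ennreal (2 powr p) * (ennreal (\<bar>f x\<bar> powr p) * indicator \<Omega> x + ennreal (\<bar>h x\<bar> powr p) * indicator \<Omega> x)"
      by (auto simp: indicator_def)
  qed
  also have "\<dots> = ennreal (2 powr p) * (Lp_energy p \<Omega> f + Lp_energy p \<Omega> h)"
    unfolding Lp_energy_lborel by (simp add: nn_integral_cmult nn_integral_add)
  also have "\<dots> < \<infinity>" using assms by (simp add: ennreal_mult_less_top)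
  finally show "Lp_energy p \<Omega> (\<lambda>x. f x - h x) < \<infinity>" .
  let ?q = "\<lambda>f z. ennreal (\<bar>f (fst z) - f (snd z)\<bar> powr p * frac_kernel s p (fst z) (snd z)) * indicator (\<Omega> \<times> UNIV) z"
  have "gagliardo s p (\<Omega> \<times> UNIV) (\<lambda>x. f x - h x) \<le> (\<integral>\<^sup>+z. ennreal (2 powr p) * (?q f z + ?q h z) \<partial>lborel)"
    unfolding gagliardo_lborel
  proof (intro nn_integral_mono)
    fix z :: "'a \<times> 'a"
    obtain x y where z: "z = (x, y)" by force
    let ?K = "frac_kernel s p x y"
    have "\<bar>(f x - h x) - (f y - h y)\<bar> powr p * ?K \<le> 2 powr p * (\<bar>f x - f y\<bar> powr p + \<bar>h x - h y\<bar> powr p) * ?K"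
      using pw[of "f x - f y" "h x - h y"] by (intro mult_right_mono) (auto simp: algebra_simps)
    then have "ennreal (\<bar>(f x - h x) - (f y - h y)\<bar> powr p * ?K)
      \<le> ennreal (2 powr p * (\<bar>f x - f y\<bar> powr p * ?K + \<bar>h x - h y\<bar> powr p * ?K))"
      by (intro ennreal_leI) (simp add: algebra_simps)
    also have "\<dots> = ennreal (2 powr p) * (ennreal (\<bar>f x - f y\<bar> powr p * ?K) + ennreal (\<bar>h x - h y\<bar> powr p * ?K))"
      by (simp add: ennreal_mult)
    finally show "ennreal (\<bar>f (fst z) - h (fst z) - (f (snd z) - h (snd z))\<bar> powr p * frac_kernel s p (fst z) (snd z)) * indicator (\<Omega> \<times> UNIV) z
      \<le> ennreal (2 powr p) * (?q f z + ?q h z)"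
      by (auto simp: z indicator_def)
  qed
  also have "\<dots> = ennreal (2 powr p) * (gagliardo s p (\<Omega> \<times> UNIV) f + gagliardo s p (\<Omega> \<times> UNIV) h)"
    unfolding gagliardo_lborel by (simp add: nn_integral_cmult nn_integral_add)
  also have "\<dots> < \<infinity>" using assms by (simp add: ennreal_mult_less_top)
  finally show "gagliardo s p (\<Omega> \<times> UNIV) (\<lambda>x. f x - h x) < \<infinity>" .
qed

text \<open>The geometric rate is obtained here, once, by selecting indices. Since the energies
  ignore null sets, g may be any Borel function that agrees with the positive part almost
  everywhere.\<close>

lemma fast_V_approximation_of_V_le0_on:
  fixes \<Omega> T :: "'a::euclidean_space set"
  assumes s: "0 < s" "s < 1" and p: "1 < p" and \<Omega>: "open \<Omega>" "\<Omega> \<noteq> {}"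
    and le: "V_le0_on s p \<Omega> T f" and gm [measurable]: "g \<in> borel_measurable borel"
    and g: "AE x in lborel. ereal (g x) = max (f x) 0"
  obtains \<psi> where "fast_V_approximation s p \<Omega> g \<psi>" "\<And>j. \<exists>K. K-lipschitz_on UNIV (\<psi> j)"
    "\<And>j. compact (supp (\<psi> j))" "\<And>j. supp (\<psi> j) \<subseteq> - T"
proof -
  obtain h \<phi> where h: "h \<in> V_space s p \<Omega>" "\<And>x. ereal (h x) = max (f x) 0"
    and \<phi>: "\<And>j. \<phi> j \<in> V_space s p \<Omega>" "\<And>j. \<exists>L. L-lipschitz_on UNIV (\<phi> j)" "\<And>j. compact (supp (\<phi> j))" "\<And>j. supp (\<phi> j) \<subseteq> - T"
    and lim: "(\<lambda>j::nat. V_norm s p \<Omega> (\<lambda>x. h x - \<phi> j x)) \<longlonglongrightarrow> 0"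
    using le unfolding V_le0_on_def by blast
  have gh: "AE x in lborel. h x = g x"
    using g by eventually_elim (simp add: h(2)[symmetric])
  have \<phi>m [measurable]: "\<phi> j \<in> borel_measurable borel" for j
    using \<phi>(2)[of j] by (auto intro: borel_measurable_continuous_onI lipschitz_on_continuous_on)
  have gfin: "Lp_energy p \<Omega> g < \<infinity>" "gagliardo s p (\<Omega> \<times> UNIV) g < \<infinity>"
    using h(1) Lp_energy_cong_AE[OF gh, of p \<Omega>] gagliardo_cong_AE[OF gh, of s p "\<Omega> \<times> UNIV"]
    by (auto simp: V_space_def)
  define E where "E j = Lp_energy p \<Omega> (\<lambda>x. g x - \<phi> j x) + gagliardo s p (\<Omega> \<times> UNIV) (\<lambda>x. g x - \<phi> j x)" for j
  \<comment> \<open>\<open>V_norm\<close> passes through \<open>enn2real\<close>, which sends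
    infinity to 0; a small norm means small energy only once finiteness is known.\<close>
  have Efin: "E j < \<infinity>" for j
    unfolding E_def using p \<phi>(1)[of j] gfin energy_finite_diff[OF _ \<Omega>(1) gm \<phi>m gfin, of j]
    by (simp add: V_space_def)
  have "AE x in lborel. h x - \<phi> j x = g x - \<phi> j x" for j using gh by eventually_elim simp
  then have norm: "V_norm s p \<Omega> (\<lambda>x. h x - \<phi> j x) = enn2real (E j) powr (1 / p)" for j
    unfolding V_norm_def E_def
    by (simp only: Lp_energy_cong_AE[of "\<lambda>x. h x - \<phi> j x" "\<lambda>x. g x - \<phi> j x"]
        gagliardo_cong_AE[of "\<lambda>x. h x - \<phi> j x" "\<lambda>x. g x - \<phi> j x"])
  have ex: "\<exists>j. E j \<le> ennreal \<epsilon>" if "0 < \<epsilon>" for \<epsilon>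
  proof -
    have "0 < \<epsilon> powr (1 / p)" using that by simp
    from order_tendstoD(2)[OF lim this] obtain j where "V_norm s p \<Omega> (\<lambda>x. h x - \<phi> j x) < \<epsilon> powr (1 / p)"
      using eventually_happens'[OF sequentially_bot] by blast
    then have "enn2real (E j) powr (1 / p) < \<epsilon> powr (1 / p)" by (simp add: norm)
    then have "\<not> \<epsilon> powr (1 / p) \<le> enn2real (E j) powr (1 / p)" by simp
    then have "\<not> \<epsilon> \<le> enn2real (E j)" using p that powr_mono2[of "1 / p" \<epsilon> "enn2real (E j)"] by auto
    then have "ennreal (enn2real (E j)) \<le> ennreal \<epsilon>" by (intro ennreal_leI) simp
    moreover have "E j = ennreal (enn2real (E j))" using Efin[of j] by simp
    ultimately have "E j \<le> ennreal \<epsilon>" by (simp only:)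
    then show ?thesis ..
  qed
  have "\<forall>i. \<exists>j. E j \<le> ennreal ((1 / 2) ^ i)" by (intro allI ex) simp
  then obtain r where r: "\<And>i. E (r i) \<le> ennreal ((1 / 2) ^ i)" by metis
  show ?thesis
  proof (rule that[of "\<lambda>i. \<phi> (r i)"])
    show "fast_V_approximation s p \<Omega> g (\<lambda>i. \<phi> (r i))"
    proof
      show "Lp_energy p \<Omega> (\<lambda>x. g x - \<phi> (r j) x) \<le> ennreal ((1 / 2) ^ j)" for j
        using order_trans[OF _ r[of j]] by (simp add: E_def)
      show "gagliardo s p (\<Omega> \<times> UNIV) (\<lambda>x. g x - \<phi> (r j) x) \<le> ennreal ((1 / 2) ^ j)" for j
        using order_trans[OF _ r[of j]] by (simp add: E_def)
    qed (use s p \<Omega> gm \<phi>m gfin in auto)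
  qed (use \<phi> in auto)
qed

lemma truncation_V_space:
  assumes u: "u \<in> V_space s p \<Omega>" and p: "0 \<le> p" and \<kappa>: "0 \<le> \<kappa>"
  shows "(\<lambda>x. max (u x - \<kappa>) 0) \<in> V_space s p \<Omega>"
proof -
  have um [measurable]: "u \<in> borel_measurable lebesgue" using u by (simp add: V_space_def)
  have "Lp_energy p \<Omega> (\<lambda>x. max (u x - \<kappa>) 0) \<le> Lp_energy p \<Omega> u"
    unfolding Lp_energy_lborel using p \<kappa>
    by (intro nn_integral_mono mult_right_mono ennreal_leI powr_mono2) auto
  moreover have "gagliardo s p (\<Omega> \<times> UNIV) (\<lambda>x. max (u x - \<kappa>) 0) \<le> gagliardo s p (\<Omega> \<times> UNIV) u"
    unfolding gagliardo_lborel using p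
    by (intro nn_integral_mono mult_right_mono ennreal_leI powr_mono2) (auto simp: max_def)
  moreover have "(\<lambda>x. max (u x - \<kappa>) 0) \<in> borel_measurable lebesgue" by measurable
  ultimately show ?thesis using u by (auto simp: V_space_def intro: le_less_trans)
qed

text \<open>The cutoff \<zeta> is 0 on the ball of radius R/2 and 1 outside that of radius 3R/4. As
  u <= \<kappa> almost everywhere in the larger ball, multiplication by \<zeta> does not change the
  truncation of u at \<kappa>, whereas it removes the approximants from the smaller ball.\<close>

lemma (in fast_V_approximation) V_le0_on_ball:
  assumes u: "u \<in> V_space s p \<Omega>" and \<kappa>: "0 \<le> \<kappa>" "m \<le> \<kappa>" and R: "0 < R" and c: "0 \<le> c"
    and \<psi>: "\<And>j. \<exists>K. K-lipschitz_on UNIV (\<psi> j)" "\<And>j. compact (supp (\<psi> j))"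
    and ug: "AE x in lborel. max (u x - \<kappa>) 0 = max (g x - c) 0"
    and small: "AE x in lborel. x \<in> ball x0 (3 * R / 4) \<longrightarrow> u x \<le> \<kappa>"
  shows "V_le0_on s p \<Omega> (ball x0 (R / 2)) (\<lambda>x. ereal (max (u x) m) - ereal \<kappa>)"
proof -
  define \<zeta> where "\<zeta> x = 1 - max 0 (min 1 ((3 * R / 4 - dist x0 x) / (R / 4)))" for x
  have \<zeta>01: "0 \<le> \<zeta> x" "\<zeta> x \<le> 1" for x by (auto simp: \<zeta>_def)
  have \<zeta>lip: "\<bar>\<zeta> x - \<zeta> y\<bar> \<le> 4 / R * norm (x - y)" for x y
  proof -
    let ?A = "\<lambda>x. max 0 (min 1 ((3 * R / 4 - dist x0 x) / (R / 4)))"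
    have "\<bar>\<zeta> x - \<zeta> y\<bar> = \<bar>?A x - ?A y\<bar>" unfolding \<zeta>_def by linarith
    also have "\<dots> \<le> norm (x - y) / (R / 4)" using R by (intro cutoff_Lipschitz) simp
    also have "\<dots> = 4 / R * norm (x - y)" by simp
    finally show ?thesis .
  qed
  have L: "0 < 4 / R" using R by simp
  have \<zeta>0: "\<zeta> x = 0" if "x \<in> ball x0 (R / 2)" for x
  proof -
    have "1 \<le> (3 * R / 4 - dist x0 x) / (R / 4)" using that R by (simp add: le_divide_eq)
    then show ?thesis by (simp add: \<zeta>_def)
  qed
  have \<zeta>1: "\<zeta> x = 1" if "x \<notin> ball x0 (3 * R / 4)" for x
  proof -
    have "(3 * R / 4 - dist x0 x) / (R / 4) \<le> 0" using that R by (intro divide_nonpos_pos) auto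
    then show ?thesis by (simp add: \<zeta>_def)
  qed
  \<comment> \<open>Built from u itself and not from its Borel representative, because
    \<open>V_le0_on\<close> demands equality at every point.\<close>
  define w where "w x = max (u x - \<kappa>) 0" for x
  define f where "f j x = \<zeta> x * max (\<psi> j x - c) 0" for j x
  have w: "AE x in lborel. w x = \<zeta> x * max (g x - c) 0"
    using ug small
  proof eventually_elim
    case (elim x)
    show ?case
    proof (cases "x \<in> ball x0 (3 * R / 4)")
      case True
      then have "w x = 0" using elim by (simp add: w_def)
      then show ?thesis using elim by (simp add: w_def)
    next
      case False
      then show ?thesis using elim \<zeta>1 by (simp add: w_def)
    qed
  qed
  have f: "\<exists>K. K-lipschitz_on UNIV (f j)" "compact (supp (f j))" for j
    using cutoff_Lipschitz_compact[OF \<zeta>01 \<zeta>lip L c, of _ j] \<psi>[of j] unfolding f_def by blast+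
  show ?thesis
    unfolding V_le0_on_def
  proof (intro bexI[of _ w] conjI exI[of _ f] allI)
    show "w \<in> V_space s p \<Omega>" unfolding w_def using truncation_V_space[OF u] p \<kappa> by simp
    show "ereal (w x) = max (ereal (max (u x) m) - ereal \<kappa>) 0" for x
    proof -
      have "max (max (u x) m - \<kappa>) 0 = w x" using \<kappa> by (auto simp: w_def max_def)
      then show ?thesis by (simp only: ereal_minus(1) max_ereal_zero)
    qed
    show "f j \<in> V_space s p \<Omega>" for j using f[of j] Lipschitz_compact_supp_V_space[OF s p] by blast
    show "\<exists>L. L-lipschitz_on UNIV (f j)" "compact (supp (f j))" for j by (rule f)+
    \<comment> \<open>The complement of the open ball is closed, so vanishing on the ball bounds the
      closed support as well.\<close>
    have "supp (f j) \<subseteq> - ball x0 (R / 2)" for j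
      unfolding supp_def using \<zeta>0 by (intro closure_minimal) (auto simp: f_def)
    then show "supp (f j) \<subseteq> - ball x0 (R / 2)" for j .
    define E where "E j = Lp_energy p \<Omega> (\<lambda>x. \<zeta> x * max (g x - c) 0 - f j x)
      + gagliardo s p (\<Omega> \<times> UNIV) (\<lambda>x. \<zeta> x * max (g x - c) 0 - f j x)" for j
    have "E \<longlonglongrightarrow> 0"
      using cutoff_energy_tendsto[OF \<zeta>01 \<zeta>lip L c] by (simp add: E_def[abs_def] f_def)
    then have "(\<lambda>j. E j) \<longlonglongrightarrow> ennreal 0" by simp
    from tendsto_enn2real[OF this] have "(\<lambda>j. enn2real (E j)) \<longlonglongrightarrow> 0" by simp
    then have "(\<lambda>j. enn2real (E j) powr (1 / p)) \<longlonglongrightarrow> 0 powr (1 / p)"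
      using p by (intro tendsto_powr') auto
    moreover have "V_norm s p \<Omega> (\<lambda>x. w x - f j x) = enn2real (E j) powr (1 / p)" for j
    proof -
      have "AE x in lborel. w x - f j x = \<zeta> x * max (g x - c) 0 - f j x" using w by eventually_elim simp
      then show ?thesis unfolding V_norm_def E_def
        by (simp only: Lp_energy_cong_AE[of "\<lambda>x. w x - f j x" "\<lambda>x. \<zeta> x * max (g x - c) 0 - f j x"]
            gagliardo_cong_AE[of "\<lambda>x. w x - f j x" "\<lambda>x. \<zeta> x * max (g x - c) 0 - f j x"])
    qed
    ultimately show "(\<lambda>j. V_norm s p \<Omega> (\<lambda>x. w x - f j x)) \<longlonglongrightarrow> 0" by simp
  qed
qed

text \<open>For empty \<Omega> the V norm vanishes identically and every inequality on T holds; the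
  case is separate because \<open>fast_V_approximation\<close> requires a point in \<Omega>.\<close>

lemma V_le0_on_empty:
  fixes T :: "'a::euclidean_space set" and f :: "'a \<Rightarrow> real"
  assumes "0 < p" "f \<in> borel_measurable lebesgue"
  shows "V_le0_on s p {} T (\<lambda>x. ereal (f x))"
proof -
  have V: "v \<in> V_space s p {}" if "v \<in> borel_measurable lebesgue" for v :: "'a \<Rightarrow> real"
    using that by (simp add: V_space_def Lp_energy_def gagliardo_def)
  have N: "V_norm s p {} v = 0" for v :: "'a \<Rightarrow> real"
    by (simp add: V_norm_def Lp_energy_def gagliardo_def)
  show ?thesis unfolding V_le0_on_def
  proof (intro bexI[of _ "\<lambda>x. max (f x) 0"] conjI exI[of _ "\<lambda>_ _. 0"] allI)
    show "ereal (max (f x) 0) = max (ereal (f x)) 0" for x by (rule max_ereal_zero[symmetric])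
    show "\<exists>L. L-lipschitz_on UNIV (\<lambda>_::'a. 0::real)" by (intro exI[of _ 0] lipschitz_onI) auto
    show "(\<lambda>x. max (f x) 0) \<in> V_space s p {}" using assms by (intro V) measurable
  qed (auto simp: V N supp_def)
qed

section \<open>Borel representatives, the weak inequality, and the finite form of tail and
  mean\<close>

lemma admissible_kernel_Borel:
  fixes k :: "'a::euclidean_space \<Rightarrow> 'a \<Rightarrow> ennreal"
  assumes "admissible_kernel s p \<Lambda> k"
  obtains k' where "kernel_bounds s p \<Lambda> k'" "AE z in lborel. k (fst z) (snd z) = k' z"
proof -
  have "(\<lambda>z. k (fst z) (snd z)) \<in> borel_measurable lebesgue" using assms by (simp add: admissible_kernel_def)
  from completion_ex_borel_measurable[OF this] obtain k'
    where k': "k' \<in> borel_measurable lborel" "AE z in lborel. k (fst z) (snd z) = k' z" by blast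
  have "AE z in lborel. fst z \<noteq> snd z \<longrightarrow>
        ennreal (inverse \<Lambda> * frac_kernel s p (fst z) (snd z)) \<le> k' z \<and>
        k' z \<le> ennreal (\<Lambda> * frac_kernel s p (fst z) (snd z))"
    using k'(2)
  proof eventually_elim
    case (elim z)
    show ?case unfolding elim[symmetric] using assms by (simp add: admissible_kernel_def frac_kernel_def)
  qed
  then show ?thesis using k' by (intro that[of k']) (auto simp: kernel_bounds_def)
qed

text \<open>Passing from -u to u exchanges the positive and negative parts of the energy, so the
  supersolution inequality for -u becomes the stated order of the two integrals, now for
  representatives of u and k.\<close>

lemma subsolution_test:
  fixes u u' :: "'a::euclidean_space \<Rightarrow> real"
  assumes sub: "weak_subsolution s p k \<Omega> u" and \<phi>: "\<phi> \<in> test_functions \<Omega>" "\<And>x. 0 \<le> \<phi> x"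
    and u': "AE x in lborel. u x = u' x" and k': "AE z in lborel. k (fst z) (snd z) = k' z"
  shows "(\<integral>\<^sup>+z. ennreal (energy_diff p u' \<phi> (fst z) (snd z)) * k' z \<partial>lborel)
     \<le> (\<integral>\<^sup>+z. ennreal (- energy_diff p u' \<phi> (fst z) (snd z)) * k' z \<partial>lborel)" (is "?b \<le> ?a")
proof -
  have ae: "AE z in lborel. energy_diff p (\<lambda>x. - u x) \<phi> (fst z) (snd z) = - energy_diff p u' \<phi> (fst z) (snd z)
      \<and> k (fst z) (snd z) = k' z"
    using AE_lborel_fst[OF u'] AE_lborel_snd[OF u'] k'
  proof eventually_elim
    case (elim z)
    have "\<bar>- x + y\<bar> = \<bar>x - y\<bar>" for x y :: real by simp
    then show ?case using elim by (simp add: energy_diff_def algebra_simps)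
  qed
  have a: "(\<integral>\<^sup>+z. ennreal (energy_diff p (\<lambda>x. - u x) \<phi> (fst z) (snd z)) * k (fst z) (snd z) \<partial>lborel) = ?a"
    by (rule nn_integral_cong_AE) (use ae in \<open>eventually_elim, simp\<close>)
  have b: "(\<integral>\<^sup>+z. ennreal (- energy_diff p (\<lambda>x. - u x) \<phi> (fst z) (snd z)) * k (fst z) (snd z) \<partial>lborel) = ?b"
    by (rule nn_integral_cong_AE) (use ae in \<open>eventually_elim, simp\<close>)
  have "0 \<le> energy p k (\<lambda>x. - u x) \<phi>"
    using sub \<phi> by (simp add: weak_subsolution_def weak_supersolution_def)
  then have ge: "0 \<le> enn2ereal ?a - enn2ereal ?b"
    unfolding energy_def nn_integral_completion a b .
  show ?thesis
  \<comment> \<open>If a is infinite, the extended difference says nothing about b, but the claim is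
    trivial. If a is finite, an infinite b would make the difference negative.\<close>
  proof (cases "?a = top")
    case False
    then have a': "\<bar>enn2ereal ?a\<bar> \<noteq> \<infinity>" by (cases ?a) (auto simp: enn2ereal_ennreal)
    have "enn2ereal ?b \<le> enn2ereal ?a"
    proof (cases "?b = top")
      case True
      then show ?thesis using ge a' by (cases "enn2ereal ?a") auto
    next
      case False
      then have "\<bar>enn2ereal ?b\<bar> \<noteq> \<infinity>" by (cases ?b) (auto simp: enn2ereal_ennreal)
      then show ?thesis using ge a' ereal_diff_positive[of "enn2ereal ?b" "enn2ereal ?a"]
        by (cases "enn2ereal ?a"; cases "enn2ereal ?b") auto
    qed
    then show ?thesis by (simp add: less_eq_ennreal.rep_eq)
  qed simp
qed

lemma powr_Lipschitz_unit:
  fixes a b p :: real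
  assumes "1 \<le> p" "0 \<le> a" "a \<le> 1" "0 \<le> b" "b \<le> 1"
  shows "\<bar>a powr p - b powr p\<bar> \<le> p * \<bar>a - b\<bar>"
proof -
  have *: "\<bar>a powr p - b powr p\<bar> \<le> p * \<bar>a - b\<bar>" if "0 \<le> b" "b \<le> a" "a \<le> 1" for a b
  proof -
    have "b powr p \<le> a powr p" using that assms(1) by (intro powr_mono2) auto
    moreover have "a powr p - b powr p \<le> p * a powr (p - 1) * (a - b)"
      using that assms(1) by (intro powr_tangent) auto
    moreover have "a powr (p - 1) \<le> 1" using that assms(1) powr_mono2[of "p - 1" a 1] by simp
    then have "p * a powr (p - 1) * (a - b) \<le> p * 1 * (a - b)"
      using that assms(1) by (intro mult_right_mono mult_left_mono) auto
    ultimately show ?thesis using that by simp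
  qed
  show ?thesis
  proof (cases "b \<le> a")
    case False
    then show ?thesis using *[of a b] assms by (simp add: abs_minus_commute)
  qed (use * assms in auto)
qed

text \<open>Excludes M = \<infinity> when the right-hand side of the estimate is finite: the
  truncation would be infinite everywhere, and the ball has positive measure.\<close>

lemma ball_mean_top:
  fixes x0 :: "'a::euclidean_space"
  assumes "0 < R"
  shows "ball_mean p (\<lambda>x. \<infinity>) x0 R = \<infinity>"
proof -
  have v: "0 < unit_ball_vol (real DIM('a)) * R ^ DIM('a)" using assms by simp
  have "emeasure lebesgue (ball x0 R) = ennreal (unit_ball_vol (real DIM('a)) * R ^ DIM('a))"
    using emeasure_ball[of R x0] assms by simp
  then have pos: "emeasure lebesgue (ball x0 R) \<noteq> 0"
    using v by (simp only: ennreal_eq_0_iff not_le)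
  have fin: "emeasure lebesgue (ball x0 R) \<noteq> top" using emeasure_ball[of R x0] assms by simp
  have "(\<integral>\<^sup>+x\<in>ball x0 R. epowr (e2ennreal \<infinity>) p \<partial>lebesgue) = top"
  proof -
    have "epowr (e2ennreal \<infinity>) p = top" by simp
    moreover have "(\<integral>\<^sup>+x\<in>ball x0 R. top \<partial>lebesgue) = top * emeasure lebesgue (ball x0 R)"
      by (rule nn_integral_cmult_indicator) simp
    ultimately show ?thesis using pos by (simp only: ennreal_top_mult if_False)
  qed
  then show ?thesis using fin by (simp add: ball_mean_def ennreal_top_divide)
qed

lemma set_nn_integral_of_Tail:
  fixes f :: "'a::euclidean_space \<Rightarrow> real"
  assumes "1 < p" "0 < r" "0 \<le> \<tau>" "\<And>x. 0 \<le> f x" "Tail s p (\<lambda>x. ereal (f x)) x0 r = ennreal \<tau>"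
  shows "(\<integral>\<^sup>+y\<in>- ball x0 r. ennreal (f y powr (p - 1) * frac_kernel s p y x0) \<partial>lborel)
    = ennreal (r powr (- (s * p)) * \<tau> powr (p - 1))"
proof -
  let ?I = "\<integral>\<^sup>+y\<in>- ball x0 r. ennreal (f y powr (p - 1) * frac_kernel s p y x0) \<partial>lborel"
  have "epowr (e2ennreal \<bar>ereal (f y)\<bar>) (p - 1) * ennreal (norm (y - x0) powr (- real DIM('a) - s * p))
      = ennreal (f y powr (p - 1) * frac_kernel s p y x0)" for y
    using assms(4)[of y] by (simp add: epowr_ennreal frac_kernel_def ennreal_mult)
  then have "epowr (ennreal (r powr (s * p)) * ?I) (1 / (p - 1)) = ennreal \<tau>"
    using assms(5) by (simp add: Tail_def nn_integral_completion)
  then have "ennreal (r powr (s * p)) * ?I = ennreal (\<tau> powr (p - 1))"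
    using assms by (intro epowr_root_eq) auto
  then have "ennreal (r powr (- (s * p))) * (ennreal (r powr (s * p)) * ?I) = ennreal (r powr (- (s * p)) * \<tau> powr (p - 1))"
    by (simp add: ennreal_mult)
  moreover have "ennreal (r powr (- (s * p))) * ennreal (r powr (s * p)) = 1"
    using assms by (simp flip: ennreal_mult powr_add)
  ultimately show ?thesis by (simp flip: mult.assoc)
qed

lemma set_nn_integral_of_ball_mean:
  fixes f :: "'a::euclidean_space \<Rightarrow> real"
  assumes "0 < p" "0 < R" "0 \<le> \<mu>" "\<And>x. 0 \<le> f x" "ball_mean p (\<lambda>x. ereal (f x)) x0 R = ennreal \<mu>"
  shows "(\<integral>\<^sup>+x\<in>ball x0 R. ennreal (f x powr p) \<partial>lborel)
    = ennreal (\<mu> powr p * (unit_ball_vol DIM('a) * R ^ DIM('a)))"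
proof -
  let ?J = "\<integral>\<^sup>+x\<in>ball x0 R. ennreal (f x powr p) \<partial>lborel" and ?v = "unit_ball_vol DIM('a) * R ^ DIM('a)"
  have v: "0 < ?v" using assms by simp
  have "epowr (e2ennreal (ereal (f x))) p = ennreal (f x powr p)" for x
    using assms(4)[of x] by (simp add: epowr_ennreal)
  then have "epowr (?J / ennreal ?v) (1 / p) = ennreal \<mu>"
    using assms(2,5) by (simp add: ball_mean_def nn_integral_completion emeasure_ball)
  then have "?J / ennreal ?v = ennreal (\<mu> powr p)" using assms by (intro epowr_root_eq) auto
  moreover have "?J = ?J / ennreal ?v * ennreal ?v"
  proof -
    have "ennreal ?v \<noteq> 0" using v by (simp only: ennreal_eq_0_iff not_le)
    then have "ennreal ?v / ennreal ?v = 1" by (intro ennreal_divide_self) auto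
    then show ?thesis by (simp only: ennreal_divide_times mult_1_right)
  qed
  ultimately show ?thesis using v by (simp add: ennreal_mult)
qed

text \<open>The identity (u - l)_+ = ((u_+ - \<kappa>')_+ - (l - \<kappa>'))_+, valid for l >=
  max(0, \<kappa>') and also for negative \<kappa>', reduces the level l to a nonnegative level for
  the approximated function. Times \<eta>^p, the approximants are supported in the closed ball of
  radius \<rho> < R and off B_R - \<Omega>, hence in \<Omega>.\<close>

lemma tested_below_exterior_sup:
  fixes u u' :: "'a::euclidean_space \<Rightarrow> real"
  assumes s: "0 < s" "s < 1" and p: "1 < p" and \<Lambda>: "1 \<le> \<Lambda>"
    and A: "fast_V_approximation s p \<Omega> (\<lambda>x. max (max (u' x) 0 - \<kappa>') 0) \<psi>"
    and \<psi>: "\<And>j. \<exists>K. K-lipschitz_on UNIV (\<psi> j)" "\<And>j. compact (supp (\<psi> j))" "\<And>j. supp (\<psi> j) \<subseteq> - (ball x0 R - \<Omega>)"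
    and u': "u' \<in> borel_measurable borel" "gagliardo s p (\<Omega> \<times> UNIV) u' < \<infinity>"
    and kb: "kernel_bounds s p \<Lambda> k"
    and test: "\<And>\<phi>. \<phi> \<in> test_functions \<Omega> \<Longrightarrow> (\<And>x. 0 \<le> \<phi> x) \<Longrightarrow>
      (\<integral>\<^sup>+z. ennreal (energy_diff p u' \<phi> (fst z) (snd z)) * k z \<partial>lborel)
       \<le> (\<integral>\<^sup>+z. ennreal (- energy_diff p u' \<phi> (fst z) (snd z)) * k z \<partial>lborel)"
    and l: "0 \<le> l" "\<kappa>' \<le> l" and \<rho>: "\<rho> < R" and d: "0 < d"
    and \<eta>: "\<And>x. 0 \<le> \<eta> x" "\<And>x. \<eta> x \<le> 1" "\<And>x y. \<bar>\<eta> x - \<eta> y\<bar> \<le> norm (x - y) / d"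
      "\<And>x. \<rho> \<le> dist x0 x \<Longrightarrow> \<eta> x = 0"
  shows "tested p k u' (\<lambda>x. \<eta> x powr p * max (u' x - l) 0)"
proof -
  interpret A: fast_V_approximation s p \<Omega> "\<lambda>x. max (max (u' x) 0 - \<kappa>') 0" \<psi> by (rule A)
  define c where "c = l - \<kappa>'"
  have "tested p k u' (\<lambda>x. \<eta> x powr p * max (max (max (u' x) 0 - \<kappa>') 0 - c) 0)"
  proof (rule A.tested_cutoff_truncation[OF _ _ _ _ _ \<Lambda> u' kb test \<psi>(1,2)])
    show "0 \<le> \<eta> x powr p" "\<eta> x powr p \<le> 1" for x
      using \<eta>(1,2)[of x] p powr_mono2[of p "\<eta> x" 1] by auto
    show "\<bar>\<eta> x powr p - \<eta> y powr p\<bar> \<le> p / d * norm (x - y)" for x y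
    proof -
      have "\<bar>\<eta> x powr p - \<eta> y powr p\<bar> \<le> p * \<bar>\<eta> x - \<eta> y\<bar>" using \<eta> p by (intro powr_Lipschitz_unit) auto
      also have "\<dots> \<le> p * (norm (x - y) / d)" using \<eta>(3) p by (intro mult_left_mono) auto
      finally show ?thesis by simp
    qed
    show "0 < p / d" "0 \<le> c" using p d l by (auto simp: c_def)
    fix j
    let ?f = "\<lambda>x. \<eta> x powr p * max (\<psi> j x - c) 0"
    have "supp ?f \<subseteq> cball x0 \<rho>"
      unfolding supp_def
    proof (intro closure_minimal subsetI)
      fix x assume "x \<in> {x. ?f x \<noteq> 0}"
      then have "\<eta> x \<noteq> 0" by auto
      then show "x \<in> cball x0 \<rho>" using \<eta>(4)[of x] by force
    qed simp
    moreover have "supp ?f \<subseteq> supp (\<psi> j)"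
      unfolding supp_def using l by (intro closure_mono) (auto simp: c_def max_def split: if_splits)
    ultimately show "supp ?f \<subseteq> \<Omega>" using \<psi>(3)[of j] \<rho> by force
  qed auto
  moreover have "max (max (max (u' x) 0 - \<kappa>') 0 - c) 0 = max (u' x - l) 0" for x
    using l by (auto simp: c_def max_def)
  ultimately show ?thesis by simp
qed

theorem theorem3p5:
  fixes s p \<Lambda> :: real
  assumes "0 < s" and "s < 1" and "1 \<le> \<Lambda>" and "1 < p" and "p \<le> real DIM('a::euclidean_space) / s"
  shows "\<exists>C>0. \<forall>(k :: 'a \<Rightarrow> 'a \<Rightarrow> ennreal) (\<Omega> :: 'a set) (u :: 'a \<Rightarrow> real) (x0 :: 'a) (R :: real) (\<delta> :: real).
    admissible_kernel s p \<Lambda> k \<longrightarrow> open \<Omega> \<longrightarrow> u \<in> V_space s p \<Omega> \<longrightarrow> weak_subsolution s p k \<Omega> u \<longrightarrow>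
    0 < R \<longrightarrow> 0 < \<delta> \<longrightarrow> \<delta> < 1 \<longrightarrow>
    (let M = exterior_sup s p \<Omega> x0 R u;
         uM = upper_trunc u M
     in wsup s p \<Omega> (ball x0 (R / 2)) uM
        \<le> enn2ereal (ennreal \<delta> * Tail s p uM x0 (R / 2)
            + ennreal (C * \<delta> powr (- ((p - 1) * real DIM('a)) / (s * p\<^sup>2))) * ball_mean p uM x0 R))"
proof -
  note s = assms(1,2) and \<Lambda> = assms(3) and p = assms(4)
  obtain c where c: "0 < c" and De_Giorgi: "\<And>(u :: 'a \<Rightarrow> real) k x0 R l0 h \<delta>.
    u \<in> borel_measurable borel \<Longrightarrow> kernel_bounds s p \<Lambda> k \<Longrightarrow> 0 < R \<Longrightarrow> 0 < h \<Longrightarrow> 0 < \<delta> \<Longrightarrow> \<delta> \<le> 1 \<Longrightarrow>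
    (\<forall>\<eta> l \<rho> d. l0 \<le> l \<longrightarrow> \<rho> < R \<longrightarrow> 0 < d \<longrightarrow> (\<forall>x. 0 \<le> \<eta> x \<and> \<eta> x \<le> 1) \<longrightarrow>
      (\<forall>x y. \<bar>\<eta> x - \<eta> y\<bar> \<le> norm (x - y) / d) \<longrightarrow> (\<forall>x. \<rho> \<le> dist x0 x \<longrightarrow> \<eta> x = 0) \<longrightarrow>
      tested p k u (\<lambda>x. \<eta> x powr p * max (u x - l) 0)) \<Longrightarrow>
    (\<integral>\<^sup>+y\<in>- ball x0 (R / 2). ennreal (max (u y - l0) 0 powr (p - 1) * frac_kernel s p y x0) \<partial>lborel)
      \<le> ennreal ((R / 2) powr (- (s * p)) * (h / \<delta>) powr (p - 1)) \<Longrightarrow>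
    (\<integral>\<^sup>+x\<in>ball x0 R. ennreal (max (u x - l0) 0 powr p) \<partial>lborel)
      \<le> ennreal (c * \<delta> powr ((p - 1) * DIM('a) / (s * p)) * R ^ DIM('a) * h powr p) \<Longrightarrow>
    (AE x in lborel. x \<in> ball x0 (3 * R / 4) \<longrightarrow> u x \<le> l0 + h)"
    using De_Giorgi_bound[OF s p \<Lambda>, where 'a = 'a] by blast
  define n where "n = real DIM('a)"
  define \<omega> where "\<omega> = unit_ball_vol n"
  have \<omega>: "0 < \<omega>" by (simp add: \<omega>_def n_def)
  \<comment> \<open>C1^p = \<omega>/c, where \<omega> R^n is the volume of the ball: this turns the
    mean into the integral that the smallness condition is about.\<close>
  define C1 where "C1 = (\<omega> / c) powr (1 / p)"
  have C1: "0 < C1" using \<omega> c by (simp add: C1_def)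
  \<comment> \<open>The iteration bounds u by base level plus increment. The base level is about m,
    and the summand 1 pays for it through m <= \<mu> <= D \<mu>.\<close>
  define C where "C = 1 + C1"
  have C: "0 < C" using C1 by (simp add: C_def)
  show ?thesis
  proof (intro exI[of _ C] conjI allI impI C)
    fix k :: "'a \<Rightarrow> 'a \<Rightarrow> ennreal" and \<Omega> :: "'a set" and u :: "'a \<Rightarrow> real" and x0 :: 'a and R \<delta> :: real
    assume k: "admissible_kernel s p \<Lambda> k" and \<Omega>: "open \<Omega>" and u: "u \<in> V_space s p \<Omega>"
      and sub: "weak_subsolution s p k \<Omega> u" and R: "0 < R" and \<delta>: "0 < \<delta>" "\<delta> < 1"
    define M where "M = exterior_sup s p \<Omega> x0 R u"
    define uM where "uM = upper_trunc u M"
    \<comment> \<open>The exponent is determined by \<open>e * p\<close>: the p-th power of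
      \<open>D\<close> has to cancel the factor \<delta>^((p-1)n/(sp)) in the smallness
      condition.\<close>
    define e where "e = - ((p - 1) * n) / (s * p\<^sup>2)"
    define D where "D = \<delta> powr e"
    have D: "1 \<le> D"
    proof -
      have "e \<le> 0" unfolding e_def n_def using s p by (simp add: divide_nonpos_pos)
      then show ?thesis using powr_mono2'[of e \<delta> 1] \<delta> by (simp add: D_def)
    qed
    define X where "X = ennreal \<delta> * Tail s p uM x0 (R / 2) + ennreal (C * D) * ball_mean p uM x0 R"
    have "wsup s p \<Omega> (ball x0 (R / 2)) uM \<le> enn2ereal X"
    proof (cases "X = top")
      case False
      then have "Tail s p uM x0 (R / 2) \<noteq> top" "ball_mean p uM x0 R \<noteq> top"
        using \<delta> C D by (auto simp: X_def ennreal_mult_eq_top_iff)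
      then obtain \<tau> \<mu> where \<tau>: "0 \<le> \<tau>" "Tail s p uM x0 (R / 2) = ennreal \<tau>"
        and \<mu>: "0 \<le> \<mu>" "ball_mean p uM x0 R = ennreal \<mu>"
        by (metis ennreal_cases)
      define Xr where "Xr = \<delta> * \<tau> + C * D * \<mu>"
      have Xr: "X = ennreal Xr" "0 \<le> Xr"
        using \<delta> \<tau> \<mu> C D by (auto simp: X_def Xr_def ennreal_mult)
      have "0 \<le> M" by (simp add: M_def exterior_sup_def)
      have "M \<noteq> \<infinity>"
      proof
        assume "M = \<infinity>"
        then have "uM = (\<lambda>x. \<infinity>)" by (simp add: uM_def upper_trunc_def fun_eq_iff max_def)
        then show False using ball_mean_top[OF R, of p x0] \<mu> by simp
      qed
      with \<open>0 \<le> M\<close> obtain m where m: "M = ereal m" "0 \<le> m" by (cases M) auto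
      define v where "v x = max (u x) m" for x
      have v: "0 \<le> v x" for x using m by (simp add: v_def)
      have uM: "uM = (\<lambda>x. ereal (v x))" by (auto simp: uM_def upper_trunc_def v_def m max_def)
      have tail: "(\<integral>\<^sup>+y\<in>- ball x0 (R / 2). ennreal (v y powr (p - 1) * frac_kernel s p y x0) \<partial>lborel)
          = ennreal ((R / 2) powr (- (s * p)) * \<tau> powr (p - 1))"
        using p R \<tau> v by (intro set_nn_integral_of_Tail) (auto simp: uM)
      have mean: "(\<integral>\<^sup>+x\<in>ball x0 R. ennreal (v x powr p) \<partial>lborel) = ennreal (\<mu> powr p * (\<omega> * R ^ DIM('a)))"
        unfolding \<omega>_def n_def using p R \<mu> v by (intro set_nn_integral_of_ball_mean) (auto simp: uM)
      \<comment> \<open>\<open>v\<close> is at least m everywhere, hence so is its mean of order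
        p.\<close>
      have m\<mu>: "m \<le> \<mu>"
      proof -
        have "ennreal (m powr p * (\<omega> * R ^ DIM('a))) = (\<integral>\<^sup>+x\<in>ball x0 R. ennreal (m powr p) \<partial>lborel)"
          using R \<omega> by (simp add: nn_integral_cmult_indicator emeasure_ball \<omega>_def n_def ennreal_mult)
        also have "\<dots> \<le> ennreal (\<mu> powr p * (\<omega> * R ^ DIM('a)))"
          unfolding mean[symmetric] using m p
          by (intro nn_integral_mono mult_right_mono ennreal_leI powr_mono2) (auto simp: v_def)
        finally have "m powr p * (\<omega> * R ^ DIM('a)) \<le> \<mu> powr p * (\<omega> * R ^ DIM('a))"
          using \<omega> R by (subst (asm) ennreal_le_iff) auto
        then have "m powr p \<le> \<mu> powr p" using \<omega> R by simp
        then show ?thesis using powr_less_mono2[of p \<mu> m] p \<mu> by force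
      qed
      have main: "V_le0_on s p \<Omega> (ball x0 (R / 2)) (\<lambda>x. uM x - ereal \<kappa>)" if \<kappa>: "Xr < \<kappa>" for \<kappa>
      proof (cases "\<Omega> = {}")
        case True
        have "u \<in> borel_measurable lebesgue" using u by (simp add: V_space_def)
        then have "(\<lambda>x. v x - \<kappa>) \<in> borel_measurable lebesgue" unfolding v_def by measurable
        from V_le0_on_empty[OF _ this, of p s "ball x0 (R / 2)"] p
        show ?thesis by (simp add: uM True)
      next
        case \<Omega>ne: False
        \<comment> \<open>Half of the gap between \<kappa> and the bound. One half lifts the base
          level strictly above M, so that the infimum yields an admissible level below it; the other
          half keeps h positive even if tail and mean vanish.\<close>
        define \<epsilon> where "\<epsilon> = (\<kappa> - Xr) / 2"
        have \<epsilon>: "0 < \<epsilon>" using \<kappa> by (simp add: \<epsilon>_def)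
        define l0 where "l0 = m + \<epsilon>"
        define h where "h = \<kappa> - l0"
        have "m \<le> D * \<mu>" using m\<mu> D \<mu> mult_right_mono[OF D \<mu>(1)] by linarith
        then have "m + C1 * D * \<mu> \<le> C * D * \<mu>" by (simp add: C_def algebra_simps)
        then have h_ge: "\<delta> * \<tau> + C1 * D * \<mu> + \<epsilon> \<le> h"
          by (simp add: h_def l0_def \<epsilon>_def Xr_def field_simps)
        have n0: "0 \<le> \<delta> * \<tau>" "0 \<le> C1 * D * \<mu>" using \<delta> \<tau> C1 D \<mu> by auto
        have h: "0 < h" "\<delta> * \<tau> \<le> h" "C1 * D * \<mu> \<le> h" using h_ge n0 \<epsilon> by linarith+
        \<comment> \<open>The integral estimates are for Borel functions; u' and k' are
          representatives, and the resulting bound is carried back to u almost everywhere.\<close>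
        have um: "u \<in> borel_measurable lebesgue" using u by (simp add: V_space_def)
        obtain u' where u'm [measurable]: "u' \<in> borel_measurable borel" and uu': "AE x in lborel. u x = u' x"
          using completion_ex_borel_measurable_real[OF um] by auto
        obtain k' where kb: "kernel_bounds s p \<Lambda> k'" and kk': "AE z in lborel. k (fst z) (snd z) = k' z"
          using admissible_kernel_Borel[OF k] by blast
        have gag: "gagliardo s p (\<Omega> \<times> UNIV) u' < \<infinity>"
          using u gagliardo_cong_AE[OF uu', of s p "\<Omega> \<times> UNIV"] by (simp add: V_space_def)
        have "wsup s p \<Omega> (ball x0 R - \<Omega>) (\<lambda>x. ereal (max (u x) 0)) \<le> ereal m"
          using m by (metis M_def exterior_sup_def max.cobounded2)
        also have "\<dots> < ereal l0" using \<epsilon> by (simp add: l0_def)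
        finally obtain \<kappa>' where \<kappa>': "\<kappa>' < l0"
          and le: "V_le0_on s p \<Omega> (ball x0 R - \<Omega>) (\<lambda>x. ereal (max (u x) 0) - ereal \<kappa>')"
          unfolding wsup_def Inf_less_iff by auto
        define g where "g x = max (max (u' x) 0 - \<kappa>') 0" for x
        have gm: "g \<in> borel_measurable borel" unfolding g_def by measurable
        have "AE x in lborel. ereal (g x) = max (ereal (max (u x) 0) - ereal \<kappa>') 0"
          using uu' by eventually_elim (simp only: g_def ereal_minus(1) max_ereal_zero)
        then obtain \<psi> where A: "fast_V_approximation s p \<Omega> g \<psi>" and \<psi>: "\<And>j. \<exists>K. K-lipschitz_on UNIV (\<psi> j)"
          "\<And>j. compact (supp (\<psi> j))" "\<And>j. supp (\<psi> j) \<subseteq> - (ball x0 R - \<Omega>)"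
          using fast_V_approximation_of_V_le0_on[OF s p \<Omega> \<Omega>ne le gm] by blast
        have test: "tested p k' u' (\<lambda>x. \<eta> x powr p * max (u' x - l) 0)"
          if "l0 \<le> l" "\<rho> < R" "0 < d" "\<forall>x. 0 \<le> \<eta> x \<and> \<eta> x \<le> 1" "\<forall>x y. \<bar>\<eta> x - \<eta> y\<bar> \<le> norm (x - y) / d"
            "\<forall>x. \<rho> \<le> dist x0 x \<longrightarrow> \<eta> x = 0" for \<eta> l \<rho> d
          using that m \<epsilon> \<kappa>'
          by (intro tested_below_exterior_sup[OF s p \<Lambda> A[unfolded g_def] \<psi> u'm gag kb subsolution_test[OF sub _ _ uu' kk']])
            (auto simp: l0_def)
        have vu: "max (u x - l0) 0 \<le> v x" for x using m \<epsilon> by (auto simp: v_def l0_def)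
        have "AE x in lborel. x \<in> ball x0 (3 * R / 4) \<longrightarrow> u' x \<le> l0 + h"
        proof (rule De_Giorgi[OF u'm kb R h(1) \<delta>(1)])
          have "(\<integral>\<^sup>+y\<in>- ball x0 (R / 2). ennreal (max (u' y - l0) 0 powr (p - 1) * frac_kernel s p y x0) \<partial>lborel)
            \<le> (\<integral>\<^sup>+y\<in>- ball x0 (R / 2). ennreal (v y powr (p - 1) * frac_kernel s p y x0) \<partial>lborel)"
          proof (rule nn_integral_mono_AE)
            show "AE y in lborel. ennreal (max (u' y - l0) 0 powr (p - 1) * frac_kernel s p y x0) * indicator (- ball x0 (R / 2)) y
              \<le> ennreal (v y powr (p - 1) * frac_kernel s p y x0) * indicator (- ball x0 (R / 2)) y"
              using uu'
            proof eventually_elim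
              case (elim y)
              then show ?case using vu[of y] p by (intro mult_right_mono ennreal_leI powr_mono2) auto
            qed
          qed
          also have "\<dots> \<le> ennreal ((R / 2) powr (- (s * p)) * (h / \<delta>) powr (p - 1))"
            unfolding tail
          proof (intro ennreal_leI mult_left_mono powr_mono2)
            show "\<tau> \<le> h / \<delta>" using h(2) \<delta> by (simp add: field_simps)
          qed (use p \<tau> in auto)
          finally show "(\<integral>\<^sup>+y\<in>- ball x0 (R / 2). ennreal (max (u' y - l0) 0 powr (p - 1) * frac_kernel s p y x0) \<partial>lborel)
            \<le> ennreal ((R / 2) powr (- (s * p)) * (h / \<delta>) powr (p - 1))" .
          have "(\<integral>\<^sup>+x\<in>ball x0 R. ennreal (max (u' x - l0) 0 powr p) \<partial>lborel)
            \<le> (\<integral>\<^sup>+x\<in>ball x0 R. ennreal (v x powr p) \<partial>lborel)"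
          proof (rule nn_integral_mono_AE)
            show "AE x in lborel. ennreal (max (u' x - l0) 0 powr p) * indicator (ball x0 R) x
              \<le> ennreal (v x powr p) * indicator (ball x0 R) x"
              using uu'
            proof eventually_elim
              case (elim x)
              then show ?case using vu[of x] p by (intro mult_right_mono ennreal_leI powr_mono2) auto
            qed
          qed
          also have "\<dots> \<le> ennreal (c * \<delta> powr ((p - 1) * DIM('a) / (s * p)) * R ^ DIM('a) * h powr p)"
            unfolding mean
          proof (intro ennreal_leI)
            have "(C1 * D * \<mu>) powr p \<le> h powr p" using h(3) n0 p by (intro powr_mono2) auto
            moreover have "C1 powr p = \<omega> / c" using \<omega> c p by (simp add: C1_def powr_powr)
            moreover have "D powr p = \<delta> powr (- ((p - 1) * DIM('a) / (s * p)))"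
            proof -
              have "e * p = - ((p - 1) * DIM('a) / (s * p))"
                using s p by (simp add: e_def n_def power2_eq_square)
              then show ?thesis by (simp only: D_def powr_powr)
            qed
            ultimately have "\<omega> / c * \<delta> powr (- ((p - 1) * DIM('a) / (s * p))) * \<mu> powr p \<le> h powr p"
              using C1 D \<mu> by (simp add: powr_mult)
            then have "c * \<delta> powr ((p - 1) * DIM('a) / (s * p)) *
                (\<omega> / c * \<delta> powr (- ((p - 1) * DIM('a) / (s * p))) * \<mu> powr p)
              \<le> c * \<delta> powr ((p - 1) * DIM('a) / (s * p)) * h powr p"
              using c by (intro mult_left_mono) auto
            moreover have "c * \<delta> powr ((p - 1) * DIM('a) / (s * p)) *
                (\<omega> / c * \<delta> powr (- ((p - 1) * DIM('a) / (s * p))) * \<mu> powr p) = \<omega> * \<mu> powr p"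
            proof -
              have "\<delta> powr t * \<delta> powr (- t) = 1" for t using \<delta> by (simp flip: powr_add)
              then show ?thesis using c by (simp add: field_simps)
            qed
            ultimately have "\<omega> * \<mu> powr p \<le> c * \<delta> powr ((p - 1) * DIM('a) / (s * p)) * h powr p" by simp
            from mult_right_mono[OF this, of "R ^ DIM('a)"] R
            show "\<mu> powr p * (\<omega> * R ^ DIM('a)) \<le> c * \<delta> powr ((p - 1) * DIM('a) / (s * p)) * R ^ DIM('a) * h powr p"
              by (simp add: mult_ac)
          qed
          finally show "(\<integral>\<^sup>+x\<in>ball x0 R. ennreal (max (u' x - l0) 0 powr p) \<partial>lborel)
            \<le> ennreal (c * \<delta> powr ((p - 1) * DIM('a) / (s * p)) * R ^ DIM('a) * h powr p)" .
        qed (use \<delta> test in auto)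
        then have small: "AE x in lborel. x \<in> ball x0 (3 * R / 4) \<longrightarrow> u x \<le> \<kappa>"
          using uu' by eventually_elim (simp add: h_def)
        have m\<kappa>: "m < \<kappa>" "\<kappa>' < \<kappa>" using h(1) \<kappa>' \<epsilon> by (auto simp: h_def l0_def)
        interpret A: fast_V_approximation s p \<Omega> g \<psi> by (rule A)
        have "V_le0_on s p \<Omega> (ball x0 (R / 2)) (\<lambda>x. ereal (max (u x) m) - ereal \<kappa>)"
        proof (rule A.V_le0_on_ball[OF u _ _ R _ \<psi>(1,2) _ small, of m "\<kappa> - \<kappa>'"])
          show "AE x in lborel. max (u x - \<kappa>) 0 = max (g x - (\<kappa> - \<kappa>')) 0"
            using uu'
          proof eventually_elim
            case (elim x)
            then show ?case using m\<kappa> m(2) by (auto simp: g_def max_def)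
          qed
        qed (use m m\<kappa> in auto)
        then show ?thesis by (simp add: uM v_def)
      qed
      show ?thesis
      proof (rule ccontr)
        \<comment> \<open>Every real \<kappa> above the right-hand side is an admissible level, so
          the infimum cannot exceed it.\<close>
        assume "\<not> wsup s p \<Omega> (ball x0 (R / 2)) uM \<le> enn2ereal X"
        then have "enn2ereal X < wsup s p \<Omega> (ball x0 (R / 2)) uM" by simp
        then obtain \<kappa> where \<kappa>: "enn2ereal X < ereal \<kappa>" "ereal \<kappa> < wsup s p \<Omega> (ball x0 (R / 2)) uM"
          using ereal_dense2 by blast
        have "Xr < \<kappa>" using \<kappa>(1) Xr by (simp add: enn2ereal_ennreal)
        then have "wsup s p \<Omega> (ball x0 (R / 2)) uM \<le> ereal \<kappa>"
          unfolding wsup_def using main by (intro Inf_lower) auto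
        then show False using \<kappa>(2) by simp
      qed
    qed (simp add: enn2ereal_top)
    then show "let M = exterior_sup s p \<Omega> x0 R u; uM = upper_trunc u M
       in wsup s p \<Omega> (ball x0 (R / 2)) uM
        \<le> enn2ereal (ennreal \<delta> * Tail s p uM x0 (R / 2)
            + ennreal (C * \<delta> powr (- ((p - 1) * real DIM('a)) / (s * p\<^sup>2))) * ball_mean p uM x0 R)"
      by (simp add: M_def uM_def X_def D_def e_def n_def Let_def)
  qed
qed

end
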